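(* Let $G=(V,E)$ be a finite simple graph with an edge $e$. Then $$\beth^{3}(G/e)\le \beth^{3}(G).$$
   Context: All graphs are finite and simple. For an edge $e=uv$, $G/e$ is the simple graph obtained by contracting $e$: the vertices $u,v$ are replaced by a single vertex $v_e$ adjacent to exactly those other vertices that are adjacent to $u$ or $v$ in $G$ (no loops or multiple edges are created). $C(G)$ is the set of all induced cycles in $G$ (of length at least 3). Solid graphs are the graphs of the following four kinds. (1) Pyramid: a graph consisting of a cycle $C$ and a vertex $w\notin V(C)$ together with at least three edges between $w$ and $C$. (2) Trihedron: the union of three paths $P_1,P_2,P_3$, each of length at least 2, having the same two (distinct) endpoints, such that no interior vertex of any of the paths is used in another of the paths. (3) Stamp: the union of a triangle $T$ and three paths $P_1,P_2,P_3$ of length $\ge 1$ that start at the three different vertices of $T$ and all end at the same vertex $x\notin V(T)$, such that the $P_i-x$ are pairwise vertex-disjoint and each $P_i$ meets $T$ only in its starting vertex. (4) Prism: $T\cup T'\cup P_1\cup P_2\cup P_3$ where $T,T'$ are vertex-disjoint triangles with vertices $x_1,x_2,x_3$ and $y_1,y_2,y_3$ respectively, and the $P_i$ are pairwise vertex-disjoint paths from $x_i$ to $y_i$ (so $P_i$ meets $T\cup T'$ only in $x_i,y_i$). A solid in $G$ is an induced subgraph of $G$ that is isomorphic to a solid graph; $S(G)$ is the set of all solids in $G$. The third graph characteristic is $\beth^{3}(G)=|S(G)|-|C(G)|+|E(G)|-|V(G)|$. *)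

theory Defs
  imports Main
begin

text \<open>An edge is the two-element set of its endpoints.\<close>

datatype 'a graph = Graph (verts: "'a set") (edges: "'a set set")

definition fin_simple_graph :: "'a graph \<Rightarrow> bool" where
  "fin_simple_graph G \<longleftrightarrow> finite (verts G) \<and> (\<forall>e\<in>edges G. e \<subseteq> verts G \<and> card e = 2)"

definition graph_iso :: "'a graph \<Rightarrow> 'b graph \<Rightarrow> bool" where
  "graph_iso G H \<longleftrightarrow> (\<exists>f. bij_betw f (verts G) (verts H) \<and> edges H = image f ` edges G)"

definition induced_subgraph :: "'a graph \<Rightarrow> 'a graph \<Rightarrow> bool" where
  "induced_subgraph H G \<longleftrightarrow> verts H \<subseteq> verts G \<and> edges H = {e \<in> edges G. e \<subseteq> verts H}"

definition graph_Union :: "'a graph set \<Rightarrow> 'a graph" where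
  "graph_Union S = Graph (\<Union>(verts ` S)) (\<Union>(edges ` S))"

text \<open>\<^const>\<open>None\<close> is the new vertex, so it is distinct from all remaining vertices.\<close>

definition contract :: "'a graph \<Rightarrow> 'a set \<Rightarrow> 'a option graph" where
  "contract G e = Graph
     (insert None (Some ` (verts G - e)))
     ({{Some a, Some b} | a b. {a, b} \<in> edges G \<and> a \<notin> e \<and> b \<notin> e} \<union>
      {{None, Some a} | a. a \<in> verts G - e \<and> (\<exists>b\<in>e. {a, b} \<in> edges G)})"

text \<open>
  Paths and cycles are listed by their vertices. A path given by the list \<open>p\<close> has length
  \<open>length p - 1\<close>, whereas a cycle given by the list \<open>c\<close> has length \<open>length c\<close>.
\<close>

definition path_graph :: "'a list \<Rightarrow> 'a graph" where
  "path_graph p = Graph (set p) {{p ! i, p ! Suc i} | i. Suc i < length p}"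

definition path_between :: "'a \<Rightarrow> 'a list \<Rightarrow> 'a \<Rightarrow> bool" where
  "path_between a p b \<longleftrightarrow> p \<noteq> [] \<and> distinct p \<and> hd p = a \<and> last p = b"

definition cycle_graph :: "'a list \<Rightarrow> 'a graph" where
  "cycle_graph c = Graph (set c) (insert {last c, hd c} (edges (path_graph c)))"

definition is_cycle :: "'a graph \<Rightarrow> bool" where
  "is_cycle H \<longleftrightarrow> (\<exists>c. distinct c \<and> 3 \<le> length c \<and> H = cycle_graph c)"

definition triangle :: "(nat \<Rightarrow> 'a) \<Rightarrow> 'a graph" where
  "triangle x = Graph {x 1, x 2, x 3} {{x 1, x 2}, {x 1, x 3}, {x 2, x 3}}"

text \<open>\<open>N\<close> is the set of neighbours of the apex \<open>w\<close>.\<close>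

definition pyramid :: "'a graph \<Rightarrow> bool" where
  "pyramid H \<longleftrightarrow> (\<exists>C w N. is_cycle C \<and> w \<notin> verts C \<and> N \<subseteq> verts C \<and> 3 \<le> card N \<and>
     H = Graph (insert w (verts C)) (edges C \<union> {{w, x} | x. x \<in> N}))"

definition trihedron :: "'a graph \<Rightarrow> bool" where
  "trihedron H \<longleftrightarrow> (\<exists>a b (P :: nat \<Rightarrow> 'a list). a \<noteq> b \<and>
     (\<forall>i\<in>{1, 2, 3}. path_between a (P i) b \<and> 2 \<le> length (P i) - 1) \<and>
     (\<forall>i\<in>{1, 2, 3}. \<forall>j\<in>{1, 2, 3}. i \<noteq> j \<longrightarrow> (set (P i) - {a, b}) \<inter> set (P j) = {}) \<and>
     H = graph_Union {path_graph (P i) | i. i \<in> {1, 2, 3}})"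

definition stamp :: "'a graph \<Rightarrow> bool" where
  "stamp H \<longleftrightarrow> (\<exists>(t :: nat \<Rightarrow> 'a) x (P :: nat \<Rightarrow> 'a list).
     inj_on t {1, 2, 3} \<and> x \<notin> verts (triangle t) \<and>
     (\<forall>i\<in>{1, 2, 3}. path_between (t i) (P i) x \<and> 1 \<le> length (P i) - 1 \<and>
        set (P i) \<inter> verts (triangle t) = {t i}) \<and>
     (\<forall>i\<in>{1, 2, 3}. \<forall>j\<in>{1, 2, 3}. i \<noteq> j \<longrightarrow> (set (P i) - {x}) \<inter> (set (P j) - {x}) = {}) \<and>
     H = graph_Union (insert (triangle t) {path_graph (P i) | i. i \<in> {1, 2, 3}}))"

definition prism :: "'a graph \<Rightarrow> bool" where
  "prism H \<longleftrightarrow> (\<exists>(x :: nat \<Rightarrow> 'a) (y :: nat \<Rightarrow> 'a) (P :: nat \<Rightarrow> 'a list).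
     inj_on x {1, 2, 3} \<and> inj_on y {1, 2, 3} \<and> verts (triangle x) \<inter> verts (triangle y) = {} \<and>
     (\<forall>i\<in>{1, 2, 3}. path_between (x i) (P i) (y i) \<and>
        set (P i) \<inter> (verts (triangle x) \<union> verts (triangle y)) = {x i, y i}) \<and>
     (\<forall>i\<in>{1, 2, 3}. \<forall>j\<in>{1, 2, 3}. i \<noteq> j \<longrightarrow> set (P i) \<inter> set (P j) = {}) \<and>
     H = graph_Union ({triangle x, triangle y} \<union> {path_graph (P i) | i. i \<in> {1, 2, 3}}))"

definition solid_graph :: "'a graph \<Rightarrow> bool" where
  "solid_graph H \<longleftrightarrow> pyramid H \<or> trihedron H \<or> stamp H \<or> prism H"

definition induced_cycles :: "'a graph \<Rightarrow> 'a graph set" where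
  "induced_cycles G = {H. induced_subgraph H G \<and> is_cycle H}"

text \<open>
  Taking \<open>K\<close> over the vertex type of \<open>G\<close> is no restriction: an isomorphic copy of \<open>H\<close> over any
  other type can be transported back to \<open>H\<close> itself.
\<close>

definition solids :: "'a graph \<Rightarrow> 'a graph set" where
  "solids G = {H. induced_subgraph H G \<and> (\<exists>K :: 'a graph. solid_graph K \<and> graph_iso H K)}"

definition beth3 :: "'a graph \<Rightarrow> int" where
  "beth3 G = int (card (solids G)) - int (card (induced_cycles G))
     + int (card (edges G)) - int (card (verts G))"

end

theory Submission
  imports Defs
begin

text \<open>
  For a set \<open>A\<close> of vertices avoiding the edge \<open>uv\<close>, compare the induced subgraphs on \<open>A + u\<close>, \<open>A + v\<close>
  and \<open>A + u + v\<close> of \<open>G\<close> with the one on \<open>A + w\<close> of \<open>G/uv\<close>, where \<open>w\<close> is the contracted vertex. All of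
  them live in one graph on the option type with \<open>w = None\<close>. The theorem is the sum over all \<open>A\<close> of a
  local inequality: every solid \<open>A + w\<close> lifts to one of the three sets, and whenever the cycles among
  the three sets outnumber the cycle \<open>A + w\<close>, the surplus is paid for by \<open>A + u + v\<close> being solid or by
  the triangle on \<open>u\<close>, \<open>v\<close> and a common neighbour, which corresponds to an edge lost in the contraction.

  Lifting rests on a uniform description of solids. Let \<open>C\<close> be an induced cycle and \<open>Q\<close> a connected set
  disjoint from \<open>C\<close> whose neighbours on \<open>C\<close> do not all lie on one edge of \<open>C\<close>. If \<open>Q\<close> is minimal with
  this property then \<open>C \<union> Q\<close> is solid, and conversely a vertex of a solid can be placed in such a \<open>Q\<close>
  unless it is an end of a trihedron or the apex of a stamp. Minimality is inherited when a vertex of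
  \<open>Q\<close> is split into \<open>u\<close> and \<open>v\<close>, so no case distinction over the kinds of solids is needed.
\<close>

subsection \<open>Induced paths and cycles\<close>

text \<open>In the alternating count the lost vertex cancels against the lost edge
  \<open>uv\<close>, so beyond cycles and solids exactly one unit per common neighbour of
  \<open>u\<close> and \<open>v\<close> is available. The local inequality is tractable because of a
  dichotomy. A cycle on \<open>A + u\<close>, \<open>A + v\<close> or \<open>A + u + v\<close>
  forces \<open>A\<close> to induce a path, whereas \<open>A + w\<close> is never solid when
  \<open>A\<close> induces a path. So lifting a solid and paying for surplus cycles never have to be
  done for the same \<open>A\<close>. Not lying on one edge of the cycle is a condition on
  attachments that is stable in both directions: it survives splitting \<open>w\<close> inside the
  ear, and it survives merging \<open>u\<close> and \<open>v\<close> again. This is why a minimal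
  ear found after the splitting projects back onto the original one. The obstacle is an end of a
  trihedron: all three induced cycles pass through both ends, so no ear contains one. There the
  cycle itself must change, with \<open>w\<close> replaced by the edge \<open>uv\<close>; the apex
  of a stamp is treated by the same argument.\<close>

definition path_edges :: "'a list \<Rightarrow> 'a set set" where
  "path_edges p = edges (path_graph p)"

lemma path_edges_Nil [simp]: "path_edges [] = {}"
  and path_edges_single [simp]: "path_edges [x] = {}"
  by (auto simp: path_edges_def path_graph_def)

lemma path_edges_Cons: "path_edges (x # p) = (if p = [] then {} else insert {x, hd p} (path_edges p))"
proof (cases p)
  case (Cons y q)
  have "{{(x # p) ! i, (x # p) ! Suc i} |i. Suc i < length (x # p)}
      = insert {x, hd p} {{p ! i, p ! Suc i} |i. Suc i < length p}" (is "?L = ?R")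
  proof (intro equalityI subsetI)
    fix e assume "e \<in> ?L"
    then obtain i where i: "Suc i < length (x # p)" "e = {(x # p) ! i, (x # p) ! Suc i}" by blast
    show "e \<in> ?R"
      using i Cons by (cases i) auto
  next
    fix e assume "e \<in> ?R"
    then consider "e = {x, hd p}" | i where "Suc i < length p" "e = {p ! i, p ! Suc i}" by blast
    then show "e \<in> ?L"
    proof cases
      case 1
      then show ?thesis using Cons by (auto intro!: exI[of _ 0])
    next
      case 2
      then show ?thesis by (auto intro!: exI[of _ "Suc i"])
    qed
  qed
  then show ?thesis using Cons by (simp add: path_edges_def path_graph_def)
qed auto

lemma path_graph_eq: "path_graph p = Graph (set p) (path_edges p)"
  by (simp add: path_edges_def path_graph_def)

lemma path_edges_subset: "f \<in> path_edges p \<Longrightarrow> f \<subseteq> set p"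
  by (induction p) (auto simp: path_edges_Cons split: if_splits)

lemma path_edges_pair: "f \<in> path_edges p \<Longrightarrow> \<exists>x y. f = {x, y}"
  by (induction p) (auto simp: path_edges_Cons split: if_splits)

text \<open>A relation without a vertex set: the graphs to be compared are all induced by vertex
  sets in one fixed relation, so being a cycle or a solid becomes a property of sets.\<close>

locale adjacency =
  fixes E :: "'a \<Rightarrow> 'a \<Rightarrow> bool"
  assumes sym: "E x y \<Longrightarrow> E y x" and irrefl [simp]: "\<not> E x x"
begin

lemma E_commute: "E x y \<longleftrightarrow> E y x"
  using sym by blast

definition induced :: "'a set \<Rightarrow> 'a graph" where
  "induced S = Graph S {{x, y} | x y. x \<in> S \<and> y \<in> S \<and> E x y}"

lemma verts_induced [simp]: "verts (induced S) = S"
  by (simp add: induced_def)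

lemma edge_induced [simp]: "{x, y} \<in> edges (induced S) \<longleftrightarrow> x \<in> S \<and> y \<in> S \<and> E x y"
  by (auto simp: induced_def doubleton_eq_iff E_commute)

lemma edge_inducedE:
  assumes "f \<in> edges (induced S)"
  obtains x y where "f = {x, y}" "x \<in> S" "y \<in> S" "E x y"
  using assms by (auto simp: induced_def)

lemma induced_eqI:
  assumes "verts H = S" "\<And>f. f \<in> edges H \<Longrightarrow> \<exists>x y. f = {x, y}"
    and "\<And>x y. {x, y} \<in> edges H \<longleftrightarrow> x \<in> S \<and> y \<in> S \<and> E x y"
  shows "induced S = H"
proof -
  have "f \<in> edges (induced S) \<longleftrightarrow> f \<in> edges H" for f
  proof
    assume "f \<in> edges (induced S)"
    then show "f \<in> edges H" using assms(3) by (auto elim!: edge_inducedE)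
  next
    assume f: "f \<in> edges H"
    then obtain x y where "f = {x, y}" using assms(2) by blast
    then show "f \<in> edges (induced S)" using assms(3) f by auto
  qed
  then have "edges (induced S) = edges H" by blast
  then show ?thesis using assms(1) by (cases H) (simp add: induced_def)
qed

fun ipath :: "'a list \<Rightarrow> bool" where
  "ipath [] \<longleftrightarrow> True"
| "ipath (x # p) \<longleftrightarrow> ipath p \<and> x \<notin> set p \<and> (\<forall>z\<in>set p. E x z \<longleftrightarrow> z = hd p)"

lemma ipath_distinct: "ipath p \<Longrightarrow> distinct p"
  by (induction p) auto

lemma ipath_append: "ipath (p @ q) \<longleftrightarrow> ipath p \<and> ipath q \<and> set p \<inter> set q = {} \<and>
   (\<forall>x\<in>set p. \<forall>y\<in>set q. E x y \<longleftrightarrow> x = last p \<and> y = hd q)"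
proof (induction p)
  case (Cons a p)
  show ?case
  proof (cases "p = []")
    case False
    then have "last p \<in> set p" "hd p \<in> set p" by auto
    moreover from this have "set p \<inter> set q = {} \<Longrightarrow> hd p \<notin> set q" by blast
    ultimately show ?thesis using Cons False by (auto simp: hd_append)
  qed auto
qed auto

lemma ipath_rev [simp]: "ipath (rev p) \<longleftrightarrow> ipath p"
  by (induction p) (auto simp: ipath_append last_rev E_commute)

lemma ipath_iff:
  "ipath p \<longleftrightarrow> distinct p \<and> (\<forall>x\<in>set p. \<forall>y\<in>set p. E x y \<longleftrightarrow> {x, y} \<in> path_edges p)"
proof (induction p)
  case (Cons a p)
  show ?case
  proof (cases "a \<in> set p")
    case False
    have *: "{a, y} \<notin> path_edges p" "{y, a} \<notin> path_edges p" for y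
      using path_edges_subset[of "{a, y}" p] path_edges_subset[of "{y, a}" p] False by auto
    have "p \<noteq> [] \<Longrightarrow> hd p \<in> set p" by simp
    then show ?thesis using False Cons * *(1)[of a]
      by (auto simp: path_edges_Cons doubleton_eq_iff E_commute)
  qed auto
qed auto

text \<open>A cycle is a base vertex together with an induced path on which the base sees exactly
  the two ends. In a triangle the path has two vertices, both of them ends.\<close>

definition icycle :: "'a list \<Rightarrow> bool" where
  "icycle c \<longleftrightarrow> 3 \<le> length c \<and> ipath (tl c) \<and> hd c \<notin> set (tl c) \<and>
     (\<forall>z\<in>set (tl c). E (hd c) z \<longleftrightarrow> z = hd (tl c) \<or> z = last c)"

lemma icycle_Cons: "icycle (x # p) \<longleftrightarrow> 2 \<le> length p \<and> ipath p \<and> x \<notin> set p \<and>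
     (\<forall>z\<in>set p. E x z \<longleftrightarrow> z = hd p \<or> z = last p)"
  by (auto simp: icycle_def)

text \<open>The choice of the base vertex is immaterial; this is the single step behind reading a
  cycle from any of its vertices.\<close>

lemma icycle_rotate1:
  assumes "icycle (x # p)"
  shows "icycle (p @ [x])"
proof -
  obtain y q where "p = y # q" using assms by (cases p) (auto simp: icycle_def)
  with assms have p: "p = y # q" "q \<noteq> []" by (auto simp: icycle_def)
  have yq: "ipath q" "y \<notin> set q" "\<And>z. z \<in> set q \<Longrightarrow> E y z \<longleftrightarrow> z = hd q"
    and x: "x \<notin> set q" "x \<noteq> y" "E x y" "\<And>z. z \<in> set q \<Longrightarrow> E x z \<longleftrightarrow> z = last q"
    using assms p by (auto simp: icycle_Cons)
  have "ipath (q @ [x])"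
    using yq x by (auto simp: ipath_append E_commute[of _ x])
  moreover have "E y z \<longleftrightarrow> z = hd q \<or> z = x" if "z \<in> set (q @ [x])" for z
    using that x yq sym[OF x(3)] p(2) by auto
  moreover have "2 \<le> length (q @ [x])" using p(2) by (cases q) auto
  ultimately show ?thesis using p x yq by (simp add: icycle_Cons)
qed

lemma icycle_rotate: "icycle (p @ q) \<Longrightarrow> icycle (q @ p)"
proof (induction p arbitrary: q)
  case (Cons a p)
  then have "icycle (p @ (q @ [a]))" using icycle_rotate1[of a "p @ q"] by simp
  then show ?case using Cons.IH[of "q @ [a]"] by simp
qed auto

lemma icycle_rev_Cons: "icycle (x # p) \<Longrightarrow> icycle (x # rev p)"
  by (cases "p = []") (auto simp: icycle_Cons hd_rev last_rev)

lemma icycle_at: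
  assumes "icycle c" "x \<in> set c"
  obtains p where "icycle (x # p)" "set c = insert x (set p)"
proof -
  obtain p q where "c = p @ x # q" using assms(2) by (meson split_list)
  then show thesis using that[of "q @ p"] icycle_rotate[of p "x # q"] assms(1) by auto
qed

lemma cycle_graph_Cons: "p \<noteq> [] \<Longrightarrow>
  cycle_graph (x # p) = Graph (set (x # p)) ({{x, hd p}, {x, last p}} \<union> path_edges p)"
  by (auto simp: cycle_graph_def path_edges_def[symmetric] path_edges_Cons insert_commute)

lemma icycle_graph: "icycle c \<Longrightarrow> induced (set c) = cycle_graph c"
proof (cases c)
  case (Cons x p)
  assume c: "icycle c"
  then have p: "p \<noteq> []" "ipath p" "x \<notin> set p"
    and E: "\<And>z. z \<in> set p \<Longrightarrow> E x z \<longleftrightarrow> z = hd p \<or> z = last p"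
    using Cons by (auto simp: icycle_Cons)
  have *: "{x, y} \<notin> path_edges p" "{y, x} \<notin> path_edges p" for y
    using path_edges_subset[of "{x, y}" p] path_edges_subset[of "{y, x}" p] p by auto
  have **: "{y, z} \<in> path_edges p \<longleftrightarrow> y \<in> set p \<and> z \<in> set p \<and> E y z" for y z
    using path_edges_subset[of "{y, z}" p] p by (auto simp: ipath_iff)
  have hl: "hd p \<in> set p" "last p \<in> set p" using p by auto
  show ?thesis unfolding Cons cycle_graph_Cons[OF p(1)]
  proof (rule induced_eqI)
    fix y z
    show "{y, z} \<in> edges (Graph (set (x # p)) ({{x, hd p}, {x, last p}} \<union> path_edges p)) \<longleftrightarrow>
      y \<in> set (x # p) \<and> z \<in> set (x # p) \<and> E y z"
      using * ** hl p E E_commute[of y x] by (auto simp: doubleton_eq_iff)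
  qed (auto simp: path_edges_pair)
qed (auto simp: icycle_def)

lemma cycle_graph_icycle:
  assumes "distinct c" "3 \<le> length c" "induced S = cycle_graph c"
  shows "icycle c \<and> set c = S"
proof (cases c)
  case (Cons x p)
  have p: "p \<noteq> []" "2 \<le> length p" "x \<notin> set p" "distinct p" using assms Cons by auto
  have eq: "induced S = Graph (set (x # p)) ({{x, hd p}, {x, last p}} \<union> path_edges p)"
    using assms(3) cycle_graph_Cons[OF p(1)] Cons by simp
  then have S: "S = set (x # p)" by (metis graph.sel(1) verts_induced)
  have ed: "{y, z} \<in> {{x, hd p}, {x, last p}} \<union> path_edges p \<longleftrightarrow> y \<in> S \<and> z \<in> S \<and> E y z" for y z
    using edge_induced[of y z S] unfolding eq by simp
  have *: "{x, y} \<notin> path_edges p" "{y, x} \<notin> path_edges p" for y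
    using path_edges_subset[of "{x, y}" p] path_edges_subset[of "{y, x}" p] p by auto
  have "ipath p" unfolding ipath_iff
  proof (intro conjI ballI)
    fix y z assume "y \<in> set p" "z \<in> set p"
    then show "E y z \<longleftrightarrow> {y, z} \<in> path_edges p"
      using ed[of y z] S p by (auto simp: doubleton_eq_iff)
  qed (use p in auto)
  moreover have "E x z \<longleftrightarrow> z = hd p \<or> z = last p" if "z \<in> set p" for z
    using ed[of x z] S p * that by (auto simp: doubleton_eq_iff)
  ultimately show ?thesis using p S Cons by (auto simp: icycle_Cons)
qed (use assms in auto)

definition cyc :: "'a set \<Rightarrow> bool" where "cyc S \<longleftrightarrow> is_cycle (induced S)"

lemma icycle_distinct: "icycle c \<Longrightarrow> distinct c"
  by (cases c) (auto simp: icycle_Cons ipath_distinct)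

lemma cyc_iff: "cyc S \<longleftrightarrow> (\<exists>c. icycle c \<and> set c = S)"
proof
  assume "cyc S"
  then show "\<exists>c. icycle c \<and> set c = S"
    unfolding cyc_def is_cycle_def using cycle_graph_icycle by blast
next
  assume "\<exists>c. icycle c \<and> set c = S"
  then obtain c where "icycle c" "set c = S" by blast
  then show "cyc S" unfolding cyc_def is_cycle_def
    using icycle_graph icycle_distinct icycle_def by (intro exI[of _ c]) auto
qed

end

subsection \<open>The four kinds of solids\<close>

lemma path_edges_distinct: "distinct p \<Longrightarrow> {x} \<notin> path_edges p"
  by (induction p) (auto simp: path_edges_Cons)

text \<open>In a trihedron this excludes the edge \<open>ab\<close>, the only chord that one path
  could receive from another.\<close>

lemma path_edges_ends: "distinct p \<Longrightarrow> 3 \<le> length p \<Longrightarrow> {hd p, last p} \<notin> path_edges p"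
proof (cases p)
  case (Cons a q)
  assume "distinct p" "3 \<le> length p"
  then have "a \<notin> set q" "q \<noteq> []" "last q \<noteq> hd q" using Cons by (cases q; auto split: if_splits)+
  then show ?thesis using Cons path_edges_subset[of "{a, last q}" q]
    by (auto simp: path_edges_Cons doubleton_eq_iff)
qed auto

lemma path_edges_mem: "{x, y} \<in> path_edges p \<Longrightarrow> x \<in> set p \<and> y \<in> set p"
  using path_edges_subset by fastforce

lemma edges_triangle:
  "edges (triangle t) = {{t i, t j} | i j. i \<in> {1, 2, 3} \<and> j \<in> {1, 2, 3} \<and> i \<noteq> j}" (is "_ = ?R")
proof
  show "edges (triangle t) \<subseteq> ?R"
  proof
    fix f assume "f \<in> edges (triangle t)"
    then consider "f = {t 1, t 2}" | "f = {t 1, t 3}" | "f = {t 2, t 3}" by (auto simp: triangle_def)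
    then show "f \<in> ?R"
    proof cases
      case 1 then show ?thesis by (intro CollectI exI[of _ 1] exI[of _ 2]) simp
    next
      case 2 then show ?thesis by (intro CollectI exI[of _ 1] exI[of _ 3]) simp
    next
      case 3 then show ?thesis by (intro CollectI exI[of _ 2] exI[of _ 3]) simp
    qed
  qed
  show "?R \<subseteq> edges (triangle t)"
    by (auto simp: triangle_def insert_commute)
qed

lemma edge_triangle_iff:
  "{x, y} \<in> edges (triangle t) \<longleftrightarrow> (\<exists>i\<in>{1, 2, 3}. \<exists>j\<in>{1, 2, 3}. i \<noteq> j \<and> x = t i \<and> y = t j)"
  unfolding edges_triangle by (simp only: mem_Collect_eq doubleton_eq_iff) metis

lemma edge_Union_triangle:
  "{x, y} \<in> \<Union>(edges ` {triangle t}) \<longleftrightarrow> (\<exists>i\<in>{1, 2, 3}. \<exists>j\<in>{1, 2, 3}. i \<noteq> j \<and> x = t i \<and> y = t j)"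
  "{x, y} \<in> \<Union>(edges ` {triangle t, triangle s}) \<longleftrightarrow> (\<exists>i\<in>{1, 2, 3}. \<exists>j\<in>{1, 2, 3}. i \<noteq> j \<and> (x = t i \<and> y = t j \<or> x = s i \<and> y = s j))"
  by (simp_all only: image_insert image_empty Union_insert Union_empty Un_iff empty_iff simp_thms
    edge_triangle_iff conj_disj_distribL bex_disj_distrib)

lemma edge_triangleE:
  assumes "f \<in> edges (triangle t)"
  obtains i j where "i \<in> {1, 2, 3}" "j \<in> {1, 2, 3}" "i \<noteq> j" "f = {t i, t j}"
  using assms unfolding edges_triangle by blast

lemma verts_triangle: "verts (triangle t) = t ` {1, 2, 3}"
  by (auto simp: triangle_def)

lemma edges_graph_Union_paths:
  "edges (graph_Union (T \<union> {path_graph (P i) | i. i \<in> I})) = \<Union>(edges ` T) \<union> (\<Union>i\<in>I. path_edges (P i))"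
  "verts (graph_Union (T \<union> {path_graph (P i) | i. i \<in> I})) = \<Union>(verts ` T) \<union> (\<Union>i\<in>I. set (P i))"
  by (auto simp: graph_Union_def path_graph_eq)

lemma Int_image_single:
  assumes "\<And>k. k \<in> I \<Longrightarrow> f k \<in> X \<Longrightarrow> k = i" "i \<in> I" "f i \<in> X"
  shows "X \<inter> f ` I = {f i}"
  using assms by blast

lemma image_disjoint: "(\<And>i j. i \<in> I \<Longrightarrow> j \<in> J \<Longrightarrow> f i \<noteq> g j) \<Longrightarrow> f ` I \<inter> g ` J = {}"
  by blast

context adjacency begin

lemma edge_ind_iff: "induced S = H \<Longrightarrow> {x, y} \<in> edges H \<longleftrightarrow> x \<in> S \<and> y \<in> S \<and> E x y"
  by auto

lemma ipath_mem: "ipath p \<Longrightarrow> {x, y} \<in> path_edges p \<longleftrightarrow> x \<in> set p \<and> y \<in> set p \<and> E x y"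
  by (metis ipath_iff path_edges_mem)

text \<open>In an induced subgraph the set \<open>N\<close> of the definition can only be the set of
  all neighbours of the apex on the rim, so it disappears.\<close>

lemma pyramid_iff: "pyramid (induced S) \<longleftrightarrow>
  (\<exists>c w. icycle c \<and> w \<notin> set c \<and> 3 \<le> card {x \<in> set c. E w x} \<and> S = insert w (set c))"
proof
  assume "pyramid (induced S)"
  then obtain C w N c where w: "w \<notin> verts C" "N \<subseteq> verts C" "3 \<le> card N"
    and C: "distinct c" "3 \<le> length c" "C = cycle_graph c"
    and S: "induced S = Graph (insert w (verts C)) (edges C \<union> {{w, x} | x. x \<in> N})"
    unfolding pyramid_def is_cycle_def by (elim exE conjE) (rule that; assumption)
  have vC: "verts C = set c" using C by (simp add: cycle_graph_def)
  have S': "S = insert w (set c)" using arg_cong[OF S, of verts] vC by simp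
  have inC: "f \<in> edges C \<Longrightarrow> f \<subseteq> set c" for f
  proof -
    have "c \<noteq> []" using C by auto
    then show "f \<in> edges C \<Longrightarrow> f \<subseteq> set c"
      using C path_edges_subset[of f c] by (auto simp: cycle_graph_def path_edges_def[symmetric])
  qed
  have ed: "{y, z} \<in> edges C \<union> {{w, x} | x. x \<in> N} \<longleftrightarrow> y \<in> S \<and> z \<in> S \<and> E y z" for y z
    using edge_ind_iff[OF S] by simp
  have "induced (set c) = C"
  proof (rule induced_eqI)
    show "\<exists>x y. f = {x, y}" if "f \<in> edges C" for f
      using that C by (auto simp: cycle_graph_def path_edges_def[symmetric] dest: path_edges_pair)
    fix y z
    show "{y, z} \<in> edges C \<longleftrightarrow> y \<in> set c \<and> z \<in> set c \<and> E y z"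
      using ed[of y z] inC[of "{y, z}"] w S' vC by (auto simp: doubleton_eq_iff)
  qed (use vC in auto)
  then have "icycle c" using cycle_graph_icycle[of c "set c"] C by simp
  moreover have "{x \<in> set c. E w x} = N"
    using ed[of w] inC[of "{w, _}"] w S' vC by (auto simp: doubleton_eq_iff)
  ultimately show "\<exists>c w. icycle c \<and> w \<notin> set c \<and> 3 \<le> card {x \<in> set c. E w x} \<and> S = insert w (set c)"
    using w vC S' by auto
next
  assume "\<exists>c w. icycle c \<and> w \<notin> set c \<and> 3 \<le> card {x \<in> set c. E w x} \<and> S = insert w (set c)"
  then obtain c w where c: "icycle c" "w \<notin> set c" "3 \<le> card {x \<in> set c. E w x}" "S = insert w (set c)"
    by blast
  have "induced S = Graph (insert w (set c)) (edges (induced (set c)) \<union> {{w, x} | x. x \<in> {x \<in> set c. E w x}})"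
  proof (rule induced_eqI)
    fix x y
    show "({x, y} \<in> edges (Graph (insert w (set c)) (edges (induced (set c)) \<union> {{w, x} |x. x \<in> {x \<in> set c. E w x}}))) =
           (x \<in> S \<and> y \<in> S \<and> E x y)"
      using c by (auto simp: doubleton_eq_iff sym)
  next
    show "\<exists>x y. f = {x, y}"
      if "f \<in> edges (Graph (insert w (set c)) (edges (induced (set c)) \<union> {{w, x} |x. x \<in> {x \<in> set c. E w x}}))" for f
      using that by (auto elim!: edge_inducedE)
  qed (use c in simp)
  moreover have "is_cycle (induced (set c))" using c cyc_def cyc_iff by blast
  ultimately show "pyramid (induced S)"
    unfolding pyramid_def using c
    by (intro exI[of _ "induced (set c)"] exI[of _ w] exI[of _ "{x \<in> set c. E w x}"]) auto
qed

text \<open>Common to trihedra, stamps and prisms: \<open>T\<close> holds the triangles (none, one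
  or two) and the \<open>P i\<close> are the paths. The premise \<open>complete\<close> says that an
  edge outside the triangles stays within a single path.\<close>

lemma induced_graph_UnionI:
  assumes ip: "\<And>i. i \<in> I \<Longrightarrow> ipath (P i)" and S: "S = (\<Union>i\<in>I. set (P i))" "\<Union>(verts ` T) \<subseteq> S"
    and sound: "\<And>f. f \<in> \<Union>(edges ` T) \<Longrightarrow> \<exists>x\<in>S. \<exists>y\<in>S. f = {x, y} \<and> E x y"
    and complete: "\<And>x y. x \<in> S \<Longrightarrow> y \<in> S \<Longrightarrow> E x y \<Longrightarrow>
      {x, y} \<in> \<Union>(edges ` T) \<or> (\<exists>i\<in>I. x \<in> set (P i) \<and> y \<in> set (P i))"
  shows "induced S = graph_Union (T \<union> {path_graph (P i) | i. i \<in> I})" (is "_ = ?G")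
proof (rule induced_eqI)
  have ed: "edges ?G = \<Union>(edges ` T) \<union> (\<Union>i\<in>I. path_edges (P i))" by (rule edges_graph_Union_paths)
  show "verts ?G = S" using S unfolding edges_graph_Union_paths by blast
  show "\<exists>x y. f = {x, y}" if "f \<in> edges ?G" for f
    using that sound path_edges_pair unfolding ed by blast
  fix x y
  show "{x, y} \<in> edges ?G \<longleftrightarrow> x \<in> S \<and> y \<in> S \<and> E x y"
  proof
    assume "{x, y} \<in> edges ?G"
    then consider "{x, y} \<in> \<Union>(edges ` T)" | i where "i \<in> I" "{x, y} \<in> path_edges (P i)"
      unfolding ed by blast
    then show "x \<in> S \<and> y \<in> S \<and> E x y"
    proof cases
      case 1
      then show ?thesis using sound[OF 1] sym by (auto simp: doubleton_eq_iff)
    next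
      case 2
      then show ?thesis using ipath_mem[OF ip] S(1) by blast
    qed
  next
    assume xy: "x \<in> S \<and> y \<in> S \<and> E x y"
    then consider "{x, y} \<in> \<Union>(edges ` T)" | i where "i \<in> I" "x \<in> set (P i)" "y \<in> set (P i)"
      using complete by metis
    then show "{x, y} \<in> edges ?G" unfolding ed using ipath_mem[OF ip] xy by cases blast+
  qed
qed

text \<open>The converse reading. A path of the solid is induced once neither a triangle nor another
  path contributes an edge between two of its vertices.\<close>

lemma induced_graph_UnionD:
  assumes eq: "induced S = graph_Union (T \<union> {path_graph (P i) | i. i \<in> I})"
    and T: "\<Union>(verts ` T) \<subseteq> (\<Union>i\<in>I. set (P i))"
  shows "S = (\<Union>i\<in>I. set (P i))"
    and "x \<in> set (P i) \<Longrightarrow> y \<in> set (P j) \<Longrightarrow> i \<in> I \<Longrightarrow> j \<in> I \<Longrightarrow>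
      E x y \<longleftrightarrow> {x, y} \<in> \<Union>(edges ` T) \<or> (\<exists>i\<in>I. {x, y} \<in> path_edges (P i))"
    and "i \<in> I \<Longrightarrow> distinct (P i) \<Longrightarrow>
      (\<And>x y. x \<in> set (P i) \<Longrightarrow> y \<in> set (P i) \<Longrightarrow> {x, y} \<notin> \<Union>(edges ` T)) \<Longrightarrow>
      (\<And>j x y. j \<in> I \<Longrightarrow> x \<in> set (P i) \<Longrightarrow> y \<in> set (P i) \<Longrightarrow> {x, y} \<in> path_edges (P j) \<Longrightarrow> j = i) \<Longrightarrow> ipath (P i)"
proof -
  show S: "S = (\<Union>i\<in>I. set (P i))"
    using arg_cong[OF eq, of verts] T unfolding edges_graph_Union_paths by auto
  have ed: "{x, y} \<in> \<Union>(edges ` T) \<or> (\<exists>i\<in>I. {x, y} \<in> path_edges (P i)) \<longleftrightarrow> x \<in> S \<and> y \<in> S \<and> E x y" for x y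
    using edge_ind_iff[OF eq, of x y] unfolding edges_graph_Union_paths by simp
  then show E: "E x y \<longleftrightarrow> {x, y} \<in> \<Union>(edges ` T) \<or> (\<exists>i\<in>I. {x, y} \<in> path_edges (P i))"
    if "x \<in> set (P i)" "y \<in> set (P j)" "i \<in> I" "j \<in> I" for x y i j
    using that S by blast
  assume "i \<in> I" "distinct (P i)"
    "\<And>x y. x \<in> set (P i) \<Longrightarrow> y \<in> set (P i) \<Longrightarrow> {x, y} \<notin> \<Union>(edges ` T)"
    "\<And>j x y. j \<in> I \<Longrightarrow> x \<in> set (P i) \<Longrightarrow> y \<in> set (P i) \<Longrightarrow> {x, y} \<in> path_edges (P j) \<Longrightarrow> j = i"
  then show "ipath (P i)" unfolding ipath_iff using E by metis
qed

text \<open>Prescribes all adjacencies between two disjoint pieces. The three relations abbreviated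
  below belong to two paths of a trihedron (interiors only), of a stamp (without the apex) and of a
  prism.\<close>

definition joined :: "'a list \<Rightarrow> 'a list \<Rightarrow> ('a \<Rightarrow> 'a \<Rightarrow> bool) \<Rightarrow> bool" where
  "joined p q R \<longleftrightarrow> set p \<inter> set q = {} \<and> (\<forall>x\<in>set p. \<forall>y\<in>set q. E x y \<longleftrightarrow> R x y)"

abbreviation apart :: "'a list \<Rightarrow> 'a list \<Rightarrow> bool" where
  "apart p q \<equiv> joined p q (\<lambda>_ _. False)"

abbreviation heads_joined :: "'a list \<Rightarrow> 'a list \<Rightarrow> bool" where
  "heads_joined p q \<equiv> joined p q (\<lambda>x y. x = hd p \<and> y = hd q)"

abbreviation ends_joined :: "'a list \<Rightarrow> 'a list \<Rightarrow> bool" where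
  "ends_joined p q \<equiv> joined p q (\<lambda>x y. x = hd p \<and> y = hd q \<or> x = last p \<and> y = last q)"

lemma joinedI:
  assumes "set p \<inter> set q = {}" "\<And>x y. x \<in> set p \<Longrightarrow> y \<in> set q \<Longrightarrow> E x y \<longleftrightarrow> R x y"
  shows "joined p q R"
  using assms by (simp add: joined_def)

lemma joinedD:
  assumes "joined p q R"
  shows "set p \<inter> set q = {}" "\<And>x y. x \<in> set p \<Longrightarrow> y \<in> set q \<Longrightarrow> E x y \<longleftrightarrow> R x y"
  using assms by (auto simp: joined_def)

text \<open>\<open>p i\<close> is the interior of a path of the trihedron, so being nonempty encodes
  length at least 2.\<close>

definition theta :: "'a \<Rightarrow> 'a \<Rightarrow> (nat \<Rightarrow> 'a list) \<Rightarrow> 'a set \<Rightarrow> bool" where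
  "theta a b p S \<longleftrightarrow> (\<forall>i\<in>{1, 2, 3}. p i \<noteq> [] \<and> ipath (a # p i @ [b])) \<and>
    (\<forall>i\<in>{1, 2, 3}. \<forall>j\<in>{1, 2, 3}. i \<noteq> j \<longrightarrow> apart (p i) (p j)) \<and>
    S = {a, b} \<union> (\<Union>i\<in>{1, 2, 3}. set (p i))"

lemma thetaI:
  assumes "\<And>i. i \<in> {1, 2, 3} \<Longrightarrow> p i \<noteq> [] \<and> ipath (a # p i @ [b])"
    and "\<And>i j. i \<in> {1, 2, 3} \<Longrightarrow> j \<in> {1, 2, 3} \<Longrightarrow> i \<noteq> j \<Longrightarrow> apart (p i) (p j)"
    and "S = {a, b} \<union> (\<Union>i\<in>{1, 2, 3}. set (p i))"
  shows "theta a b p S"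
  unfolding theta_def by (rule conjI[OF ballI conjI[OF _ assms(3)]]) (use assms in blast)+

lemma thetaD:
  assumes "theta a b p S"
  shows "i \<in> {1, 2, 3} \<Longrightarrow> p i \<noteq> [] \<and> ipath (a # p i @ [b])"
    and "i \<in> {1, 2, 3} \<Longrightarrow> j \<in> {1, 2, 3} \<Longrightarrow> i \<noteq> j \<Longrightarrow> apart (p i) (p j)"
    and "S = {a, b} \<union> (\<Union>i\<in>{1, 2, 3}. set (p i))"
  using assms unfolding theta_def by blast+

text \<open>\<open>p i\<close> is a path without the apex \<open>b\<close>, starting at its triangle
  vertex. The relation between heads supplies the triangle and forbids every other edge between the
  paths.\<close>

definition stamp_paths :: "'a \<Rightarrow> (nat \<Rightarrow> 'a list) \<Rightarrow> 'a set \<Rightarrow> bool" where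
  "stamp_paths b p S \<longleftrightarrow> (\<forall>i\<in>{1, 2, 3}. p i \<noteq> [] \<and> ipath (p i @ [b])) \<and>
    (\<forall>i\<in>{1, 2, 3}. \<forall>j\<in>{1, 2, 3}. i \<noteq> j \<longrightarrow> heads_joined (p i) (p j)) \<and>
    S = {b} \<union> (\<Union>i\<in>{1, 2, 3}. set (p i))"

lemma stamp_pathsI:
  assumes "\<And>i. i \<in> {1, 2, 3} \<Longrightarrow> p i \<noteq> [] \<and> ipath (p i @ [b])"
    and "\<And>i j. i \<in> {1, 2, 3} \<Longrightarrow> j \<in> {1, 2, 3} \<Longrightarrow> i \<noteq> j \<Longrightarrow> heads_joined (p i) (p j)"
    and "S = {b} \<union> (\<Union>i\<in>{1, 2, 3}. set (p i))"
  shows "stamp_paths b p S"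
  unfolding stamp_paths_def by (rule conjI[OF ballI conjI[OF _ assms(3)]]) (use assms in blast)+

lemma stamp_pathsD:
  assumes "stamp_paths b p S"
  shows "i \<in> {1, 2, 3} \<Longrightarrow> p i \<noteq> [] \<and> ipath (p i @ [b])"
    and "i \<in> {1, 2, 3} \<Longrightarrow> j \<in> {1, 2, 3} \<Longrightarrow> i \<noteq> j \<Longrightarrow> heads_joined (p i) (p j)"
    and "S = {b} \<union> (\<Union>i\<in>{1, 2, 3}. set (p i))"
  using assms unfolding stamp_paths_def by blast+

text \<open>The heads form one triangle and the last vertices the other; two vertices per path keep
  the triangles disjoint.\<close>

definition prism_paths :: "(nat \<Rightarrow> 'a list) \<Rightarrow> 'a set \<Rightarrow> bool" where
  "prism_paths p S \<longleftrightarrow> (\<forall>i\<in>{1, 2, 3}. 2 \<le> length (p i) \<and> ipath (p i)) \<and>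
    (\<forall>i\<in>{1, 2, 3}. \<forall>j\<in>{1, 2, 3}. i \<noteq> j \<longrightarrow> ends_joined (p i) (p j)) \<and>
    S = (\<Union>i\<in>{1, 2, 3}. set (p i))"

lemma prism_pathsI:
  assumes "\<And>i. i \<in> {1, 2, 3} \<Longrightarrow> 2 \<le> length (p i) \<and> ipath (p i)"
    and "\<And>i j. i \<in> {1, 2, 3} \<Longrightarrow> j \<in> {1, 2, 3} \<Longrightarrow> i \<noteq> j \<Longrightarrow> ends_joined (p i) (p j)"
    and "S = (\<Union>i\<in>{1, 2, 3}. set (p i))"
  shows "prism_paths p S"
  unfolding prism_paths_def by (rule conjI[OF ballI conjI[OF _ assms(3)]]) (use assms in blast)+

lemma prism_pathsD:
  assumes "prism_paths p S"
  shows "i \<in> {1, 2, 3} \<Longrightarrow> 2 \<le> length (p i) \<and> ipath (p i)"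
    and "i \<in> {1, 2, 3} \<Longrightarrow> j \<in> {1, 2, 3} \<Longrightarrow> i \<noteq> j \<Longrightarrow> ends_joined (p i) (p j)"
    and "S = (\<Union>i\<in>{1, 2, 3}. set (p i))"
  using assms unfolding prism_paths_def by blast+

lemma trihedron_iff: "trihedron (induced S) \<longleftrightarrow> (\<exists>a b p. theta a b p S)" (is "_ \<longleftrightarrow> ?R")
proof
  let ?I = "{1, 2, 3} :: nat set"
  assume "trihedron (induced S)"
  then obtain a b and P :: "nat \<Rightarrow> 'a list" where
    P0: "\<forall>i\<in>?I. path_between a (P i) b \<and> 2 \<le> length (P i) - 1"
    and dis: "\<forall>i\<in>?I. \<forall>j\<in>?I. i \<noteq> j \<longrightarrow> (set (P i) - {a, b}) \<inter> set (P j) = {}"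
    and "induced S = graph_Union {path_graph (P i) | i. i \<in> ?I}"
    unfolding trihedron_def by (elim exE conjE) (rule that)
  then have eq: "induced S = graph_Union ({} \<union> {path_graph (P i) | i. i \<in> ?I})" by simp
  note D = induced_graph_UnionD[OF eq]
  have "\<exists>q. P i = a # q @ [b] \<and> q \<noteq> [] \<and> distinct (P i)" if "i \<in> ?I" for i
  proof -
    have "path_between a (P i) b \<and> 2 \<le> length (P i) - 1" using P0 that by blast
    then have P: "P i \<noteq> []" "hd (P i) = a" "last (P i) = b" "distinct (P i)" "3 \<le> length (P i)"
      by (auto simp: path_between_def)
    then obtain r where "P i = a # r" by (cases "P i") auto
    moreover from this have "r \<noteq> []" "butlast r \<noteq> []" using P by (auto, cases r rule: rev_cases, auto)
    ultimately show ?thesis using P by (intro exI[of _ "butlast r"]) auto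
  qed
  then obtain p where p: "\<And>i. i \<in> ?I \<Longrightarrow> P i = a # p i @ [b] \<and> p i \<noteq> [] \<and> distinct (P i)" by metis
  have int: "set (p i) = set (P i) - {a, b}" if "i \<in> ?I" for i using p[OF that] by auto
  have same: "j = i" if "i \<in> ?I" "j \<in> ?I" "x \<in> set (p i)" "x \<in> set (P j)" for i j x
    using dis int[OF that(1)] that by blast
  have ends: "{a, b} \<notin> path_edges (P i)" "{b, a} \<notin> path_edges (P i)" if "i \<in> ?I" for i
    using path_edges_ends[of "P i"] p[OF that] by (cases "p i"; simp add: insert_commute)+
  have "ipath (P i)" if i: "i \<in> ?I" for i
  proof (rule D(3)[OF _ i])
    fix j x y assume xy: "j \<in> ?I" "x \<in> set (P i)" "y \<in> set (P i)" "{x, y} \<in> path_edges (P j)"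
    \<comment> \<open>Interior vertices lie on one path only, so an edge of another path inside
      \<open>P i\<close> would be a loop at \<open>a\<close> or \<open>b\<close>, or the edge
      \<open>ab\<close>.\<close>
    show "j = i"
    proof (rule ccontr)
      assume "j \<noteq> i"
      then have "x \<in> {a, b}" "y \<in> {a, b}"
        using path_edges_mem[OF xy(4)] same[OF i xy(1)] xy(2,3) int[OF i] by blast+
      then show False
        using ends[OF xy(1)] xy(4) path_edges_distinct[of "P j"] p[OF xy(1)] by auto
    qed
  qed (use p[OF i] in auto)
  then have A: "p i \<noteq> [] \<and> ipath (a # p i @ [b])" if "i \<in> ?I" for i using p that by metis
  have B: "apart (p i) (p j)" if ij: "i \<in> ?I" "j \<in> ?I" "i \<noteq> j" for i j
  proof (rule joinedI)
    show "set (p i) \<inter> set (p j) = {}" using same[OF ij(1,2)] int[OF ij(2)] ij(3) by blast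
    fix x y assume xy: "x \<in> set (p i)" "y \<in> set (p j)"
    then have "x \<in> set (P i)" "y \<in> set (P j)" using int ij by blast+
    moreover have "\<not> (\<exists>k\<in>?I. {x, y} \<in> path_edges (P k))"
      using same[OF ij(1) _ xy(1)] same[OF ij(2) _ xy(2)] path_edges_mem ij(3) by metis
    ultimately show "E x y \<longleftrightarrow> False" using D(2)[OF _ _ _ ij(1,2)] by simp
  qed
  have "S = {a, b} \<union> (\<Union>i\<in>?I. set (p i))" using D(1) p by fastforce
  then show ?R using thetaI[where p = p, OF A B] by blast
next
  let ?I = "{1, 2, 3} :: nat set"
  assume ?R
  then obtain a b p where th: "theta a b p S" by blast
  note j = thetaD(2)[OF th] and S = thetaD(3)[OF th]
  define P where "P = (\<lambda>i. a # p i @ [b])"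
  have p: "p i \<noteq> []" "ipath (P i)" if "i \<in> ?I" for i using thetaD(1)[OF th that] unfolding P_def by blast+
  have sP: "set (P i) = {a, b} \<union> set (p i)" for i by (auto simp: P_def)
  have SP: "S = (\<Union>i\<in>?I. set (P i))" using S sP by auto
  have "induced S = graph_Union ({} \<union> {path_graph (P i) | i. i \<in> ?I})"
  proof (rule induced_graph_UnionI[OF p(2) SP])
    fix x y assume xy: "x \<in> S" "y \<in> S" "E x y"
    have "\<exists>i\<in>?I. x \<in> set (P i) \<and> y \<in> set (P i)"
    proof (rule ccontr)
      assume n: "\<not> ?thesis"
      then have "x \<notin> {a, b}" "y \<notin> {a, b}" using xy SP sP by blast+
      then obtain i j where ij: "i \<in> ?I" "j \<in> ?I" "x \<in> set (p i)" "y \<in> set (p j)" using xy S by blast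
      then have "i \<noteq> j" using n sP by blast
      then show False using joinedD(2)[OF j[OF ij(1,2)] ij(3,4)] xy(3) by simp
    qed
    then show "{x, y} \<in> \<Union>(edges ` {}) \<or> (\<exists>i\<in>?I. x \<in> set (P i) \<and> y \<in> set (P i))" by simp
  qed auto
  then have *: "induced S = graph_Union {path_graph (P i) | i. i \<in> ?I}" by simp
  show "trihedron (induced S)" unfolding trihedron_def
  proof (rule exI[of _ a], rule exI[of _ b], rule exI[of _ P], intro conjI ballI impI *)
    show "a \<noteq> b" using ipath_distinct[OF p(2)[of 1]] by (auto simp: P_def)
    fix i :: nat assume i: "i \<in> ?I"
    show "path_between a (P i) b" using ipath_distinct[OF p(2)[OF i]] by (auto simp: P_def path_between_def)
    show "2 \<le> length (P i) - 1" using p(1)[OF i] by (cases "p i") (auto simp: P_def)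
    fix k :: nat assume k: "k \<in> ?I" "i \<noteq> k"
    show "(set (P i) - {a, b}) \<inter> set (P k) = {}"
      using joinedD(1)[OF j[OF i k]] sP[of i] sP[of k] by blast
  qed
qed

lemma stamp_iff: "stamp (induced S) \<longleftrightarrow> (\<exists>b p. stamp_paths b p S)" (is "_ \<longleftrightarrow> ?R")
proof
  let ?I = "{1, 2, 3} :: nat set"
  assume "stamp (induced S)"
  then obtain t b and P :: "nat \<Rightarrow> 'a list" where t: "inj_on t ?I" and b: "b \<notin> t ` ?I"
    and P0: "\<forall>i\<in>?I. path_between (t i) (P i) b \<and> 1 \<le> length (P i) - 1 \<and> set (P i) \<inter> t ` ?I = {t i}"
    and dis: "\<forall>i\<in>?I. \<forall>j\<in>?I. i \<noteq> j \<longrightarrow> (set (P i) - {b}) \<inter> (set (P j) - {b}) = {}"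
    and "induced S = graph_Union (insert (triangle t) {path_graph (P i) | i. i \<in> ?I})"
    unfolding stamp_def verts_triangle by (elim exE conjE) (rule that)
  then have eq: "induced S = graph_Union ({triangle t} \<union> {path_graph (P i) | i. i \<in> ?I})" by simp
  have P: "path_between (t i) (P i) b \<and> 1 \<le> length (P i) - 1 \<and> set (P i) \<inter> t ` ?I = {t i}" if "i \<in> ?I" for i
    using P0 that by blast
  then have "\<Union>(verts ` {triangle t}) \<subseteq> (\<Union>i\<in>?I. set (P i))" unfolding verts_triangle[of t] image_insert by blast
  note D = induced_graph_UnionD[OF eq this]
  have "\<exists>q. P i = q @ [b] \<and> q \<noteq> [] \<and> hd q = t i \<and> distinct (P i)" if "i \<in> ?I" for i
  proof -
    have *: "P i \<noteq> []" "hd (P i) = t i" "last (P i) = b" "distinct (P i)" "2 \<le> length (P i)"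
      using P[OF that] by (auto simp: path_between_def)
    then have b: "P i = butlast (P i) @ [b]" by (metis append_butlast_last_id)
    then have "butlast (P i) \<noteq> []" using *(5) by (cases "P i" rule: rev_cases) auto
    moreover from this have "hd (butlast (P i)) = t i" using *(2) b by (metis hd_append)
    ultimately show ?thesis using *(4) b by blast
  qed
  then obtain p where p: "\<And>i. i \<in> ?I \<Longrightarrow> P i = p i @ [b] \<and> p i \<noteq> [] \<and> hd (p i) = t i \<and> distinct (P i)" by metis
  have int: "set (p i) = set (P i) - {b}" if "i \<in> ?I" for i using p[OF that] by auto
  have same: "j = i" if "i \<in> ?I" "j \<in> ?I" "x \<in> set (p i)" "x \<in> set (P j)" for i j x
    using dis int[OF that(1)] that by blast
  have ti: "j = i" if "i \<in> ?I" "j \<in> ?I" "t j \<in> set (P i)" for i j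
  proof -
    have "t j \<in> {t i}" using P[of i] that by blast
    then show ?thesis using inj_onD[OF t, of j i] that by simp
  qed
  have "ipath (P i)" if i: "i \<in> ?I" for i
  proof (rule D(3)[OF i])
    fix x y assume "x \<in> set (P i)" "y \<in> set (P i)"
    then show "{x, y} \<notin> \<Union>(edges ` {triangle t})"
      using ti[OF i] unfolding edge_Union_triangle by metis
  next
    fix j x y assume xy: "j \<in> ?I" "x \<in> set (P i)" "y \<in> set (P i)" "{x, y} \<in> path_edges (P j)"
    \<comment> \<open>The paths share only the apex, so an edge of another path inside
      \<open>P i\<close> would be a loop at \<open>b\<close>.\<close>
    show "j = i"
    proof (rule ccontr)
      assume "j \<noteq> i"
      then have "x = b" "y = b"
        using path_edges_mem[OF xy(4)] same[OF i xy(1)] xy(2,3) int[OF i] by blast+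
      then show False using xy(4) path_edges_distinct[of "P j"] p[OF xy(1)] by auto
    qed
  qed (use p[OF i] in auto)
  then have A: "p i \<noteq> [] \<and> ipath (p i @ [b])" if "i \<in> ?I" for i using p that by metis
  have B: "heads_joined (p i) (p j)" if ij: "i \<in> ?I" "j \<in> ?I" "i \<noteq> j" for i j
  proof (rule joinedI)
    show "set (p i) \<inter> set (p j) = {}" using same[OF ij(1,2)] int[OF ij(2)] ij(3) by blast
    fix x y assume xy: "x \<in> set (p i)" "y \<in> set (p j)"
    then have m: "x \<in> set (P i)" "y \<in> set (P j)" using int ij by blast+
    have "\<not> (\<exists>k\<in>?I. {x, y} \<in> path_edges (P k))"
      using same[OF ij(1) _ xy(1)] same[OF ij(2) _ xy(2)] path_edges_mem ij(3) by metis
    then have "E x y \<longleftrightarrow> (\<exists>k\<in>?I. \<exists>l\<in>?I. k \<noteq> l \<and> x = t k \<and> y = t l)"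
      using D(2)[OF m ij(1,2)] unfolding edge_Union_triangle by (simp only: simp_thms)
    also have "\<dots> \<longleftrightarrow> x = t i \<and> y = t j" using ti m ij by metis
    finally show "E x y \<longleftrightarrow> x = hd (p i) \<and> y = hd (p j)" using p ij by metis
  qed
  have "S = {b} \<union> (\<Union>i\<in>?I. set (p i))" using D(1) p by fastforce
  then show ?R using stamp_pathsI[where p = p, OF A B] by blast
next
  let ?I = "{1, 2, 3} :: nat set"
  assume ?R
  then obtain b p where sp: "stamp_paths b p S" by blast
  note S = stamp_pathsD(3)[OF sp]
  define P where "P = (\<lambda>i. p i @ [b])"
  define t where "t = (\<lambda>i. hd (p i))"
  have p: "p i \<noteq> []" "ipath (P i)" if "i \<in> ?I" for i using stamp_pathsD(1)[OF sp that] unfolding P_def by blast+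
  have sP: "set (P i) = {b} \<union> set (p i)" for i by (auto simp: P_def)
  have j: "joined (p i) (p j) (\<lambda>x y. x = t i \<and> y = t j)" if "i \<in> ?I" "j \<in> ?I" "i \<noteq> j" for i j
    using stamp_pathsD(2)[OF sp that] unfolding t_def .
  have b: "b \<notin> set (p i)" if "i \<in> ?I" for i
    using ipath_distinct[OF p(2)[OF that]] by (auto simp: P_def)
  have tp: "t i \<in> set (p i)" if "i \<in> ?I" for i using p(1)[OF that] by (simp add: t_def)
  have SP: "S = (\<Union>i\<in>?I. set (P i))" using S sP by auto
  have "induced S = graph_Union ({triangle t} \<union> {path_graph (P i) | i. i \<in> ?I})"
  proof (rule induced_graph_UnionI[OF p(2) SP])
    show "\<Union>(verts ` {triangle t}) \<subseteq> S" using tp unfolding S verts_triangle[of t] image_insert by blast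
    fix f assume "f \<in> \<Union>(edges ` {triangle t})"
    then have "f \<in> edges (triangle t)" by simp
    then obtain k l where kl: "k \<in> ?I" "l \<in> ?I" "k \<noteq> l" "f = {t k, t l}" by (rule edge_triangleE)
    then have "E (t k) (t l)" using joinedD(2)[OF j[OF kl(1-3)] tp tp] by blast
    moreover have "t k \<in> S" "t l \<in> S" unfolding S using tp kl(1,2) by blast+
    ultimately show "\<exists>x\<in>S. \<exists>y\<in>S. f = {x, y} \<and> E x y" using kl(4) by blast
  next
    fix x y assume xy: "x \<in> S" "y \<in> S" "E x y"
    show "{x, y} \<in> \<Union>(edges ` {triangle t}) \<or> (\<exists>i\<in>?I. x \<in> set (P i) \<and> y \<in> set (P i))"
    proof (rule disjCI)
      assume n: "\<not> (\<exists>i\<in>?I. x \<in> set (P i) \<and> y \<in> set (P i))"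
      then have "x \<noteq> b" "y \<noteq> b" using xy SP sP by blast+
      then obtain k l where kl: "k \<in> ?I" "l \<in> ?I" "x \<in> set (p k)" "y \<in> set (p l)" using xy S by blast
      then have "k \<noteq> l" using n sP by blast
      moreover from this have "x = t k \<and> y = t l" using joinedD(2)[OF j[OF kl(1,2)] kl(3,4)] xy(3) by simp
      ultimately show "{x, y} \<in> \<Union>(edges ` {triangle t})"
        using kl(1,2) unfolding edge_Union_triangle by metis
    qed
  qed
  then have *: "induced S = graph_Union (insert (triangle t) {path_graph (P i) | i. i \<in> ?I})" by simp
  have tj: "k = i" if "i \<in> ?I" "k \<in> ?I" "t k \<in> set (P i)" for i k
  proof (rule ccontr)
    assume "k \<noteq> i"
    then have "set (p i) \<inter> set (p k) = {}" using joinedD(1)[OF j[OF that(1,2)]] by metis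
    then show False using tp[OF that(2)] b[OF that(2)] that(3) sP[of i] by auto
  qed
  show "stamp (induced S)" unfolding stamp_def
  proof (intro exI[of _ t] exI[of _ b] exI[of _ P] conjI ballI impI *)
    show "inj_on t ?I" using tj tp sP by (intro inj_onI) (metis UnCI)
    show "b \<notin> verts (triangle t)" using b tp by (auto simp: verts_triangle)
    fix i :: nat assume i: "i \<in> ?I"
    show "path_between (t i) (P i) b" using ipath_distinct[OF p(2)[OF i]] p(1)[OF i] by (auto simp: P_def t_def path_between_def)
    show "1 \<le> length (P i) - 1" using p(1)[OF i] by (cases "p i") (auto simp: P_def)
    have "t i \<in> set (P i)" using tp[OF i] sP by blast
    then show "set (P i) \<inter> verts (triangle t) = {t i}"
      unfolding verts_triangle by (intro Int_image_single tj i)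
    fix k :: nat assume k: "k \<in> ?I" "i \<noteq> k"
    show "(set (P i) - {b}) \<inter> (set (P k) - {b}) = {}" using joinedD(1)[OF j[OF i k]] sP[of i] sP[of k] by blast
  qed
qed

lemma prism_iff: "prism (induced S) \<longleftrightarrow> (\<exists>p. prism_paths p S)" (is "_ \<longleftrightarrow> ?R")
proof
  let ?I = "{1, 2, 3} :: nat set"
  assume "prism (induced S)"
  then obtain t s and p :: "nat \<Rightarrow> 'a list" where t: "inj_on t ?I" "inj_on s ?I" "t ` ?I \<inter> s ` ?I = {}"
    and P0: "\<forall>i\<in>?I. path_between (t i) (p i) (s i) \<and> set (p i) \<inter> (t ` ?I \<union> s ` ?I) = {t i, s i}"
    and dis: "\<forall>i\<in>?I. \<forall>j\<in>?I. i \<noteq> j \<longrightarrow> set (p i) \<inter> set (p j) = {}"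
    and eq: "induced S = graph_Union ({triangle t, triangle s} \<union> {path_graph (p i) | i. i \<in> ?I})"
    unfolding prism_def verts_triangle by (elim exE conjE) (rule that)
  have P: "path_between (t i) (p i) (s i) \<and> set (p i) \<inter> (t ` ?I \<union> s ` ?I) = {t i, s i}" if "i \<in> ?I" for i
    using P0 that by blast
  have tp: "t i \<in> set (p i)" "s i \<in> set (p i)" if "i \<in> ?I" for i using P[OF that] by blast+
  then have "\<Union>(verts ` {triangle t, triangle s}) \<subseteq> (\<Union>i\<in>?I. set (p i))"
    unfolding verts_triangle[of t] verts_triangle[of s] image_insert by blast
  note D = induced_graph_UnionD[OF eq this]
  have p: "p i \<noteq> [] \<and> hd (p i) = t i \<and> last (p i) = s i \<and> distinct (p i) \<and> 2 \<le> length (p i)" if "i \<in> ?I" for i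
  proof -
    have *: "p i \<noteq> []" "hd (p i) = t i" "last (p i) = s i" "distinct (p i)"
      using P[OF that] by (auto simp: path_between_def)
    moreover have "t i \<noteq> s i" using t that by blast
    ultimately show ?thesis by (cases "p i") (auto simp: Suc_le_eq split: if_splits)
  qed
  have same: "j = i" if "i \<in> ?I" "j \<in> ?I" "x \<in> set (p i)" "x \<in> set (p j)" for i j x
    using dis that by blast
  have idx: "j = i" if "i \<in> ?I" "j \<in> ?I" "t j \<in> set (p i) \<or> s j \<in> set (p i)" for i j
    using same[OF that(1,2)] tp[OF that(2)] that(3) by blast
  have "ipath (p i)" if i: "i \<in> ?I" for i
  proof (rule D(3)[OF i])
    fix x y assume "x \<in> set (p i)" "y \<in> set (p i)"
    then show "{x, y} \<notin> \<Union>(edges ` {triangle t, triangle s})"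
      using idx[OF i] unfolding edge_Union_triangle by metis
  next
    fix j x y assume "j \<in> ?I" "x \<in> set (p i)" "{x, y} \<in> path_edges (p j)"
    then show "j = i" using same[OF i] path_edges_mem by metis
  qed (use p[OF i] in auto)
  then have A: "2 \<le> length (p i) \<and> ipath (p i)" if "i \<in> ?I" for i using p that by metis
  have B: "ends_joined (p i) (p j)"
    if ij: "i \<in> ?I" "j \<in> ?I" "i \<noteq> j" for i j
  proof (rule joinedI)
    show "set (p i) \<inter> set (p j) = {}" using dis ij by blast
    fix x y assume xy: "x \<in> set (p i)" "y \<in> set (p j)"
    have "\<not> (\<exists>k\<in>?I. {x, y} \<in> path_edges (p k))"
      using same[OF ij(1) _ xy(1)] same[OF ij(2) _ xy(2)] path_edges_mem ij(3) by metis
    then have "E x y \<longleftrightarrow> (\<exists>k\<in>?I. \<exists>l\<in>?I. k \<noteq> l \<and> (x = t k \<and> y = t l \<or> x = s k \<and> y = s l))"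
      using D(2)[OF xy ij(1,2)] unfolding edge_Union_triangle by (simp only: simp_thms)
    also have "\<dots> \<longleftrightarrow> x = t i \<and> y = t j \<or> x = s i \<and> y = s j" using idx xy ij by metis
    finally show "E x y \<longleftrightarrow> x = hd (p i) \<and> y = hd (p j) \<or> x = last (p i) \<and> y = last (p j)" using p ij by metis
  qed
  show ?R using prism_pathsI[where p = p, OF A B D(1)] by blast
next
  let ?I = "{1, 2, 3} :: nat set"
  assume ?R
  then obtain p where pp: "prism_paths p S" by blast
  note S = prism_pathsD(3)[OF pp]
  define t where "t = (\<lambda>i. hd (p i))"
  define s where "s = (\<lambda>i. last (p i))"
  have p: "2 \<le> length (p i)" "ipath (p i)" if "i \<in> ?I" for i using prism_pathsD(1)[OF pp that] by blast+
  have j: "joined (p i) (p j) (\<lambda>x y. x = t i \<and> y = t j \<or> x = s i \<and> y = s j)" if "i \<in> ?I" "j \<in> ?I" "i \<noteq> j" for i j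
    using prism_pathsD(2)[OF pp that] unfolding t_def s_def .
  have ne: "p i \<noteq> []" if "i \<in> ?I" for i using p[OF that] by auto
  have tp: "t i \<in> set (p i)" "s i \<in> set (p i)" if "i \<in> ?I" for i using ne[OF that] by (simp_all add: t_def s_def)
  have ts: "t i \<noteq> s i" if "i \<in> ?I" for i
    using p[OF that] by (cases "p i") (auto simp: t_def s_def split: if_splits)
  have idx: "k = i" if "i \<in> ?I" "k \<in> ?I" "t k \<in> set (p i) \<or> s k \<in> set (p i)" for i k
    using joinedD(1)[OF j[OF that(1,2)]] tp[OF that(2)] that by blast
  have *: "induced S = graph_Union ({triangle t, triangle s} \<union> {path_graph (p i) | i. i \<in> ?I})"
  proof (rule induced_graph_UnionI[OF p(2) S])
    show "\<Union>(verts ` {triangle t, triangle s}) \<subseteq> S"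
      using tp unfolding S verts_triangle[of t] verts_triangle[of s] image_insert by blast
    fix f assume "f \<in> \<Union>(edges ` {triangle t, triangle s})"
    then have "f \<in> edges (triangle t) \<or> f \<in> edges (triangle s)" by simp
    then obtain k l where kl: "k \<in> ?I" "l \<in> ?I" "k \<noteq> l" "f = {t k, t l} \<or> f = {s k, s l}"
      using edge_triangleE by metis
    then have "E (t k) (t l)" "E (s k) (s l)" using joinedD(2)[OF j[OF kl(1-3)]] tp by simp_all
    moreover have "t k \<in> S" "t l \<in> S" "s k \<in> S" "s l \<in> S" unfolding S using tp kl(1,2) by blast+
    ultimately show "\<exists>x\<in>S. \<exists>y\<in>S. f = {x, y} \<and> E x y" using kl(4) by blast
  next
    fix x y assume xy: "x \<in> S" "y \<in> S" "E x y"
    show "{x, y} \<in> \<Union>(edges ` {triangle t, triangle s}) \<or> (\<exists>i\<in>?I. x \<in> set (p i) \<and> y \<in> set (p i))"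
    proof (rule disjCI)
      assume n: "\<not> (\<exists>i\<in>?I. x \<in> set (p i) \<and> y \<in> set (p i))"
      obtain k l where kl: "k \<in> ?I" "l \<in> ?I" "x \<in> set (p k)" "y \<in> set (p l)" using xy S by blast
      then have "k \<noteq> l" using n by blast
      moreover from this have "x = t k \<and> y = t l \<or> x = s k \<and> y = s l"
        using joinedD(2)[OF j[OF kl(1,2)] kl(3,4)] xy(3) by blast
      ultimately show "{x, y} \<in> \<Union>(edges ` {triangle t, triangle s})"
        using kl(1,2) unfolding edge_Union_triangle by metis
    qed
  qed
  show "prism (induced S)" unfolding prism_def
  proof (rule exI[of _ t], rule exI[of _ s], rule exI[of _ p], intro conjI ballI impI *)
    show "inj_on t ?I" "inj_on s ?I" using idx tp by (intro inj_onI; metis)+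
    show "verts (triangle t) \<inter> verts (triangle s) = {}"
      unfolding verts_triangle using idx tp ts by (intro image_disjoint) metis
    fix i :: nat assume i: "i \<in> ?I"
    show "path_between (t i) (p i) (s i)" using ipath_distinct p[OF i] ne[OF i] by (auto simp: t_def s_def path_between_def)
    have "set (p i) \<inter> t ` ?I = {t i}" "set (p i) \<inter> s ` ?I = {s i}"
      using idx[OF i] tp[OF i] i by (intro Int_image_single; blast)+
    then show "set (p i) \<inter> (verts (triangle t) \<union> verts (triangle s)) = {t i, s i}"
      unfolding verts_triangle Int_Un_distrib by auto
    fix k :: nat assume "k \<in> ?I" "i \<noteq> k"
    then show "set (p i) \<inter> set (p k) = {}" using joinedD(1)[OF j[OF i]] by blast
  qed
qed

text \<open>The isomorphic copy allowed by \<open>solids\<close> is left out;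
  \<open>solid_iso_iff\<close> shows that nothing changes.\<close>

definition solid :: "'a set \<Rightarrow> bool" where "solid S \<longleftrightarrow> solid_graph (induced S)"

lemma solid_pyramidI:
  assumes "icycle c" "w \<notin> set c" "3 \<le> card {x \<in> set c. E w x}"
  shows "solid (insert w (set c))"
  using assms pyramid_iff unfolding solid_def solid_graph_def by blast

lemma card_ge_3I:
  assumes "finite A" "x \<in> A" "y \<in> A" "z \<in> A" "x \<noteq> y" "x \<noteq> z" "y \<noteq> z"
  shows "3 \<le> card A"
proof -
  have "card {x, y, z} \<le> card A" by (rule card_mono) (use assms in auto)
  then show ?thesis using assms by simp
qed

definition "three p q r i = (if i = 1 then p else if i = 2 then q else (r :: 'b list))" for i :: nat

lemma three_simps [simp]: "three p q r (Suc 0) = p" "three p q r 1 = p" "three p q r 2 = q" "three p q r 3 = r"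
  by (auto simp: three_def)

lemma joined_sym:
  assumes "joined p q R" "\<And>x y. R' y x \<longleftrightarrow> R x y"
  shows "joined q p R'"
  unfolding joined_def using assms(1)[unfolded joined_def] assms(2) E_commute by (metis Int_commute)

lemma ball_123: "(\<forall>i\<in>{1, 2, 3}. P i) \<longleftrightarrow> P 1 \<and> P 2 \<and> P (3 :: nat)"
  by blast

lemma solid_trihedronI:
  assumes "p \<noteq> []" "q \<noteq> []" "r \<noteq> []" "ipath (a # p @ [b])" "ipath (a # q @ [b])" "ipath (a # r @ [b])"
    "apart p q" "apart p r" "apart q r"
    and S: "S = {a, b} \<union> set p \<union> set q \<union> set r"
  shows "solid S"
proof -
  note j = assms(7-9) assms(7-9)[THEN joined_sym, of "\<lambda>_ _. False", simplified]
  have "trihedron (induced S)"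
    unfolding trihedron_iff theta_def ball_123
    using assms(1-6) j by (intro exI[of _ a] exI[of _ b] exI[of _ "three p q r"]) (simp add: S Un_assoc)
  then show ?thesis by (simp add: solid_def solid_graph_def)
qed

lemma solid_stampI:
  assumes "p \<noteq> []" "q \<noteq> []" "r \<noteq> []" "ipath (p @ [b])" "ipath (q @ [b])" "ipath (r @ [b])"
    "heads_joined p q" "heads_joined p r"
    "heads_joined q r"
    and S: "S = {b} \<union> set p \<union> set q \<union> set r"
  shows "solid S"
proof -
  have "heads_joined q p" "heads_joined r p"
    "heads_joined r q"
    by (auto intro: joined_sym[OF assms(7)] joined_sym[OF assms(8)] joined_sym[OF assms(9)])
  then have "stamp (induced S)"
    unfolding stamp_iff stamp_paths_def ball_123
    using assms(1-9) by (intro exI[of _ b] exI[of _ "three p q r"]) (simp add: S Un_assoc)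
  then show ?thesis by (simp add: solid_def solid_graph_def)
qed

lemma solid_prismI:
  assumes "2 \<le> length p" "2 \<le> length q" "2 \<le> length r" "ipath p" "ipath q" "ipath r"
    "ends_joined p q"
    "ends_joined p r"
    "ends_joined q r"
    and S: "S = set p \<union> set q \<union> set r"
  shows "solid S"
proof -
  have "ends_joined q p"
    "ends_joined r p"
    "ends_joined r q"
    by (auto intro: joined_sym[OF assms(7)] joined_sym[OF assms(8)] joined_sym[OF assms(9)])
  then have "prism (induced S)"
    unfolding prism_iff prism_paths_def ball_123
    using assms(1-9) by (intro exI[of _ "three p q r"]) (simp add: S Un_assoc)
  then show ?thesis by (simp add: solid_def solid_graph_def)
qed

section \<open>Solids made of an induced cycle and an ear with prescribed attachments\<close>

lemma icycle_split:
  assumes "icycle (x # p @ y # r)" "p \<noteq> []" "r \<noteq> []"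
  shows "ipath (x # p @ [y])" "ipath (x # rev r @ [y])" "apart p r"
proof -
  have p: "ipath p" "ipath r" "ipath (y # r)" and xy: "x \<noteq> y" "x \<notin> set p" "x \<notin> set r" "y \<notin> set p" "y \<notin> set r"
    and x: "\<And>z. z \<in> set p \<union> insert y (set r) \<Longrightarrow> E x z \<longleftrightarrow> z = hd p \<or> z = last r"
    and pr: "\<And>s t. s \<in> set p \<Longrightarrow> t \<in> insert y (set r) \<Longrightarrow> E s t \<longleftrightarrow> s = last p \<and> t = y"
    and yr: "\<And>t. t \<in> set r \<Longrightarrow> E y t \<longleftrightarrow> t = hd r"
    and dis: "set p \<inter> set r = {}"
    using assms by (auto simp: icycle_Cons ipath_append)
  have m: "hd p \<in> set p" "last p \<in> set p" "hd r \<in> set r" "last r \<in> set r" using assms by auto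
  have d: "hd p \<noteq> y" "last r \<noteq> y" "last r \<notin> set p" "hd p \<notin> set r" using m dis xy by blast+
  have nxy: "\<not> E x y" using x[of y] d by auto
  show "ipath (x # p @ [y])"
    using p xy pr x d assms(2) nxy by (auto simp: ipath_append)
  have "s \<in> set r \<Longrightarrow> E s y \<longleftrightarrow> s = hd r" for s using yr E_commute[of s y] by blast
  then show "ipath (x # rev r @ [y])"
    using p xy x d assms(3) nxy by (auto simp: ipath_append hd_rev last_rev)
  show "apart p r" unfolding joined_def using dis pr xy by blast
qed

text \<open>As \<open>p\<close> and \<open>r\<close> are nonempty, \<open>x\<close> and
  \<open>y\<close> are not consecutive on the cycle; they become the ends, and the two arcs and the
  ear become the three paths.\<close>

lemma solid_ear_trihedron:
  assumes c: "icycle (x # p @ y # r)" "p \<noteq> []" "r \<noteq> []" and q: "ipath q" "q \<noteq> []" "set q \<inter> set (x # p @ y # r) = {}"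
    and E: "\<And>s t. s \<in> set q \<Longrightarrow> t \<in> set (x # p @ y # r) \<Longrightarrow> E s t \<longleftrightarrow> s = hd q \<and> t = x \<or> s = last q \<and> t = y"
  shows "solid (set (x # p @ y # r) \<union> set q)"
proof (rule solid_trihedronI[of p "rev r" q x y])
  note spl = icycle_split[OF c]
  have d: "x \<noteq> y" "x \<notin> set p" "x \<notin> set r" "y \<notin> set p" "y \<notin> set r" using icycle_distinct[OF c(1)] by auto
  show "ipath (x # p @ [y])" "ipath (x # rev r @ [y])" by (fact spl)+
  have nxy: "\<not> E x y" using spl(1) d c(2) by auto
  have qy: "E s y \<longleftrightarrow> s = last q" if "s \<in> set q" for s using E[OF that, of y] d by auto
  have qx: "E x s \<longleftrightarrow> s = hd q" if "s \<in> set q" for s using E[OF that, of x] d E_commute[of x s] by auto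
  have "ipath (q @ [y])" using q qy by (auto simp: ipath_append)
  then show "ipath (x # q @ [y])"
    using qx q d nxy by auto
  show "apart p (rev r)" using spl(3) by (simp add: joined_def)
  have "\<not> E t s" if "s \<in> set q" "t \<in> set p \<union> set r" for s t
    using E[OF that(1), of t] d that(2) E_commute[of t s] by auto
  then show "apart p q" "apart (rev r) q"
    using q(3) unfolding joined_def by auto
qed (use c q in auto)

text \<open>The cycle is read from the apex \<open>b\<close>, so that \<open>hd p\<close> and
  \<open>hd r\<close> are consecutive; together with \<open>hd q\<close> they form the
  triangle.\<close>

lemma solid_ear_stamp:
  assumes c: "icycle (b # rev p @ r)" "p \<noteq> []" "r \<noteq> []" and q: "ipath q" "q \<noteq> []" "set q \<inter> set (b # p @ r) = {}"
    and E: "\<And>s t. s \<in> set q \<Longrightarrow> t \<in> set (b # p @ r) \<Longrightarrow>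
      E s t \<longleftrightarrow> s = hd q \<and> (t = hd p \<or> t = hd r) \<or> s = last q \<and> t = b"
  shows "solid (insert b (set p \<union> set r \<union> set q))"
proof (rule solid_stampI[of p r q b])
  have ip: "ipath p" "ipath r" "b \<notin> set p" "b \<notin> set r" and dis: "set p \<inter> set r = {}"
    and pr: "\<And>s t. s \<in> set p \<Longrightarrow> t \<in> set r \<Longrightarrow> E s t \<longleftrightarrow> s = hd p \<and> t = hd r"
    and Eb: "\<And>t. t \<in> set p \<union> set r \<Longrightarrow> E b t \<longleftrightarrow> t = last p \<or> t = last r"
    using c by (simp_all add: icycle_Cons ipath_append last_rev hd_rev)
  have h: "hd p \<in> set p" "hd r \<in> set r" "last p \<in> set p" "last r \<in> set r" using c by auto
  have "E t b \<longleftrightarrow> t = last p" if "t \<in> set p" for t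
    using Eb[of t] E_commute[of t b] that h dis by auto
  then show "ipath (p @ [b])" using ip by (auto simp: ipath_append)
  have "E t b \<longleftrightarrow> t = last r" if "t \<in> set r" for t
    using Eb[of t] E_commute[of t b] that h dis by auto
  then show "ipath (r @ [b])" using ip by (auto simp: ipath_append)
  have "hd p \<noteq> b" "hd r \<noteq> b" using h ip by auto
  then have "E s b \<longleftrightarrow> s = last q" if "s \<in> set q" for s using E[OF that, of b] by auto
  then show "ipath (q @ [b])" using q by (auto simp: ipath_append)
  show "heads_joined p r" by (rule joinedI[OF dis pr])
  show "heads_joined p q"
  proof (rule joinedI)
    fix t s assume "t \<in> set p" "s \<in> set q"
    moreover from this have "t \<noteq> hd r" "t \<noteq> b" using h ip dis by auto
    ultimately show "E t s \<longleftrightarrow> t = hd p \<and> s = hd q" using E[of s t] E_commute[of t s] by auto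
  qed (use q in auto)
  show "heads_joined r q"
  proof (rule joinedI)
    fix t s assume "t \<in> set r" "s \<in> set q"
    moreover from this have "t \<noteq> hd p" "t \<noteq> b" using h ip dis by auto
    ultimately show "E t s \<longleftrightarrow> t = hd r \<and> s = hd q" using E[of s t] E_commute[of t s] by auto
  qed (use q in auto)
qed (use c q in auto)

lemma icycle_append:
  assumes "icycle (p @ q)" "2 \<le> length p" "q \<noteq> []"
  shows "ipath p" "ipath q" "set p \<inter> set q = {}"
    "\<And>s t. s \<in> set p \<Longrightarrow> t \<in> set q \<Longrightarrow> E s t \<longleftrightarrow> s = hd p \<and> t = last q \<or> s = last p \<and> t = hd q"
proof -
  obtain x p' where p: "p = x # p'" "p' \<noteq> []" using assms(2) by (cases p) (auto simp: Suc_le_eq)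
  obtain y q' where q: "q = y # q'" using assms(3) by (cases q) auto
  have c: "icycle (x # p' @ q)" using assms(1) p by simp
  have "icycle (y # q' @ p)" using icycle_rotate[OF assms(1)] q by simp
  then show "ipath p" by (auto simp: icycle_Cons ipath_append)
  show "ipath q" using c by (auto simp: icycle_Cons ipath_append)
  show dis: "set p \<inter> set q = {}" using icycle_distinct[OF assms(1)] by auto
  fix s t assume st: "s \<in> set p" "t \<in> set q"
  show "E s t \<longleftrightarrow> s = hd p \<and> t = last q \<or> s = last p \<and> t = hd q"
  proof (cases "s = x")
    case True
    have "hd p' \<in> set p" "last p' \<in> set p'" "x \<notin> set p'" using p icycle_distinct[OF c] by auto
    then have "t \<noteq> hd p'" "x \<noteq> last p'" using st dis by auto
    moreover have "E x t \<longleftrightarrow> t = hd (p' @ q) \<or> t = last (p' @ q)" using c st(2) unfolding icycle_Cons by simp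
    ultimately show ?thesis using True p assms(3) by simp
  next
    case False
    then have "s \<in> set p'" using st p by simp
    then have "E s t \<longleftrightarrow> s = last p' \<and> t = hd q" using c st(2) unfolding icycle_Cons ipath_append by blast
    then show ?thesis using False p by simp
  qed
qed

lemma icycle_joined:
  assumes "icycle (p @ rev r)" "2 \<le> length p" "2 \<le> length r"
  shows "ipath p" "ipath r" "ends_joined p r"
proof -
  have "r \<noteq> []" using assms(3) by auto
  then show "ipath p" "ipath r" "ends_joined p r"
    using icycle_append[OF assms(1,2)] by (auto simp: joined_def hd_rev last_rev)
qed

text \<open>The cycle is cut at the edges from \<open>hd p\<close> to \<open>hd r\<close> and from
  \<open>last p\<close> to \<open>last r\<close>; an end of the ear completes each of them to a
  triangle.\<close>

lemma solid_ear_prism: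
  assumes c: "icycle (p @ rev r)" "2 \<le> length p" "2 \<le> length r" and q: "ipath q" "2 \<le> length q" "set q \<inter> set (p @ r) = {}"
    and E: "\<And>s t. s \<in> set q \<Longrightarrow> t \<in> set (p @ r) \<Longrightarrow>
      E s t \<longleftrightarrow> s = hd q \<and> (t = hd p \<or> t = hd r) \<or> s = last q \<and> (t = last p \<or> t = last r)"
  shows "solid (set p \<union> set r \<union> set q)"
proof (rule solid_prismI[of p r q])
  note j = icycle_joined[OF c]
  show "ipath p" "ipath r" "ends_joined p r" by (fact j)+
  have "hd p \<in> set p" "last p \<in> set p" "hd r \<in> set r" "last r \<in> set r" using c by (auto intro!: hd_in_set last_in_set)
  then have m: "hd p \<notin> set r" "last p \<notin> set r" "hd r \<notin> set p" "last r \<notin> set p" using j(3) by (auto simp: joined_def)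
  show "ends_joined p q"
    unfolding joined_def
  proof (intro conjI ballI)
    fix t s assume st: "t \<in> set p" "s \<in> set q"
    then show "E t s \<longleftrightarrow> t = hd p \<and> s = hd q \<or> t = last p \<and> s = last q"
      using E[of s t] E_commute[of t s] m by auto
  qed (use q in auto)
  show "ends_joined r q"
    unfolding joined_def
  proof (intro conjI ballI)
    fix t s assume st: "t \<in> set r" "s \<in> set q"
    then show "E t s \<longleftrightarrow> t = hd r \<and> s = hd q \<or> t = last r \<and> s = last q"
      using E[of s t] E_commute[of t s] m by auto
  qed (use q in auto)
qed (use c q in auto)

subsection \<open>Connected sets\<close>

text \<open>Connectivity through cuts instead of walks: ears are changed by splitting and merging
  vertices, and a cut is easily carried along such a change. Paths are recovered by
  \<open>conn_ipath\<close>.\<close>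

definition conn :: "'a set \<Rightarrow> bool" where
  "conn Q \<longleftrightarrow> Q \<noteq> {} \<and> (\<forall>X. X \<subseteq> Q \<longrightarrow> X \<noteq> {} \<longrightarrow> X \<noteq> Q \<longrightarrow> (\<exists>x\<in>X. \<exists>y\<in>Q - X. E x y))"

lemma connD: "conn Q \<Longrightarrow> X \<subseteq> Q \<Longrightarrow> X \<noteq> {} \<Longrightarrow> X \<noteq> Q \<Longrightarrow> \<exists>x\<in>X. \<exists>y\<in>Q - X. E x y"
  unfolding conn_def by blast

lemma conn_singleton [simp]: "conn {x}"
  unfolding conn_def by blast

lemma conn_Un:
  assumes "conn A" "conn B" "A \<inter> B \<noteq> {} \<or> (\<exists>a\<in>A. \<exists>b\<in>B. E a b)"
  shows "conn (A \<union> B)"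
  unfolding conn_def
proof (intro conjI allI impI)
  show "A \<union> B \<noteq> {}" using assms(1) by (auto simp: conn_def)
  fix X assume X: "X \<subseteq> A \<union> B" "X \<noteq> {}" "X \<noteq> A \<union> B"
  have A: "A \<noteq> {}" and B: "B \<noteq> {}" using assms by (auto simp: conn_def)
  consider "X \<inter> A \<noteq> {}" "X \<inter> A \<noteq> A" | "X \<inter> B \<noteq> {}" "X \<inter> B \<noteq> B"
    | "X \<inter> A = A" "X \<inter> B = {}" | "X \<inter> A = {}" "X \<inter> B = B"
    using X by blast
  then show "\<exists>x\<in>X. \<exists>y\<in>A \<union> B - X. E x y"
  proof cases
    case 1 then show ?thesis using connD[OF assms(1), of "X \<inter> A"] by blast
  next
    case 2 then show ?thesis using connD[OF assms(2), of "X \<inter> B"] by blast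
  next
    case 3 then show ?thesis using assms(3) A B by blast
  next
    case 4 then show ?thesis using assms(3) A B sym by blast
  qed
qed

lemma ipath_conn: "ipath p \<Longrightarrow> p \<noteq> [] \<Longrightarrow> conn (set p)"
proof (induction p)
  case (Cons x p)
  show ?case
  proof (cases "p = []")
    case False
    then have "conn ({x} \<union> set p)" using Cons by (intro conn_Un) (auto intro!: bexI[of _ "hd p"])
    then show ?thesis by simp
  qed auto
qed auto

text \<open>A missing inner vertex would separate the part of \<open>X\<close> before it from the
  part after it, since an induced path has no edge that skips a vertex.\<close>

lemma conn_ipath_eq:
  assumes "ipath q" "conn X" "X \<subseteq> set q" "hd q \<in> X" "last q \<in> X"
  shows "X = set q"
proof (rule ccontr)
  assume "X \<noteq> set q"
  then obtain y where y: "y \<in> set q" "y \<notin> X" using assms by blast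
  then obtain q1 q2 where q: "q = q1 @ y # q2" by (meson split_list)
  have "q1 \<noteq> []" "q2 \<noteq> []" using assms(4,5) y q by auto
  then have "hd q \<in> set q1" "last q \<in> set q2" using q by auto
  then have "X \<inter> set q1 \<noteq> {}" "X \<inter> set q1 \<noteq> X"
    using assms q ipath_distinct[OF assms(1)] by auto
  then obtain a b where ab: "a \<in> X \<inter> set q1" "b \<in> X - X \<inter> set q1" "E a b" using connD[OF assms(2), of "X \<inter> set q1"] by blast
  then have "b \<in> set q2" using assms(3) y q by auto
  then show False using ab assms(1) q ipath_distinct[OF assms(1)] by (auto simp: ipath_append)
qed

text \<open>No length is minimised: the induced paths that start in \<open>S\<close> and meet it
  nowhere else reach every vertex of \<open>Q\<close>; one that reaches \<open>T\<close> is cut at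
  its first vertex in \<open>T\<close>.\<close>

lemma conn_ipath:
  assumes "conn Q" "S \<inter> Q \<noteq> {}" "T \<inter> Q \<noteq> {}"
  obtains p where "ipath p" "p \<noteq> []" "set p \<subseteq> Q" "hd p \<in> S" "last p \<in> T"
    "set (tl p) \<inter> S = {}" "set (butlast p) \<inter> T = {}"
proof -
  define W where "W p \<longleftrightarrow> ipath p \<and> p \<noteq> [] \<and> set p \<subseteq> Q \<and> hd p \<in> S \<and> set (tl p) \<inter> S = {}" for p
  define X where "X = {x. \<exists>p. W p \<and> last p = x}"
  have take: "W (p1 @ [y])" if "W (p1 @ y # p2)" for p1 y p2
  proof -
    have "ipath ((p1 @ [y]) @ p2)" using that by (simp add: W_def)
    then have "ipath (p1 @ [y])" unfolding ipath_append[of "p1 @ [y]"] by blast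
    then show ?thesis using that unfolding W_def by (cases p1) auto
  qed
  have "X = Q"
  proof (rule ccontr)
    assume ne: "X \<noteq> Q"
    have sub: "X \<subseteq> Q" using W_def X_def by auto
    obtain s where s: "s \<in> S" "s \<in> Q" using assms by blast
    then have "W [s]" by (simp add: W_def)
    then have "X \<noteq> {}" using X_def by fastforce
    then obtain x y where xy: "x \<in> X" "y \<in> Q" "y \<notin> X" "E x y" using connD[OF assms(1) sub _ ne] by blast
    then obtain p where p: "W p" "last p = x" using X_def by blast
    \<comment> \<open>Stopping at the first vertex of \<open>p\<close> adjacent to \<open>y\<close>
      is what keeps the path induced when \<open>y\<close> is appended.\<close>
    then have "\<exists>z\<in>set p. E z y" using xy by (metis W_def last_in_set)
    then obtain p1 z p2 where z: "p = p1 @ z # p2" "E z y" "\<forall>t\<in>set p1. \<not> E t y"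
      by (rule split_list_first_propE)
    have yp: "y \<notin> set p"
    proof
      assume "y \<in> set p"
      then obtain p1 p2 where "p = p1 @ y # p2" by (meson split_list)
      then have "W (p1 @ [y])" using take p by blast
      then have "y \<in> X" unfolding X_def by (metis (mono_tags, lifting) last_snoc mem_Collect_eq)
      then show False using xy by simp
    qed
    have "y \<notin> S"
    proof
      assume "y \<in> S"
      then have "W [y]" using xy by (simp add: W_def)
      then show False using xy X_def by fastforce
    qed
    moreover have Wz: "W (p1 @ [z])" using take p z by blast
    moreover have "ipath ((p1 @ [z]) @ [y])"
      unfolding ipath_append[of "p1 @ [z]"]
      using Wz z yp by (auto simp: W_def)
    moreover have "hd ((p1 @ [z]) @ [y]) = hd (p1 @ [z])" "tl ((p1 @ [z]) @ [y]) = tl (p1 @ [z]) @ [y]"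
      by (cases p1; simp)+
    ultimately have "W ((p1 @ [z]) @ [y])"
      using xy unfolding W_def by auto
    then have "W (p1 @ [z, y])" by simp
    moreover have "last (p1 @ [z, y]) = y" by simp
    ultimately show False using xy X_def by blast
  qed
  then obtain p where p: "W p" "last p \<in> T" using assms(3) X_def by blast
  then have "\<exists>z\<in>set p. z \<in> T" by (metis W_def last_in_set)
  then obtain p1 z p2 where z: "p = p1 @ z # p2" "z \<in> T" "\<forall>t\<in>set p1. t \<notin> T"
    by (rule split_list_first_propE)
  have "W (p1 @ [z])" using take p z by blast
  then show thesis using that[of "p1 @ [z]"] z unfolding W_def by auto
qed

subsection \<open>Minimal ears of induced cycles\<close>

definition att :: "'a set \<Rightarrow> 'a set \<Rightarrow> 'a set" where
  "att C Q = {x \<in> C. \<exists>q\<in>Q. E q x}"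

text \<open>A subset of an induced cycle fails to be small iff it has two distinct nonadjacent
  vertices or consists of all three vertices of a triangle; \<open>minbad_solid\<close> splits along
  this.\<close>

definition small :: "'a set \<Rightarrow> 'a set \<Rightarrow> bool" where
  "small C N \<longleftrightarrow> (\<exists>x\<in>C. \<exists>y\<in>C. E x y \<and> N \<subseteq> {x, y})"

definition bad :: "'a set \<Rightarrow> 'a set \<Rightarrow> bool" where
  "bad C Q \<longleftrightarrow> conn Q \<and> Q \<inter> C = {} \<and> \<not> small C (att C Q)"

definition minbad :: "'a set \<Rightarrow> 'a set \<Rightarrow> bool" where
  "minbad C Q \<longleftrightarrow> bad C Q \<and> (\<forall>Q'\<subseteq>Q. bad C Q' \<longrightarrow> Q' = Q)"

lemma minbadD: "minbad C Q \<Longrightarrow> conn Q' \<Longrightarrow> Q' \<subseteq> Q \<Longrightarrow> \<not> small C (att C Q') \<Longrightarrow> Q' = Q"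
  unfolding minbad_def bad_def by blast

lemma small_mono: "small C N \<Longrightarrow> M \<subseteq> N \<Longrightarrow> small C M"
  unfolding small_def by blast

lemma att_mono: "Q \<subseteq> Q' \<Longrightarrow> att C Q \<subseteq> att C Q'"
  unfolding att_def by blast

lemma smallD: "small C N \<Longrightarrow> x \<in> N \<Longrightarrow> y \<in> N \<Longrightarrow> x \<noteq> y \<Longrightarrow> E x y"
  unfolding small_def using sym by blast

lemma not_small_3: "x \<in> N \<Longrightarrow> y \<in> N \<Longrightarrow> z \<in> N \<Longrightarrow> x \<noteq> y \<Longrightarrow> x \<noteq> z \<Longrightarrow> y \<noteq> z \<Longrightarrow> \<not> small C N"
  unfolding small_def by blast

lemma icycle_nbrs:
  assumes "icycle c" "x \<in> set c"
  obtains y z where "y \<in> set c" "z \<in> set c" "y \<noteq> z" "E x y" "E x z" "\<And>t. t \<in> set c \<Longrightarrow> E x t \<longleftrightarrow> t = y \<or> t = z"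
proof -
  obtain p where p: "icycle (x # p)" "set c = insert x (set p)" using icycle_at assms .
  then have "2 \<le> length p" "distinct p" using icycle_distinct[OF p(1)] by (auto simp: icycle_Cons)
  then have "p \<noteq> []" "hd p \<noteq> last p" by (cases p; auto)+
  moreover from this have "hd p \<in> set p" "last p \<in> set p" by auto
  moreover from this have "x \<noteq> hd p" "x \<noteq> last p" using p by (auto simp: icycle_Cons)
  moreover from this have "E x t \<longleftrightarrow> t = hd p \<or> t = last p" if "t \<in> set c" for t
    using that p by (cases "t = x") (auto simp: icycle_Cons)
  ultimately show thesis using that[of "hd p" "last p"] p by auto
qed

lemma small_pair:
  assumes "icycle c" "N \<subseteq> {x}" "N \<subseteq> set c"
  shows "small (set c) N"
proof -
  obtain y where y: "y \<in> set c" "N \<subseteq> {y}" using assms by (cases "N = {}") (auto simp: icycle_def, metis list.set_sel(1) length_0_conv not_numeral_le_zero)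
  obtain z where "z \<in> set c" "E y z" using icycle_nbrs[OF assms(1) y(1)] by metis
  then show ?thesis using y unfolding small_def by blast
qed

text \<open>In the order \<open>z\<close>, \<open>r\<close>, \<open>q\<close>, \<open>y\<close> the
  vertices form an induced cycle on which \<open>x\<close> sees \<open>y\<close>, \<open>z\<close>
  and \<open>hd q\<close>: a pyramid with apex \<open>x\<close>, which may have further neighbours
  on the rim.\<close>

lemma solid_triangle_aux:
  assumes adj: "E x y" "E x z" "E y z" and ip: "ipath q" "ipath r" "q \<noteq> []" "r \<noteq> []"
    and nin: "{x, y, z} \<inter> (set q \<union> set r) = {}" and dis: "set q \<inter> set r = {}"
    and qx: "E x (hd q)" and qy: "\<And>s. s \<in> set q \<Longrightarrow> E y s \<longleftrightarrow> s = last q" and qz: "\<And>s. s \<in> set q \<Longrightarrow> \<not> E z s"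
    and rz: "\<And>s. s \<in> set r \<Longrightarrow> E z s \<longleftrightarrow> s = hd r" and ry: "\<And>s. s \<in> set r \<Longrightarrow> \<not> E y s"
    and qr: "\<And>s t. s \<in> set r \<Longrightarrow> t \<in> set q \<Longrightarrow> E s t \<longleftrightarrow> s = last r \<and> t = hd q"
  shows "solid ({x, y, z} \<union> set q \<union> set r)"
proof -
  let ?c = "z # r @ q @ [y]"
  have "ipath (q @ [y])" using ip nin qy E_commute[of _ y] by (auto simp: ipath_append)
  then have "ipath (r @ q @ [y])"
    using ip nin dis qr ry E_commute[of _ y] by (subst ipath_append) auto
  then have "icycle ?c"
    using ip nin rz qz adj by (auto simp: icycle_Cons sym Suc_le_eq)
  moreover have "x \<notin> set ?c" using nin adj by auto
  moreover have "3 \<le> card {s \<in> set ?c. E x s}"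
    by (rule card_ge_3I[of _ y z "hd q"]) (use adj qx ip nin in auto)
  ultimately have "solid (insert x (set ?c))" by (rule solid_pyramidI)
  moreover have "insert x (set ?c) = {x, y, z} \<union> set q \<union> set r" by auto
  ultimately show ?thesis by simp
qed

text \<open>The case where the cycle is a triangle. Take an induced path \<open>q\<close> in
  \<open>Q\<close> between contacts with \<open>x\<close> and \<open>y\<close>. If \<open>z\<close>
  sees \<open>q\<close>, minimality gives a pyramid with apex \<open>z\<close>. Otherwise a path
  \<open>r\<close> leads from \<open>z\<close> to \<open>q\<close>, minimality leaves nothing else
  in \<open>Q\<close>, and the last vertex \<open>m\<close> of \<open>r\<close> decides. One
  neighbour \<open>a\<close> on \<open>q\<close> gives a stamp with apex \<open>a\<close>, or a
  pyramid if \<open>x\<close> or \<open>y\<close> sees \<open>r\<close>. Several neighbours give a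
  prism with triangles \<open>xyz\<close> and \<open>mab\<close>.\<close>

lemma solid_triangle:
  assumes adj: "E x y" "E x z" "E y z" and Q: "conn Q" and nin: "{x, y, z} \<inter> Q = {}"
    and touch: "\<exists>s\<in>Q. E x s" "\<exists>s\<in>Q. E y s" "\<exists>s\<in>Q. E z s"
    and min: "\<And>Q'. conn Q' \<Longrightarrow> Q' \<subseteq> Q \<Longrightarrow> \<exists>s\<in>Q'. E x s \<Longrightarrow> \<exists>s\<in>Q'. E y s \<Longrightarrow> \<exists>s\<in>Q'. E z s \<Longrightarrow> Q' = Q"
  shows "solid ({x, y, z} \<union> Q)"
proof -
  have ne: "x \<noteq> y" "x \<noteq> z" "y \<noteq> z" using adj by auto
  obtain q where q: "ipath q" "q \<noteq> []" "set q \<subseteq> Q" "hd q \<in> {s. E x s}" "last q \<in> {s. E y s}"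
    "set (tl q) \<inter> {s. E x s} = {}" "set (butlast q) \<inter> {s. E y s} = {}"
    using touch by (rule_tac conn_ipath[OF Q, of "{s. E x s}" "{s. E y s}"]) auto
  have qx: "E x s \<longleftrightarrow> s = hd q" if "s \<in> set q" for s
    using q that by (cases q) auto
  have qy: "E y s \<longleftrightarrow> s = last q" if "s \<in> set q" for s
    using q that by (cases q rule: rev_cases) auto
  have hl: "hd q \<in> set q" "last q \<in> set q" using q by auto
  have nq: "x \<notin> set q" "y \<notin> set q" "z \<notin> set q" using nin q by auto
  have "ipath (q @ [y])" using q nq qy E_commute[of _ y] by (auto simp: ipath_append)
  then have xqy: "icycle (x # q @ [y])" using q qx nq ne adj by (auto simp: icycle_Cons Suc_le_eq)
  show ?thesis
  proof (cases "\<exists>s\<in>set q. E z s")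
    case True
    then have "set q = Q" using min[OF ipath_conn] q qx qy hl by blast
    note xqy
    moreover have "z \<notin> set (x # q @ [y])" using nq ne by auto
    moreover obtain s where "s \<in> set q" "E z s" using True by blast
    then have "3 \<le> card {s \<in> set (x # q @ [y]). E z s}"
      by (intro card_ge_3I[of _ x y s]) (use nq ne adj sym in auto)
    ultimately have "solid (insert z (set (x # q @ [y])))" by (rule solid_pyramidI)
    moreover have "insert z (set (x # q @ [y])) = {x, y, z} \<union> Q" using \<open>set q = Q\<close> by auto
    ultimately show ?thesis by simp
  next
    case False
    then have qz: "\<not> E z s" if "s \<in> set q" for s using that by blast
    have "set q \<noteq> Q" using qz touch by blast
    then have "\<exists>s\<in>set q. \<exists>t\<in>Q - set q. E s t"
      using q(2) by (intro connD[OF Q q(3)]) auto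
    then have "{s. \<exists>t\<in>set q. E s t} \<inter> Q \<noteq> {}" using sym by blast
    then obtain r where r: "ipath r" "r \<noteq> []" "set r \<subseteq> Q" "hd r \<in> {s. E z s}" "last r \<in> {s. \<exists>t\<in>set q. E s t}"
      "set (tl r) \<inter> {s. E z s} = {}" "set (butlast r) \<inter> {s. \<exists>t\<in>set q. E s t} = {}"
      using touch by (rule_tac conn_ipath[OF Q, of "{s. E z s}" "{s. \<exists>t\<in>set q. E s t}"]) auto
    have rz: "E z s \<longleftrightarrow> s = hd r" if "s \<in> set r" for s
      using r that by (cases r) auto
    have hr: "hd r \<in> set r" "last r \<in> set r" using r by auto
    have nr: "x \<notin> set r" "y \<notin> set r" "z \<notin> set r" using nin r by auto
    define m where "m = last r"
    have rq: "s = m" if "s \<in> set r" "t \<in> set q" "E s t" for s t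
      using r that unfolding m_def by (cases r rule: rev_cases) auto
    \<comment> \<open>A vertex of \<open>r\<close> on \<open>q\<close> is not the first of
      \<open>r\<close>, as \<open>z\<close> does not see \<open>q\<close>; its predecessor would
      then see \<open>q\<close> before the end of \<open>r\<close> is reached.\<close>
    have dis: "set q \<inter> set r = {}"
    proof (rule ccontr)
      assume "set q \<inter> set r \<noteq> {}"
      then obtain s r1 r2 where s: "s \<in> set q" "r = r1 @ s # r2" by (meson split_list disjoint_iff)
      have "r1 \<noteq> []" using s r(4) qz by auto
      then have "E (last r1) s" "last r1 \<in> set r" using r(1) s by (auto simp: ipath_append)
      then have "last r1 = m" using rq s by blast
      moreover have "m \<in> set (s # r2)" using s by (simp add: m_def)
      moreover have "last r1 \<in> set r1" using \<open>r1 \<noteq> []\<close> by simp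
      ultimately show False using ipath_distinct[OF r(1)] s by auto
    qed
    have "\<exists>a\<in>set q. \<exists>b\<in>set r. E a b" using r(5) hr sym by blast
    then have "conn (set q \<union> set r)" using r q by (intro conn_Un ipath_conn disjI2)
    then have QQ: "Q = set q \<union> set r" using min[of "set q \<union> set r"] q r qx qy rz hl hr by blast
    have "\<exists>a\<in>set q. E m a" using r m_def by auto
    then obtain q1 a q2 where a: "q = q1 @ a # q2" "E m a" "\<forall>t\<in>set q1. \<not> E m t"
      by (rule split_list_first_propE)
    have mr: "m \<in> set r" using hr m_def by simp
    have ipz: "ipath (z # r)" using r(1) rz nr by auto
    have dzr: "set (z # r) \<inter> ({x, y} \<union> set q) = {}" using ne nq nr dis by auto
    have att_z: "E z t \<longleftrightarrow> t = x \<or> t = y" if "t \<in> {x, y} \<union> set q" for t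
      using that adj qz nq by (auto dest: sym)
    have arith: "{x, y, z} \<inter> (set q \<union> set r) = {}" "{y, x, z} \<inter> (set (rev q) \<union> set r) = {}" using nq nr by auto
    show ?thesis
    proof (cases "\<exists>b\<in>set q2. E m b")
      case False
      then have qm: "E s t \<longleftrightarrow> s = m \<and> t = a" if "s \<in> set r" "t \<in> set q" for s t
        using rq[OF that] a that by auto
      consider "\<exists>s\<in>set r. E x s" | "\<exists>s\<in>set r. E y s" | "\<forall>s\<in>set r. \<not> E x s \<and> \<not> E y s" by blast
      then show ?thesis
      proof cases
        case 1
        \<comment> \<open>\<open>r\<close> touches \<open>x\<close> and \<open>z\<close>, and the
          tail of \<open>q\<close> from \<open>a\<close> on touches \<open>y\<close>; so minimality
          leaves no vertex of \<open>q\<close> before \<open>a\<close>.\<close>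
        have "conn (set r \<union> set (a # q2))"
          using r q a mr by (intro conn_Un ipath_conn disjI2) (auto simp: ipath_append)
        moreover have "last q \<in> set (a # q2)" using a by simp
        ultimately have "set r \<union> set (a # q2) = Q"
        proof (intro min)
          show "set r \<union> set (a # q2) \<subseteq> Q" using QQ a by auto
          show "\<exists>s\<in>set r \<union> set (a # q2). E x s" using 1 by blast
          show "\<exists>s\<in>set r \<union> set (a # q2). E y s" using \<open>last q \<in> set (a # q2)\<close> qy[OF hl(2)] by blast
          show "\<exists>s\<in>set r \<union> set (a # q2). E z s" using hr(1) rz[OF hr(1)] by blast
        qed
        then have "q1 = []" using dis a QQ ipath_distinct[OF q(1)] by (cases q1) auto
        then have ha: "hd q = a" using a by simp
        have ry: "\<not> E y s" if "s \<in> set r" for s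
        proof
          assume "E y s"
          then have "set r = Q" using min[OF ipath_conn] r that 1 rz hr by blast
          then show False using QQ dis hl by auto
        qed
        have "solid ({x, y, z} \<union> set q \<union> set r)"
          by (rule solid_triangle_aux) (use adj q r dis arith qx hl qy qz rz ry qm ha m_def in auto)
        then show ?thesis using QQ by (simp add: Un_assoc)
      next
        case 2
        \<comment> \<open>The mirror image of the previous case, with \<open>q\<close> reversed and
          \<open>x\<close> and \<open>y\<close> exchanged.\<close>
        have "conn (set r \<union> set (q1 @ [a]))"
          using r q a mr by (intro conn_Un ipath_conn disjI2) (auto simp: ipath_append)
        moreover have "hd q \<in> set (q1 @ [a])" using a by (cases q1) auto
        ultimately have "set r \<union> set (q1 @ [a]) = Q"
        proof (intro min)
          show "set r \<union> set (q1 @ [a]) \<subseteq> Q" using QQ a by auto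
          show "\<exists>s\<in>set r \<union> set (q1 @ [a]). E y s" using 2 by blast
          show "\<exists>s\<in>set r \<union> set (q1 @ [a]). E x s" using \<open>hd q \<in> set (q1 @ [a])\<close> qx[OF hl(1)] by blast
          show "\<exists>s\<in>set r \<union> set (q1 @ [a]). E z s" using hr(1) rz[OF hr(1)] by blast
        qed
        then have "q2 = []" using dis a QQ ipath_distinct[OF q(1)] by (cases q2) auto
        then have ha: "last q = a" using a by simp
        have rx: "\<not> E x s" if "s \<in> set r" for s
        proof
          assume "E x s"
          then have "set r = Q" using min[OF ipath_conn] r that 2 rz hr by blast
          then show False using QQ dis hl by auto
        qed
        have "solid ({y, x, z} \<union> set (rev q) \<union> set r)"
        proof (rule solid_triangle_aux)
          show "E y x" "E y z" "E x z" using adj sym by blast+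
          show "ipath (rev q)" "rev q \<noteq> []" "set (rev q) \<inter> set r = {}" using q dis by simp_all
          show "E y (hd (rev q))" using q by (simp add: hd_rev)
          show "E x s \<longleftrightarrow> s = last (rev q)" if "s \<in> set (rev q)" for s
            using qx[of s] that q(2) by (simp add: last_rev)
          show "\<not> E z s" if "s \<in> set (rev q)" for s using qz that by simp
          show "E s t \<longleftrightarrow> s = last r \<and> t = hd (rev q)" if "s \<in> set r" "t \<in> set (rev q)" for s t
            using qm[of s t] that ha q(2) by (simp add: hd_rev m_def)
        qed (use r rz rx arith in simp_all)
        then show ?thesis using QQ by (simp add: Un_assoc insert_commute)
      next
        case 3
        \<comment> \<open>The cycle through \<open>x\<close>, \<open>q\<close> and \<open>y\<close>
          is read from \<open>a\<close>, the future apex; the ear \<open>z # r\<close> completes the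
          edge \<open>xy\<close> to the triangle.\<close>
        have "icycle (a # (q2 @ [y]) @ x # q1)" using icycle_rotate[of "x # q1" "a # q2 @ [y]"] xqy a(1) by simp
        then have "icycle (a # rev (x # q1) @ y # rev q2)" using icycle_rev_Cons by fastforce
        moreover have "E s t \<longleftrightarrow> s = hd (z # r) \<and> (t = hd (x # q1) \<or> t = hd (y # rev q2)) \<or> s = last (z # r) \<and> t = a"
          if "s \<in> set (z # r)" "t \<in> set (a # (x # q1) @ y # rev q2)" for s t
        proof -
          have t: "t = x \<or> t = y \<or> t \<in> set q" using that(2) a(1) by auto
          have "a \<noteq> x" "a \<noteq> y" "z \<noteq> m" using nq nr mr a(1) by auto
          then show ?thesis using att_z[of t] E_commute[of s t] qm[of s t] 3 t that(1) nr nq r(2) by (auto simp: m_def)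
        qed
        ultimately have "solid (insert a (set (x # q1) \<union> set (y # rev q2) \<union> set (z # r)))"
          using ipz dzr a(1) by (intro solid_ear_stamp) auto
        moreover have "insert a (set (x # q1) \<union> set (y # rev q2) \<union> set (z # r)) = {x, y, z} \<union> Q" using QQ a(1) by auto
        ultimately show ?thesis by metis
      qed
    next
      case True
      then obtain p b q3 where b: "q2 = p @ b # q3" "E m b" "\<forall>t\<in>set q3. \<not> E m t"
        by (rule split_list_last_propE)
      have ipa: "ipath (q1 @ [a])" "ipath (b # q3)" using q(1) a b by (auto simp: ipath_append)
      \<comment> \<open>The stretch of \<open>q\<close> strictly between its first and last
        neighbour of \<open>m\<close> can be bypassed through \<open>m\<close>, so minimality makes
        \<open>a\<close> and \<open>b\<close> consecutive.\<close>
      have "conn ((set (q1 @ [a]) \<union> set r) \<union> set (b # q3))"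
        using ipa r mr a b by (intro conn_Un ipath_conn disjI2) (auto dest: sym)
      moreover have hq: "hd q = hd (q1 @ [a])" "last q = last (b # q3)" using a b by (cases q1; simp)+
      moreover have hq': "hd q \<in> set (q1 @ [a])" "last q \<in> set (b # q3)"
        unfolding hq by (rule hd_in_set last_in_set; simp)+
      ultimately have eq: "(set (q1 @ [a]) \<union> set r) \<union> set (b # q3) = Q"
      proof (intro min)
        let ?W = "(set (q1 @ [a]) \<union> set r) \<union> set (b # q3)"
        show "?W \<subseteq> Q" using QQ a b by auto
        show "\<exists>s\<in>?W. E x s" using hq'(1) qx[OF hl(1)] by blast
        show "\<exists>s\<in>?W. E y s" using hq'(2) qy[OF hl(2)] by blast
        show "\<exists>s\<in>?W. E z s" using hr(1) rz[OF hr(1)] by blast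
      qed
      have "p = []" using eq dis a b QQ ipath_distinct[OF q(1)] by (cases p) auto
      then have qq: "q = q1 @ a # b # q3" using a b by simp
      have dq: "a \<notin> set q1" "a \<notin> set q3" "b \<notin> set q3" "b \<notin> set q1" "a \<noteq> b" "set q1 \<inter> set q3 = {}"
        using ipath_distinct[OF q(1)] qq by auto
      have qm: "E s t \<longleftrightarrow> s = m \<and> (t = a \<or> t = b)" if "s \<in> set r" "t \<in> set q" for s t
        using rq[OF that] a b qq that by auto
      have rx: "\<not> E x s" if "s \<in> set r" for s
      proof
        assume "E x s"
        moreover have "conn (set r \<union> set (b # q3))"
          using r ipa b mr by (intro conn_Un ipath_conn disjI2) auto
        ultimately have "set r \<union> set (b # q3) = Q"
        proof (intro min)
          let ?W = "set r \<union> set (b # q3)"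
          show "?W \<subseteq> Q" using QQ qq by auto
          show "\<exists>s\<in>?W. E x s" if "E x s" using that \<open>s \<in> set r\<close> by blast
          show "\<exists>s\<in>?W. E y s" using hq'(2) qy[OF hl(2)] by blast
          show "\<exists>s\<in>?W. E z s" using hr(1) rz[OF hr(1)] by blast
        qed
        then show False using dis qq QQ dq by auto
      qed
      have ry: "\<not> E y s" if "s \<in> set r" for s
      proof
        assume "E y s"
        moreover have "conn (set r \<union> set (q1 @ [a]))"
          using r ipa a mr by (intro conn_Un ipath_conn disjI2) auto
        ultimately have "set r \<union> set (q1 @ [a]) = Q"
        proof (intro min)
          let ?W = "set r \<union> set (q1 @ [a])"
          show "?W \<subseteq> Q" using QQ qq by auto
          show "\<exists>s\<in>?W. E y s" if "E y s" using that \<open>s \<in> set r\<close> by blast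
          show "\<exists>s\<in>?W. E x s" using hq'(1) qx[OF hl(1)] by blast
          show "\<exists>s\<in>?W. E z s" using hr(1) rz[OF hr(1)] by blast
        qed
        then show False using dis qq QQ dq by auto
      qed
      let ?p = "x # q1 @ [a]" and ?r = "y # rev (b # q3)"
      have "icycle (?p @ rev ?r)" using xqy qq by simp
      moreover have "E s t \<longleftrightarrow> s = hd (z # r) \<and> (t = hd ?p \<or> t = hd ?r) \<or> s = last (z # r) \<and> (t = last ?p \<or> t = last ?r)"
        if "s \<in> set (z # r)" "t \<in> set (?p @ ?r)" for s t
      proof -
        have t: "t = x \<or> t = y \<or> t \<in> set q" using that(2) qq by auto
        have "a \<noteq> x" "a \<noteq> y" "b \<noteq> x" "b \<noteq> y" "z \<noteq> m" using nq nr mr qq by auto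
        then show ?thesis using att_z[of t] E_commute[of s t] qm[of s t] rx ry t that(1) nr nq r(2) by (auto simp: m_def)
      qed
      ultimately have "solid (set ?p \<union> set ?r \<union> set (z # r))"
        using ipz dzr qq r(2) by (intro solid_ear_prism) (auto simp: Suc_le_eq)
      moreover have "set ?p \<union> set ?r \<union> set (z # r) = {x, y, z} \<union> Q" using QQ qq by auto
      ultimately show ?thesis by metis
    qed
  qed
qed

text \<open>Three or more neighbours on the cycle give a pyramid. Exactly two are nonadjacent and
  give a trihedron whose third path has \<open>z\<close> as its only interior vertex.\<close>

lemma solid_single:
  assumes c: "icycle c" and z: "z \<notin> set c" and ns: "\<not> small (set c) (att (set c) {z})"
  shows "solid (insert z (set c))"
proof (cases "3 \<le> card {x \<in> set c. E z x}")
  case True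
  then show ?thesis using solid_pyramidI c z by blast
next
  case False
  let ?N = "{x \<in> set c. E z x}"
  have N: "att (set c) {z} = ?N" by (auto simp: att_def)
  have "\<not> ?N \<subseteq> {x}" for x using small_pair[OF c, of ?N x] ns N by auto
  then obtain x y where xy: "x \<in> ?N" "y \<in> ?N" "x \<noteq> y" by blast
  have only: "t = x \<or> t = y" if "t \<in> ?N" for t
    using card_ge_3I[of ?N t x y] that xy False by auto
  then have "?N \<subseteq> {x, y}" by blast
  then have nE: "\<not> E x y" using ns xy N unfolding small_def by auto
  obtain R where R: "icycle (x # R)" "set c = insert x (set R)" using icycle_at[OF c, of x] xy by blast
  then have "y \<in> set R" using xy by auto
  then obtain p r where pr: "R = p @ y # r" by (meson split_list)
  have "p \<noteq> []" "r \<noteq> []" using R(1) pr nE by (auto simp: icycle_Cons)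
  then have "solid (set (x # p @ y # r) \<union> set [z])"
    using R pr z xy only by (intro solid_ear_trihedron) auto
  then show ?thesis using R pr by simp
qed

text \<open>The cycle is rerouted: \<open>R\<close> closed up by \<open>q\<close> instead of
  \<open>z\<close> is again an induced cycle, and \<open>z\<close> sees both ends of
  \<open>R\<close> as well as a vertex of \<open>q\<close>, which makes it the apex of a
  pyramid.\<close>

lemma solid_wheel_ear:
  assumes c: "icycle (z # R)" and q: "ipath q" "2 \<le> length q" "set q \<inter> set (z # R) = {}"
    and E: "\<And>s t. s \<in> set q \<Longrightarrow> t \<in> set R \<Longrightarrow> E s t \<longleftrightarrow> s = hd q \<and> t = hd R \<or> s = last q \<and> t = last R"
    and z: "s \<in> set q" "E z s"
  shows "solid (set (z # R) \<union> set q)"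
proof -
  have R: "ipath R" "z \<notin> set R" "2 \<le> length R" using c by (auto simp: icycle_Cons)
  have "hd R \<in> set R" "last R \<in> set R" using R by (auto intro!: hd_in_set last_in_set)
  then have zR: "E z (hd R)" "E z (last R)"
    using c R by (auto simp: icycle_Cons)
  obtain x R' where xR: "R = x # R'" "R' \<noteq> []" using R(3) by (cases R) (auto simp: Suc_le_eq)
  have x: "x \<notin> set R'" "last R' \<in> set R'" "hd R' \<in> set R'" using R(1) xR by auto
  then have nx: "last R' \<noteq> x" by auto
  have qne: "q \<noteq> []" using q by auto
  have "E t s \<longleftrightarrow> t = last R' \<and> s = last q" if "t \<in> set R'" "s \<in> set q" for s t
  proof -
    have "t \<noteq> x" using that x by auto
    then show ?thesis using E[of s t] that xR nx E_commute[of s t] by auto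
  qed
  then have "ipath (R' @ rev q)"
    using R(1) xR q qne by (auto simp: ipath_append hd_rev)
  moreover have "E x s \<longleftrightarrow> s = hd R' \<or> s = hd q" if "s \<in> set R' \<union> set q" for s
  proof (cases "s \<in> set R'")
    case True
    then have "s \<notin> set q" using q(3) xR by auto
    then have "s \<noteq> hd q" using qne by auto
    then show ?thesis using True R(1) xR by auto
  next
    case False
    then have "s \<noteq> hd R'" "s \<in> set q" using x that by auto
    then show ?thesis using E[of s x] xR nx E_commute[of x s] by auto
  qed
  moreover have "2 \<le> length (R' @ rev q)" using q by simp
  moreover have "x \<notin> set (R' @ rev q)" using x q xR by auto
  ultimately have "icycle (x # R' @ rev q)"
    using xR(2) qne by (auto simp: icycle_Cons last_rev)
  moreover have "z \<notin> set (x # R' @ rev q)" using q R xR by auto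
  moreover have "3 \<le> card {t \<in> set (x # R' @ rev q). E z t}"
    by (rule card_ge_3I[of _ x "last R'" s]) (use zR xR nx x z q in auto)
  ultimately have "solid (insert z (set (x # R' @ rev q)))" by (rule solid_pyramidI)
  moreover have "insert z (set (x # R' @ rev q)) = set (z # R) \<union> set q" using xR by auto
  ultimately show ?thesis by simp
qed

text \<open>By minimality an induced path \<open>q\<close> between contacts with \<open>x\<close>
  and \<open>y\<close> is all of \<open>Q\<close>, and dropping one of its ends leaves small
  attachments. So \<open>q\<close> without its last vertex attaches within an edge
  \<open>xx'\<close>, and without its first within an edge \<open>yy'\<close>. Unless
  \<open>x' = y'\<close> is seen by \<open>q\<close>, only the ends of \<open>q\<close> attach, each
  to a vertex or to an edge of the cycle: two vertices give a trihedron, a vertex and an edge a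
  stamp, two edges a prism.\<close>

lemma solid_nonadjacent:
  assumes c: "icycle c" and mb: "minbad (set c) Q" and nsing: "\<And>s. Q \<noteq> {s}"
    and x: "x \<in> att (set c) Q" and y: "y \<in> att (set c) Q" and xy: "x \<noteq> y" "\<not> E x y"
  shows "solid (set c \<union> Q)"
proof -
  let ?C = "set c"
  have Q: "conn Q" "Q \<inter> ?C = {}" using mb by (auto simp: minbad_def bad_def)
  have xyC: "x \<in> ?C" "y \<in> ?C" using x y by (auto simp: att_def)
  obtain q where q: "ipath q" "q \<noteq> []" "set q \<subseteq> Q" "hd q \<in> {s. E s x}" "last q \<in> {s. E s y}"
    "set (tl q) \<inter> {s. E s x} = {}" "set (butlast q) \<inter> {s. E s y} = {}"
    using x y by (rule_tac conn_ipath[OF Q(1), of "{s. E s x}" "{s. E s y}"]) (auto simp: att_def)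
  have hl: "hd q \<in> set q" "last q \<in> set q" using q by auto
  have qx: "E s x \<longleftrightarrow> s = hd q" if "s \<in> set q" for s
    using q that by (cases q) auto
  have qy: "E s y \<longleftrightarrow> s = last q" if "s \<in> set q" for s
    using q that by (cases q rule: rev_cases) auto
  have "x \<in> att ?C (set q)" "y \<in> att ?C (set q)" using q hl xyC by (auto simp: att_def)
  then have "\<not> small ?C (att ?C (set q))" using smallD xy by blast
  then have qQ: "set q = Q" using minbadD[OF mb ipath_conn] q by blast
  have len: "2 \<le> length q"
  proof (rule ccontr)
    assume "\<not> 2 \<le> length q"
    then obtain s where "q = [s]" using q(2) by (cases q) (auto simp: not_le)
    then show False using qQ nsing by auto
  qed
  have dq: "set q \<inter> ?C = {}" using qQ Q by simp
  have hne: "hd q \<noteq> last q" using len ipath_distinct[OF q(1)] by (cases q) (auto split: if_splits)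
  have b: "q = butlast q @ [last q]" and t: "q = hd q # tl q" using q(2) by simp_all
  have bne: "butlast q \<noteq> []" "tl q \<noteq> []" using len b t by (metis One_nat_def append_Nil length_Cons list.size(3) not_less_eq_eq numeral_2_eq_2 order_refl)+
  have ipb: "ipath (butlast q)" using q(1) b by (metis ipath_append)
  have ipt: "ipath (tl q)" using q(1) t by (metis ipath.simps(2))
  have din: "last q \<notin> set (butlast q)" "hd q \<notin> set (tl q)"
    using ipath_distinct[OF q(1)] b t by (metis distinct_append distinct.simps(2) not_distinct_conv_prefix, metis distinct.simps(2))
  have sb: "set (butlast q) = set q - {last q}" "set (tl q) = set q - {hd q}"
    using arg_cong[OF b, of set] arg_cong[OF t, of set] din by auto
  have "small ?C (att ?C (set (butlast q)))"
    using minbadD[OF mb ipath_conn[OF ipb bne(1)]] sb qQ hl by blast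
  moreover have "x \<in> att ?C (set (butlast q))" using sb hl hne qx xyC by (auto simp: att_def)
  ultimately obtain x' where x': "x' \<in> ?C" "E x x'" "att ?C (set (butlast q)) \<subseteq> {x, x'}"
    unfolding small_def using sym by blast
  have "small ?C (att ?C (set (tl q)))"
    using minbadD[OF mb ipath_conn[OF ipt bne(2)]] sb qQ hl by blast
  moreover have "y \<in> att ?C (set (tl q))" using sb hl hne qy xyC by (auto simp: att_def)
  ultimately obtain y' where y': "y' \<in> ?C" "E y y'" "att ?C (set (tl q)) \<subseteq> {y, y'}"
    unfolding small_def using sym by blast
  have inx: "t = x \<or> t = x'" if "t \<in> ?C" "s \<in> set q" "s \<noteq> last q" "E s t" for s t
    using x'(3) sb that by (auto simp: att_def)
  have iny: "t = y \<or> t = y'" if "t \<in> ?C" "s \<in> set q" "s \<noteq> hd q" "E s t" for s t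
    using y'(3) sb that by (auto simp: att_def)
  have ne: "x' \<noteq> x" "y' \<noteq> y" "x' \<noteq> y" "y' \<noteq> x" using x' y' xy sym by auto
  show ?thesis
  proof (cases "x' = y' \<and> (\<exists>s\<in>set q. E x' s)")
    \<comment> \<open>The common neighbour \<open>x'\<close> of \<open>x\<close> and
      \<open>y\<close> on the cycle may be seen from anywhere on \<open>q\<close>; it becomes the
      apex of a pyramid.\<close>
    case True
    then obtain s where s: "s \<in> set q" "E x' s" by blast
    obtain R where R: "icycle (x' # R)" "?C = insert x' (set R)" using icycle_at[OF c x'(1)] by blast
    have Rl: "2 \<le> length R" "ipath R" "x' \<notin> set R" using R(1) by (auto simp: icycle_Cons)
    have "x \<in> set R" "y \<in> set R" using R(2) xyC ne by auto
    then have hlR: "{x, y} \<subseteq> {hd R, last R}"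
      using R(1) x'(2) y'(2) True sym unfolding icycle_Cons by blast
    have EE: "E s t \<longleftrightarrow> s = hd q \<and> t = x \<or> s = last q \<and> t = y" if "s \<in> set q" "t \<in> set R" for s t
    proof
      assume E: "E s t"
      have t: "t \<in> ?C" "t \<noteq> x'" using R Rl that by auto
      then have "s \<noteq> last q \<Longrightarrow> t = x" "s \<noteq> hd q \<Longrightarrow> t = y"
        using inx[of t s] iny[of t s] that E True by auto
      then show "s = hd q \<and> t = x \<or> s = last q \<and> t = y" using hne xy by metis
    next
      assume "s = hd q \<and> t = x \<or> s = last q \<and> t = y"
      then show "E s t" using qx qy hl by blast
    qed
    show ?thesis
    proof (cases "hd R = x")
      case True
      then have "last R = y" using hlR xy by blast
      then have "solid (set (x' # R) \<union> set q)"
        using True EE dq R s by (intro solid_wheel_ear[OF R(1) q(1) len _ _ s]) auto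
      then show ?thesis using R qQ by simp
    next
      case False
      then have "last R = x" "hd R = y" using hlR xy by blast+
      moreover have "R \<noteq> []" using Rl by auto
      ultimately have "solid (set (x' # rev R) \<union> set q)"
        using EE dq R s by (intro solid_wheel_ear[OF icycle_rev_Cons[OF R(1)] q(1) len _ _ s]) (auto simp: hd_rev last_rev)
      then show ?thesis using R qQ by simp
    qed
  next
    case False
    define ux where "ux \<longleftrightarrow> E (hd q) x'"
    define uy where "uy \<longleftrightarrow> E (last q) y'"
    have nI: "x' = y' \<Longrightarrow> s \<in> set q \<Longrightarrow> \<not> E s x'" for s using False sym by blast
    have EE: "E s t \<longleftrightarrow> s = hd q \<and> (t = x \<or> ux \<and> t = x') \<or> s = last q \<and> (t = y \<or> uy \<and> t = y')"
      if "s \<in> set q" "t \<in> ?C" for s t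
    proof
      assume E: "E s t"
      have 1: "s \<noteq> last q \<Longrightarrow> t = x \<or> t = x'" "s \<noteq> hd q \<Longrightarrow> t = y \<or> t = y'"
        using inx[of t s] iny[of t s] that E by auto
      show "s = hd q \<and> (t = x \<or> ux \<and> t = x') \<or> s = last q \<and> (t = y \<or> uy \<and> t = y')"
      proof (cases "s = hd q")
        case True
        then show ?thesis using 1 E hne ux_def by auto
      next
        case n: False
        show ?thesis
        proof (cases "s = last q")
          case True
          then show ?thesis using 1 E n uy_def by auto
        next
          case n2: False
          then have "t \<noteq> x" "t \<noteq> y" using qx[OF that(1)] qy[OF that(1)] n E by auto
          then have "t = x'" "t = y'" using 1 n n2 by auto
          then show ?thesis using nI[of s] that E by auto
        qed
      qed
    next
      assume "s = hd q \<and> (t = x \<or> ux \<and> t = x') \<or> s = last q \<and> (t = y \<or> uy \<and> t = y')"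
      then show "E s t" using qx qy hl ux_def uy_def by blast
    qed
    have uxy: "ux \<Longrightarrow> x' \<noteq> y'" "uy \<Longrightarrow> x' \<noteq> y'" using nI hl ux_def uy_def by blast+
    \<comment> \<open>Placing \<open>x'\<close> last fixes the orientation of the cycle. Then
      \<open>y'\<close> can lie on either side of \<open>y\<close>, so each case with
      \<open>uy\<close> occurs twice.\<close>
    obtain R where R: "icycle (x # R)" "?C = insert x (set R)" "last R = x'"
    proof -
      obtain R where R: "icycle (x # R)" "?C = insert x (set R)" using icycle_at[OF c xyC(1)] by blast
      have "x' = hd R \<or> x' = last R" "R \<noteq> []" using R x' ne by (auto simp: icycle_Cons)
      then show thesis using that[of R] that[of "rev R"] R icycle_rev_Cons[OF R(1)] by (auto simp: last_rev)
    qed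
    then have "y \<in> set R" using xyC xy by auto
    then obtain p r where pr: "R = p @ y # r" by (meson split_list)
    have pne: "p \<noteq> []" using R(1) xy pr by (auto simp: icycle_Cons)
    have rne: "r \<noteq> []" using R(3) pr ne by auto
    have cc: "icycle (x # p @ y # r)" and C: "?C = set (x # p @ y # r)" and lr: "last r = x'"
      using R pr rne by auto
    have cy: "icycle (y # r @ x # p)" using icycle_rotate[of "x # p" "y # r"] cc by simp
    have "y' \<in> set (r @ x # p)" using y'(1) C ne by auto
    then have y'': "y' = hd r \<or> y' = last p"
      using cy y'(2) rne pne unfolding icycle_Cons by auto
    consider "\<not> ux" "\<not> uy" | "ux" "\<not> uy" | "\<not> ux" "uy" "y' = last p" | "\<not> ux" "uy" "y' = hd r"
      | "ux" "uy" "y' = hd r" | "ux" "uy" "y' = last p" using y'' by blast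
    then have "solid (?C \<union> set q)"
    proof cases
      case 1
      then show ?thesis unfolding C using EE dq q C
        by (intro solid_ear_trihedron[OF cc pne rne]) auto
    next
      case 2
      have "icycle (y # rev (rev r) @ x # p)" using cy by simp
      then have "solid (insert y (set (rev r) \<union> set (x # p) \<union> set q))"
        using 2 EE dq q C lr rne by (intro solid_ear_stamp) (auto simp: hd_rev)
      moreover have "insert y (set (rev r) \<union> set (x # p)) = ?C" using C by auto
      ultimately show ?thesis by (metis Un_insert_left)
    next
      case 3
      have "icycle (x # rev (rev p) @ y # r)" using cc by simp
      then have "solid (insert x (set (rev p) \<union> set (y # r) \<union> set (rev q)))"
        using 3 EE dq q C pne by (intro solid_ear_stamp) (auto simp: hd_rev last_rev)
      moreover have "insert x (set (rev p) \<union> set (y # r)) = ?C" using C by auto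
      ultimately show ?thesis by (metis Un_insert_left set_rev)
    next
      case 4
      have "icycle (x # rev r @ y # rev p)" using icycle_rev_Cons[OF cc] by simp
      then have "solid (insert x (set r \<union> set (y # rev p) \<union> set (rev q)))"
        using 4 EE dq q C rne by (intro solid_ear_stamp) (auto simp: hd_rev last_rev)
      moreover have "insert x (set r \<union> set (y # rev p)) = ?C" using C by auto
      ultimately show ?thesis by (metis Un_insert_left set_rev)
    next
      case 5
      let ?p = "x # p @ [y]" and ?r = "rev r"
      \<comment> \<open>The ends of the arc \<open>r\<close> are \<open>y'\<close> and
        \<open>x'\<close>; that they differ gives this arc the two vertices that a prism
        needs.\<close>
      have "hd r \<noteq> last r" using 5 uxy lr by auto
      then have "2 \<le> length r" using rne by (cases r) (auto simp: Suc_le_eq)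
      then have "solid (set ?p \<union> set ?r \<union> set q)"
        using 5 EE dq q C cc len rne lr by (intro solid_ear_prism) (auto simp: hd_rev last_rev)
      moreover have "set ?p \<union> set ?r = ?C" using C by auto
      ultimately show ?thesis by metis
    next
      case 6
      let ?p = "x # p" and ?r = "rev (y # r)"
      have "hd ?r = x'" "last ?r = y" using lr rne by (simp_all add: hd_append hd_rev)
      then have "solid (set ?p \<union> set ?r \<union> set q)"
        using 6 EE dq q C cc len rne lr pne by (intro solid_ear_prism) (auto simp: Suc_le_eq)
      moreover have "set ?p \<union> set ?r = ?C" using C by auto
      ultimately show ?thesis by metis
    qed
    then show ?thesis using qQ by simp
  qed
qed

text \<open>The ear is a single vertex, or two of its attachments are nonadjacent, or all are
  pairwise adjacent. In the last case three mutually adjacent vertices lie on an induced cycle,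
  which is then a triangle.\<close>

theorem minbad_solid:
  assumes c: "icycle c" and mb: "minbad (set c) Q"
  shows "solid (set c \<union> Q)"
proof -
  let ?C = "set c" and ?N = "att (set c) Q"
  have Q: "conn Q" "Q \<inter> ?C = {}" "\<not> small ?C ?N" using mb by (auto simp: minbad_def bad_def)
  consider s where "Q = {s}" | x y where "\<And>s. Q \<noteq> {s}" "x \<in> ?N" "y \<in> ?N" "x \<noteq> y" "\<not> E x y"
    | "\<And>x y. x \<in> ?N \<Longrightarrow> y \<in> ?N \<Longrightarrow> x \<noteq> y \<Longrightarrow> E x y" by blast
  then show ?thesis
  proof cases
    case 1
    then show ?thesis using solid_single[OF c] Q by (auto simp: insert_commute)
  next
    case 2
    then show ?thesis using solid_nonadjacent[OF c mb] by blast
  next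
    case 3
    have NC: "?N \<subseteq> ?C" by (auto simp: att_def)
    have n1: "\<not> ?N \<subseteq> {x}" for x using small_pair[OF c _ NC] Q(3) by blast
    obtain x where x: "x \<in> ?N" using n1 by blast
    obtain y where y: "y \<in> ?N" "y \<noteq> x" using n1[of x] by blast
    have "\<not> ?N \<subseteq> {x, y}" using Q(3) 3[OF x y(1)] x y NC unfolding small_def by blast
    then obtain z where z: "z \<in> ?N" "z \<noteq> x" "z \<noteq> y" by blast
    have adj: "E x y" "E x z" "E y z" using 3 x y z by metis+
    obtain R where R: "icycle (x # R)" "?C = insert x (set R)" using icycle_at[OF c] x NC by blast
    have yz: "y \<in> set R" "z \<in> set R" using R(2) x y z NC by auto
    have "R \<noteq> []" using yz by auto
    then obtain a R' where aR: "R = a # R'" by (cases R) auto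
    \<comment> \<open>The neighbours \<open>y\<close> and \<open>z\<close> of \<open>x\<close> are
      the two ends of the induced path \<open>R\<close>; as they are adjacent, \<open>R\<close> has
      no further vertex.\<close>
    have "y = hd R \<or> y = last R" "z = hd R \<or> z = last R" using R(1) yz adj unfolding icycle_Cons by blast+
    then have "{hd R, last R} = {y, z}" using z(3) by auto
    then have "E (hd R) (last R)" using adj sym by (metis doubleton_eq_iff)
    moreover have "R' \<noteq> []" using R(1) aR by (auto simp: icycle_Cons)
    ultimately have "last R' = hd R'" using R(1) aR by (auto simp: icycle_Cons)
    moreover have "distinct R'" using icycle_distinct[OF R(1)] aR by simp
    ultimately have "set R' = {last R'}" using \<open>R' \<noteq> []\<close> by (cases R') (auto split: if_splits)
    then have "set R = {hd R, last R}" using aR \<open>R' \<noteq> []\<close> by auto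
    then have C: "?C = {x, y, z}" using R \<open>{hd R, last R} = {y, z}\<close> by simp
    have "solid ({x, y, z} \<union> Q)"
    proof (rule solid_triangle[OF adj Q(1)])
      show "{x, y, z} \<inter> Q = {}" using C Q(2) by blast
      show "\<exists>s\<in>Q. E x s" "\<exists>s\<in>Q. E y s" "\<exists>s\<in>Q. E z s" using x y z sym by (auto simp: att_def)
      fix Q' assume Q': "conn Q'" "Q' \<subseteq> Q" "\<exists>s\<in>Q'. E x s" "\<exists>s\<in>Q'. E y s" "\<exists>s\<in>Q'. E z s"
      then have "x \<in> att ?C Q'" "y \<in> att ?C Q'" "z \<in> att ?C Q'" using sym C by (auto simp: att_def)
      then have "\<not> small ?C (att ?C Q')" using not_small_3 y z by metis
      then show "Q' = Q" using minbadD[OF mb] Q' by blast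
    qed
    then show ?thesis using C by simp
  qed
qed

text \<open>A subset that misses an end of \<open>q\<close> has small attachments by monotonicity,
  and a connected one that contains both ends is all of \<open>q\<close>.\<close>

lemma minbad_path:
  assumes "ipath q" "q \<noteq> []" "set q \<inter> C = {}" "small C (att C (set q - {hd q}))"
    "small C (att C (set q - {last q}))" "\<not> small C (att C (set q))"
  shows "minbad C (set q)"
  unfolding minbad_def
proof (intro conjI allI impI)
  show "bad C (set q)" using assms ipath_conn unfolding bad_def by blast
  fix Q' assume Q': "Q' \<subseteq> set q" "bad C Q'"
  then have "hd q \<in> Q'" "last q \<in> Q'"
    using assms(4,5) small_mono[OF _ att_mono] unfolding bad_def by (metis Diff_insert0 Diff_empty Diff_mono subset_Diff_insert)+
  then show "Q' = set q" using conn_ipath_eq[OF assms(1)] Q' unfolding bad_def by blast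
qed

lemma bad_minbad:
  assumes "finite Q" "bad C Q"
  obtains Q' where "Q' \<subseteq> Q" "minbad C Q'"
proof -
  obtain Q' where Q': "Q' \<subseteq> Q" "bad C Q'" "\<And>X. X \<subseteq> Q \<Longrightarrow> bad C X \<Longrightarrow> card Q' \<le> card X"
    using ex_has_least_nat[of "\<lambda>X. X \<subseteq> Q \<and> bad C X" Q card] assms by blast
  have "minbad C Q'" unfolding minbad_def
    using Q' finite_subset[OF _ assms(1)] by (meson card_seteq order_trans)
  then show thesis using that Q' by blast
qed

end

subsection \<open>Placing a vertex of a solid in an ear\<close>

lemma three_indices_split:
  assumes "i \<in> {1, 2, 3 :: nat}"
  obtains j k where "j \<in> {1, 2, 3}" "k \<in> {1, 2, 3}" "i \<noteq> j" "i \<noteq> k" "j \<noteq> k" "{1, 2, 3} = {i, j, k}"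
proof -
  consider "i = 1" | "i = 2" | "i = 3" using assms by blast
  then show thesis
  proof cases
    case 1 then show ?thesis using that[of 2 3] by auto
  next
    case 2 then show ?thesis using that[of 1 3] by auto
  next
    case 3 then show ?thesis using that[of 1 2] by auto
  qed
qed

lemma third_index:
  assumes "i \<in> {1, 2, 3 :: nat}" "j \<in> {1, 2, 3}" "i \<noteq> j"
  obtains k where "k \<in> {1, 2, 3}" "i \<noteq> k" "j \<noteq> k" "{1, 2, 3} = {i, j, k}"
proof -
  obtain l m where lm: "l \<in> {1, 2, 3}" "m \<in> {1, 2, 3}" "i \<noteq> l" "i \<noteq> m" "l \<noteq> m" "{1, 2, 3} = {i, l, m}"
    using three_indices_split[OF assms(1)] .
  then have "j = l \<or> j = m" using assms by blast
  then show thesis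
  proof
    assume "j = l" then show thesis using that[of m] lm by blast
  next
    assume "j = m" then show thesis using that[of l] lm by (metis insert_commute)
  qed
qed

lemma card_ge_3E:
  assumes "3 \<le> card A"
  obtains x y z where "x \<in> A" "y \<in> A" "z \<in> A" "x \<noteq> y" "x \<noteq> z" "y \<noteq> z"
proof -
  obtain B where "B \<subseteq> A" "card B = 3" using assms by (meson obtain_subset_with_card_n)
  then obtain x y z where "B = {x, y, z}" "x \<noteq> y" "x \<noteq> z" "y \<noteq> z" by (auto simp: card_3_iff)
  then show thesis using that \<open>B \<subseteq> A\<close> by blast
qed

context adjacency begin

section \<open>Induced cycles formed by two of the three paths of a solid\<close>

lemma icycle_of_stamp:
  assumes "ipath (p @ [b])" "ipath (r @ [b])" "p \<noteq> []" "r \<noteq> []" "heads_joined p r"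
  shows "icycle (b # rev p @ r)"
proof -
  have p: "ipath p" "ipath r" "b \<notin> set p" "b \<notin> set r" and E: "\<And>s. s \<in> set p \<Longrightarrow> E s b \<longleftrightarrow> s = last p"
    "\<And>s. s \<in> set r \<Longrightarrow> E s b \<longleftrightarrow> s = last r" using assms by (auto simp: ipath_append)
  have dis: "set p \<inter> set r = {}" and pr: "\<And>s t. s \<in> set p \<Longrightarrow> t \<in> set r \<Longrightarrow> E s t \<longleftrightarrow> s = hd p \<and> t = hd r"
    using assms(5) by (auto simp: joined_def)
  have "ipath (rev p @ r)" using p dis pr assms(3) by (auto simp: ipath_append last_rev)
  moreover have "2 \<le> length (rev p @ r)" using assms(3,4) by (cases p; cases r) auto
  moreover have "E b t \<longleftrightarrow> t = hd (rev p @ r) \<or> t = last (rev p @ r)" if t: "t \<in> set (rev p @ r)" for t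
  proof -
    have h: "hd (rev p @ r) = last p" "last (rev p @ r) = last r" using assms(3,4) by (simp_all add: hd_rev)
    have m: "last p \<in> set p" "last r \<in> set r" using assms by auto
    show ?thesis
    proof (cases "t \<in> set p")
      case True
      then have "t \<noteq> last r" using m dis by auto
      then show ?thesis using E(1)[OF True] h E_commute[of b t] by simp
    next
      case False
      then have "t \<in> set r" "t \<noteq> last p" using t m by auto
      then show ?thesis using E(2)[of t] h E_commute[of b t] by simp
    qed
  qed
  ultimately show ?thesis using p by (simp add: icycle_Cons)
qed

text \<open>Reduced to the stamp: the head \<open>b\<close> of \<open>p\<close> plays the apex, and
  reversing the paths turns their joined last vertices into joined heads.\<close>

lemma icycle_of_prism:
  assumes "ipath p" "ipath r" "2 \<le> length p" "2 \<le> length r"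
    "ends_joined p r"
  shows "icycle (p @ rev r)"
proof -
  obtain b p' where p: "p = b # p'" "p' \<noteq> []" using assms(3) by (cases p) (auto simp: Suc_le_eq)
  obtain c r' where r: "r = c # r'" "r' \<noteq> []" using assms(4) by (cases r) (auto simp: Suc_le_eq)
  have bp: "b \<notin> set p'" "last p' \<in> set p'" using assms(1) p by auto
  then have lb: "last p' \<noteq> b" by auto
  have dis: "set p \<inter> set r = {}"
    and j: "\<And>s t. s \<in> set p \<Longrightarrow> t \<in> set r \<Longrightarrow> E s t \<longleftrightarrow> s = hd p \<and> t = hd r \<or> s = last p \<and> t = last r"
    using assms(5) by (simp_all add: joined_def)
  have hp: "hd p = b" "last p = last p'" "hd r = c" using p r by simp_all
  have pr: "E s t \<longleftrightarrow> s = b \<and> t = c \<or> s = last p' \<and> t = last r" if "s \<in> set p" "t \<in> set r" for s t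
    using j[OF that] unfolding hp .
  have "heads_joined (rev p') (rev r)"
    unfolding joined_def
  proof (intro conjI ballI)
    fix s t assume st: "s \<in> set (rev p')" "t \<in> set (rev r)"
    then have "s \<noteq> b" using bp by auto
    then show "E s t \<longleftrightarrow> s = hd (rev p') \<and> t = hd (rev r)"
      using pr[of s t] st p by (simp add: hd_rev)
  qed (use dis p in auto)
  moreover have "ipath (rev p' @ [b])" using assms(1) p ipath_rev[of p] by simp
  moreover have "E b t \<longleftrightarrow> t = hd r" if "t \<in> set r" for t
    using pr[of b t] that p(1) r(1) lb by auto
  then have "ipath (b # r)" using assms(2) dis p(1) by auto
  then have "ipath (rev r @ [b])" using ipath_rev[of "b # r"] by simp
  ultimately have "icycle (b # rev (rev p') @ rev r)"
    using p r by (intro icycle_of_stamp) auto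
  then show ?thesis using p by simp
qed

text \<open>Counting the end \<open>a\<close> to the first path produces the situation of a stamp
  with apex \<open>b\<close>, the edge from \<open>a\<close> to \<open>hd r\<close> joining the
  heads.\<close>

lemma icycle_of_theta:
  assumes "ipath (a # p @ [b])" "ipath (a # r @ [b])" "p \<noteq> []" "r \<noteq> []" "apart p r"
  shows "icycle (b # rev (a # p) @ r)"
proof (rule icycle_of_stamp)
  have ra: "ipath r" "ipath (r @ [b])" "\<And>t. t \<in> set r \<Longrightarrow> E a t \<longleftrightarrow> t = hd r" "a \<notin> set r"
    using assms(2,4) by (auto simp: ipath_append)
  then show "ipath ((a # p) @ [b])" "ipath (r @ [b])" using assms by simp_all
  show "heads_joined (a # p) r"
    using assms(1,5) ra unfolding joined_def by auto
qed (use assms in auto)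

lemma nonadjacent_ends: "ipath (a # p @ [b]) \<Longrightarrow> p \<noteq> [] \<Longrightarrow> \<not> E a b \<and> a \<noteq> b"
  by (auto simp: ipath_append)

text \<open>\<open>X\<close> and \<open>Y\<close> are the attachments of the two ends of
  \<open>q\<close>, and nothing else attaches. Dropping an end leaves at most the attachments of the
  other, which are small alone but not together.\<close>

lemma minbad_ear:
  assumes "ipath q" "q \<noteq> []" "set q \<inter> C = {}" "X \<subseteq> C" "Y \<subseteq> C" "small C X" "small C Y" "\<not> small C (X \<union> Y)"
    and E: "\<And>s t. s \<in> set q \<Longrightarrow> t \<in> C \<Longrightarrow> E s t \<longleftrightarrow> t \<in> X \<and> s = hd q \<or> t \<in> Y \<and> s = last q"
  shows "minbad C (set q)"
proof (rule minbad_path[OF assms(1-3)])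
  have "att C (set q - {hd q}) \<subseteq> Y" "att C (set q - {last q}) \<subseteq> X" using E by (auto simp: att_def)
  then show "small C (att C (set q - {hd q}))" "small C (att C (set q - {last q}))"
    using small_mono assms(6,7) by blast+
  have "hd q \<in> set q" "last q \<in> set q" using assms(2) by simp_all
  then have "X \<union> Y \<subseteq> att C (set q)" using E assms(4,5) unfolding att_def by blast
  then show "\<not> small C (att C (set q))" using small_mono assms(8) by blast
qed

lemma small_edge: "E x y \<Longrightarrow> x \<in> C \<Longrightarrow> y \<in> C \<Longrightarrow> small C {x, y}"
  unfolding small_def by blast

text \<open>In a trihedron, stamp or prism the path through \<open>w\<close> serves as ear and the
  other two paths form the cycle; the common ends of the paths are kept as separate outcomes. In a
  pyramid the apex is an ear by itself.\<close>

lemma solid_cases: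
  assumes "solid S" "w \<in> S"
  obtains (ear) c Q where "icycle c" "minbad (set c) Q" "S = set c \<union> Q" "w \<in> Q"
  | (theta) b p where "theta w b p S"
  | (apex) p where "stamp_paths w p S"
proof -
  let ?I = "{1, 2, 3} :: nat set"
  consider "pyramid (induced S)" | "trihedron (induced S)" | "stamp (induced S)" | "prism (induced S)"
    using assms(1) by (auto simp: solid_def solid_graph_def)
  then show thesis
  proof cases
    case 1
    then obtain c z where c: "icycle c" "z \<notin> set c" and card: "3 \<le> card {x \<in> set c. E z x}" and S: "S = insert z (set c)"
      unfolding pyramid_iff by blast
    obtain n1 n2 n3 where "n1 \<in> {x \<in> set c. E z x}" "n2 \<in> {x \<in> set c. E z x}" "n3 \<in> {x \<in> set c. E z x}"
      and ne: "n1 \<noteq> n2" "n1 \<noteq> n3" "n2 \<noteq> n3"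
      by (rule card_ge_3E[OF card])
    then have n: "n1 \<in> set c" "n2 \<in> set c" "n3 \<in> set c" "E z n1" "E z n2" "E z n3"
      "n1 \<noteq> n2" "n1 \<noteq> n3" "n2 \<noteq> n3" by simp_all
    show thesis
    proof (cases "w = z")
      case True
      have "minbad (set c) (set [z])"
      proof (rule minbad_path)
        have "small (set c) {}" using small_pair[OF c(1), of "{}"] by simp
        then show "small (set c) (att (set c) (set [z] - {hd [z]}))" "small (set c) (att (set c) (set [z] - {last [z]}))"
          by (simp_all add: att_def)
        show "\<not> small (set c) (att (set c) (set [z]))"
          by (rule not_small_3[of n1 _ n2 n3]) (use n in \<open>auto simp: att_def\<close>)
      qed (use c in auto)
      then show thesis using ear[of c "{z}"] c S True by auto
    next
      case False
      then have "w \<in> set c" using assms(2) S by auto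
      then obtain R where R: "icycle (w # R)" "set c = insert w (set R)" using icycle_at[OF c(1)] by blast
      \<comment> \<open>At most one of the three neighbours of \<open>z\<close> is \<open>w\<close>,
        so at least two are met on the way around the rim from \<open>w\<close>.\<close>
      have "\<exists>x y. x \<in> set R \<and> y \<in> set R \<and> E z x \<and> E z y \<and> x \<noteq> y" using n R(2) by auto
      then obtain m1 m2 where m: "m1 \<in> set R" "m2 \<in> set R" "E z m1" "E z m2" "m1 \<noteq> m2" by blast
      then have "\<exists>x\<in>set R. E z x" by blast
      then obtain r1 x R2 where x: "R = r1 @ x # R2" "E z x" "\<forall>t\<in>set r1. \<not> E z t"
        by (rule split_list_first_propE)
      have "\<exists>y\<in>set R2. E z y" using m x by auto
      then obtain r2 y r3 where y: "R2 = r2 @ y # r3" "E z y" "\<forall>t\<in>set r2. \<not> E z t"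
        by (rule split_list_first_propE)
      \<comment> \<open>the cycle is a sector of the pyramid that avoids \<open>w\<close>, the ear is the rest of the rim\<close>
      let ?P = "x # r2 @ [y]" and ?q = "r3 @ w # r1"
      have cc: "icycle (?P @ ?q)" using icycle_rotate[of "w # r1" "x # r2 @ y # r3"] R(1) x(1) y(1) by simp
      note app = icycle_append[OF cc, simplified]
      have Sq: "S = set (z # ?P) \<union> set ?q" using S R(2) x y by auto
      have zn: "z \<notin> set ?P" "z \<notin> set ?q" using c(2) R(2) x(1) y(1) by auto
      have xy: "x \<noteq> y" "x \<notin> set r2" "y \<notin> set r2" using icycle_distinct[OF cc] by auto
      have "icycle (z # ?P)"
        unfolding icycle_Cons using app(1) zn x(2) y(2,3) by auto
      moreover have "minbad (set (z # ?P)) (set ?q)"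
      proof (rule minbad_path)
        show "ipath ?q" by (rule icycle_append[OF cc]) auto
        show "?q \<noteq> []" by simp
        have "set ?P \<inter> set ?q = {}" by (rule icycle_append[OF cc]) auto
        then show dd: "set ?q \<inter> set (z # ?P) = {}" using zn by auto
        have E: "E s t \<longleftrightarrow> t = x \<and> s = last ?q \<or> t = y \<and> s = hd ?q" if "t \<in> set ?P" "s \<in> set ?q" for s t
          using icycle_append(4)[OF cc _ _ that] E_commute[of s t] by simp
        have "att (set (z # ?P)) (set ?q - {hd ?q}) \<subseteq> {x, z}" using E unfolding att_def by auto
        then show "small (set (z # ?P)) (att (set (z # ?P)) (set ?q - {hd ?q}))"
          unfolding small_def using x(2) sym by (intro bexI[of _ x] bexI[of _ z]) auto
        have "att (set (z # ?P)) (set ?q - {last ?q}) \<subseteq> {y, z}" using E unfolding att_def by auto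
        then show "small (set (z # ?P)) (att (set (z # ?P)) (set ?q - {last ?q}))"
          unfolding small_def using y(2) sym by (intro bexI[of _ y] bexI[of _ z]) auto
        \<comment> \<open>\<open>z\<close> has a third neighbour on the rim, and the interior
          \<open>r2\<close> of the sector contains none, so it lies on the ear.\<close>
        have "\<exists>s\<in>set ?q. E z s"
        proof -
          have "set c = set ?P \<union> set ?q" using R(2) x(1) y(1) by auto
          moreover obtain k where k: "k \<in> {n1, n2, n3}" "k \<noteq> x" "k \<noteq> y" using n(7-9) by (cases "n1 = x \<or> n1 = y"; cases "n2 = x \<or> n2 = y") auto
          moreover from this have "E z k" "k \<in> set c" using n(1-6) by auto
          ultimately have "E z k" "k \<in> set ?P \<union> set ?q" "k \<noteq> x" "k \<noteq> y" by simp_all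
          then show ?thesis using y(3) by auto
        qed
        then have "z \<in> att (set (z # ?P)) (set ?q)" using sym by (auto simp: att_def)
        moreover have "hd ?q \<in> set ?q" "last ?q \<in> set ?q" by (rule hd_in_set last_in_set; simp)+
        moreover from this have "E (last ?q) x" "E (hd ?q) y" using E[of x "last ?q"] E[of y "hd ?q"] by simp_all
        moreover have "x \<in> set (z # ?P)" "y \<in> set (z # ?P)" by simp_all
        ultimately have "z \<in> att (set (z # ?P)) (set ?q)" "x \<in> att (set (z # ?P)) (set ?q)" "y \<in> att (set (z # ?P)) (set ?q)"
          unfolding att_def by blast+
        then show "\<not> small (set (z # ?P)) (att (set (z # ?P)) (set ?q))"
          by (rule not_small_3) (use zn(1) xy in simp_all)
      qed
      ultimately show thesis using ear[of "z # ?P" "set ?q"] Sq by simp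
    qed
  next
    case 2
    then obtain a b p where th: "theta a b p S" unfolding trihedron_iff by blast
    note p = thetaD(1)[OF th] and j = thetaD(2)[OF th] and S = thetaD(3)[OF th]
    consider "w = a" | "w = b" | i where "i \<in> ?I" "w \<in> set (p i)" using assms(2) S by blast
    then show thesis
    proof cases
      case 1
      then show thesis using theta th by blast
    next
      case 2
      have "theta w a (\<lambda>i. rev (p i)) S"
      proof (rule thetaI)
        show "rev (p i) \<noteq> [] \<and> ipath (w # rev (p i) @ [a])" if "i \<in> ?I" for i
          using p[OF that] ipath_rev[of "a # p i @ [b]"] 2 by simp
        show "apart (rev (p i)) (rev (p j))" if "i \<in> ?I" "j \<in> ?I" "i \<noteq> j" for i j
          using j[OF that] by (simp add: joined_def)
        show "S = {w, a} \<union> (\<Union>i\<in>?I. set (rev (p i)))" using S 2 by auto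
      qed
      then show thesis by (rule theta)
    next
      case i: 3
      obtain k l where kl: "k \<in> ?I" "l \<in> ?I" "i \<noteq> k" "i \<noteq> l" "k \<noteq> l" "?I = {i, k, l}"
        using three_indices_split[OF i(1)] .
      define C where "C = b # rev (a # p k) @ p l"
      have cy: "icycle C" unfolding C_def using p[OF kl(1)] p[OF kl(2)] j[OF kl(1,2,5)] by (intro icycle_of_theta) auto
      have ab: "\<not> E a b" "a \<noteq> b" using nonadjacent_ends p[OF kl(1)] by blast+
      have E: "E s t \<longleftrightarrow> t = a \<and> s = hd (p i) \<or> t = b \<and> s = last (p i)" if "t \<in> set C" "s \<in> set (p i)" for s t
      proof -
        have "E a s \<longleftrightarrow> s = hd (p i)" "E s b \<longleftrightarrow> s = last (p i)"
          using p[OF i(1)] that(2) by (auto simp: ipath_append)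
        moreover have "\<not> E s t" if "t \<in> set (p k) \<union> set (p l)"
          using j[OF i(1) kl(1,3)] j[OF i(1) kl(2,4)] that \<open>s \<in> set (p i)\<close> by (auto simp: joined_def)
        moreover have "a \<notin> set (p k)" "b \<notin> set (p k)" "a \<notin> set (p l)" "b \<notin> set (p l)"
          using p[OF kl(1)] p[OF kl(2)] by (auto simp: ipath_append)
        ultimately show ?thesis using that(1) E_commute[of a s] ab unfolding C_def by auto
      qed
      have abC: "a \<in> set C" "b \<in> set C" by (simp_all add: C_def)
      have "minbad (set C) (set (p i))"
      proof (rule minbad_ear)
        show "set (p i) \<inter> set C = {}"
          unfolding C_def using p[OF i(1)] j[OF i(1) kl(1,3)] j[OF i(1) kl(2,4)] by (auto simp: joined_def ipath_append)
        show "small (set C) {a}" "small (set C) {b}" using small_pair[OF cy] abC by auto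
        show "\<not> small (set C) ({a} \<union> {b})" using smallD[of _ "{a} \<union> {b}" a b] ab by auto
      qed (use p[OF i(1)] abC E in \<open>auto simp: ipath_append\<close>)
      moreover have "S = set C \<union> set (p i)" unfolding S kl(6) C_def by auto
      ultimately show thesis using ear[OF cy] i by blast
    qed
  next
    case 3
    then obtain b p where sp: "stamp_paths b p S" unfolding stamp_iff by blast
    note p = stamp_pathsD(1)[OF sp] and j = stamp_pathsD(2)[OF sp] and S = stamp_pathsD(3)[OF sp]
    consider "w = b" | i where "i \<in> ?I" "w \<in> set (p i)" using assms(2) S by blast
    then show thesis
    proof cases
      case 1
      then show thesis using apex sp by blast
    next
      case i: 2
      obtain k l where kl: "k \<in> ?I" "l \<in> ?I" "i \<noteq> k" "i \<noteq> l" "k \<noteq> l" "?I = {i, k, l}"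
        using three_indices_split[OF i(1)] .
      define C where "C = b # rev (p k) @ p l"
      have cy: "icycle C" unfolding C_def using p[OF kl(1)] p[OF kl(2)] j[OF kl(1,2,5)] by (intro icycle_of_stamp) auto
      have h: "hd (p k) \<in> set (p k)" "hd (p l) \<in> set (p l)" "hd (p i) \<in> set (p i)" "last (p i) \<in> set (p i)"
        using p[OF kl(1)] p[OF kl(2)] p[OF i(1)] by auto
      have nb: "b \<notin> set (p k)" "b \<notin> set (p l)" "b \<notin> set (p i)" "set (p k) \<inter> set (p l) = {}"
        using p[OF kl(1)] p[OF kl(2)] p[OF i(1)] j[OF kl(1,2,5)] by (auto simp: ipath_append joined_def)
      have E: "E s t \<longleftrightarrow> (t = hd (p k) \<or> t = hd (p l)) \<and> s = hd (p i) \<or> t = b \<and> s = last (p i)" if t: "t \<in> set C" and s: "s \<in> set (p i)" for s t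
      proof -
        have 1: "E s b \<longleftrightarrow> s = last (p i)"
          using p[OF i(1)] s by (auto simp: ipath_append)
        have 2: "E s t \<longleftrightarrow> s = hd (p i) \<and> t = hd (p k)" if "t \<in> set (p k)"
          using j[OF i(1) kl(1,3)] that s by (auto simp: joined_def)
        have 3: "E s t \<longleftrightarrow> s = hd (p i) \<and> t = hd (p l)" if "t \<in> set (p l)"
          using j[OF i(1) kl(2,4)] that s by (auto simp: joined_def)
        consider "t = b" | "t \<in> set (p k)" | "t \<in> set (p l)" using t unfolding C_def by auto
        then show ?thesis
        proof cases
          case 1 then show ?thesis using \<open>E s b \<longleftrightarrow> _\<close> h nb by auto
        next
          case k: 2
          then have "t \<noteq> hd (p l)" "t \<noteq> b" using h nb by auto
          then show ?thesis using 2[OF k] by auto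
        next
          case l: 3
          then have "t \<noteq> hd (p k)" "t \<noteq> b" using h nb by auto
          then show ?thesis using 3[OF l] by auto
        qed
      qed
      have hC: "hd (p k) \<in> set C" "hd (p l) \<in> set C" "b \<in> set C" using h by (auto simp: C_def)
      have "minbad (set C) (set (p i))"
      proof (rule minbad_ear)
        show "set (p i) \<inter> set C = {}"
          unfolding C_def using p[OF i(1)] j[OF i(1) kl(1,3)] j[OF i(1) kl(2,4)] by (auto simp: joined_def ipath_append)
        have "E (hd (p k)) (hd (p l))" using joinedD(2)[OF j[OF kl(1,2,5)]] h by simp
        then show "small (set C) {hd (p k), hd (p l)}" using hC by (intro small_edge)
        show "small (set C) {b}" using small_pair[OF cy] hC by auto
        show "\<not> small (set C) ({hd (p k), hd (p l)} \<union> {b})"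
          by (rule not_small_3[of "hd (p k)" _ "hd (p l)" b]) (use h nb in auto)
      qed (use p[OF i(1)] hC E in \<open>auto simp: ipath_append\<close>)
      moreover have "S = set C \<union> set (p i)" unfolding S kl(6) C_def by auto
      ultimately show thesis using ear[OF cy] i by blast
    qed
  next
    case 4
    then obtain p where pp: "prism_paths p S" unfolding prism_iff by blast
    note p = prism_pathsD(1)[OF pp] and j = prism_pathsD(2)[OF pp] and S = prism_pathsD(3)[OF pp]
    obtain i where i: "i \<in> ?I" "w \<in> set (p i)" using assms(2) S by blast
    obtain k l where kl: "k \<in> ?I" "l \<in> ?I" "i \<noteq> k" "i \<noteq> l" "k \<noteq> l" "?I = {i, k, l}"
      using three_indices_split[OF i(1)] .
    define C where "C = p k @ rev (p l)"
    have cy: "icycle C" unfolding C_def using p[OF kl(1)] p[OF kl(2)] j[OF kl(1,2,5)] by (intro icycle_of_prism) auto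
    have ne: "p k \<noteq> []" "p l \<noteq> []" "p i \<noteq> []" using p[OF kl(1)] p[OF kl(2)] p[OF i(1)] by auto
    then have h: "hd (p k) \<in> set (p k)" "hd (p l) \<in> set (p l)" "hd (p i) \<in> set (p i)" "last (p i) \<in> set (p i)"
      "last (p k) \<in> set (p k)" "last (p l) \<in> set (p l)" by auto
    have dis: "set (p k) \<inter> set (p l) = {}" using j[OF kl(1,2,5)] by (auto simp: joined_def)
    have hk: "hd (p k) \<noteq> last (p k)" using p[OF kl(1)] ipath_distinct[of "p k"] by (cases "p k") (auto split: if_splits)
    have E: "E s t \<longleftrightarrow> (t = hd (p k) \<or> t = hd (p l)) \<and> s = hd (p i) \<or> (t = last (p k) \<or> t = last (p l)) \<and> s = last (p i)"
      if t: "t \<in> set C" and s: "s \<in> set (p i)" for s t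
    proof -
      consider "t \<in> set (p k)" | "t \<in> set (p l)" using t unfolding C_def by auto
      then show ?thesis
      proof cases
        case 1
        then have "t \<noteq> hd (p l)" "t \<noteq> last (p l)" using h dis by auto
        then show ?thesis using j[OF i(1) kl(1,3)] s 1 by (auto simp: joined_def)
      next
        case 2
        then have "t \<noteq> hd (p k)" "t \<noteq> last (p k)" using h dis by auto
        then show ?thesis using j[OF i(1) kl(2,4)] s 2 by (auto simp: joined_def)
      qed
    qed
    have hC: "hd (p k) \<in> set C" "hd (p l) \<in> set C" "last (p k) \<in> set C" "last (p l) \<in> set C" using h by (auto simp: C_def)
    have "minbad (set C) (set (p i))"
    proof (rule minbad_ear)
      show "set (p i) \<inter> set C = {}"
        unfolding C_def using j[OF i(1) kl(1,3)] j[OF i(1) kl(2,4)] by (auto simp: joined_def)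
      have "E (hd (p k)) (hd (p l))" "E (last (p k)) (last (p l))" using joinedD(2)[OF j[OF kl(1,2,5)]] h by simp_all
      then show "small (set C) {hd (p k), hd (p l)}" "small (set C) {last (p k), last (p l)}"
        using hC by (blast intro: small_edge)+
      show "\<not> small (set C) ({hd (p k), hd (p l)} \<union> {last (p k), last (p l)})"
        by (rule not_small_3[of "hd (p k)" _ "hd (p l)" "last (p k)"]) (use h dis hk in auto)
    qed (use p[OF i(1)] ne hC E in auto)
    moreover have "S = set C \<union> set (p i)" unfolding S kl(6) C_def by auto
    ultimately show thesis using ear[OF cy] i by blast
  qed
qed

end

subsection \<open>Relabelling\<close>

text \<open>\<open>f\<close> is faithful on \<open>S\<close> only. The locale serves the embedding
  of \<open>G\<close> into the option type, the isomorphic copies in \<open>solids\<close>, and the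
  exchange of \<open>w\<close> for another vertex.\<close>

locale adjacency_embedding = A: adjacency E + B: adjacency F
  for E :: "'a \<Rightarrow> 'a \<Rightarrow> bool" and F :: "'b \<Rightarrow> 'b \<Rightarrow> bool" +
  fixes f :: "'a \<Rightarrow> 'b" and S :: "'a set"
  assumes inj: "inj_on f S"
    and pres: "x \<in> S \<Longrightarrow> y \<in> S \<Longrightarrow> F (f x) (f y) \<longleftrightarrow> E x y"
begin

lemma f_eq: "x \<in> S \<Longrightarrow> y \<in> S \<Longrightarrow> f x = f y \<longleftrightarrow> x = y"
  using inj by (auto dest: inj_onD)

lemma f_mem: "x \<in> S \<Longrightarrow> T \<subseteq> S \<Longrightarrow> f x \<in> f ` T \<longleftrightarrow> x \<in> T"
  using inj by (auto dest: inj_onD)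

lemma ipath_map: "set p \<subseteq> S \<Longrightarrow> B.ipath (map f p) \<longleftrightarrow> A.ipath p"
proof (induction p)
  case (Cons x p)
  show ?case
  proof (cases "p = []")
    case False
    then have "hd p \<in> S" using Cons.prems by (auto intro: hd_in_set)
    then have "(F (f x) (f z) \<longleftrightarrow> f z = f (hd p)) \<longleftrightarrow> (E x z \<longleftrightarrow> z = hd p)" if "z \<in> set p" for z
      using that Cons.prems by (simp add: pres f_eq subset_iff)
    then show ?thesis using Cons False f_mem[of x "set p"] by (simp add: hd_map)
  qed simp
qed simp

lemma icycle_map:
  assumes "set c \<subseteq> S"
  shows "B.icycle (map f c) \<longleftrightarrow> A.icycle c"
proof (cases c)
  case (Cons x p)
  show ?thesis
  proof (cases "2 \<le> length p")
    case True
    then have "p \<noteq> []" by auto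
    then have "hd p \<in> S" "last p \<in> S" using assms Cons by (auto intro: hd_in_set last_in_set)
    then have "(F (f x) (f z) \<longleftrightarrow> f z = f (hd p) \<or> f z = f (last p)) \<longleftrightarrow> (E x z \<longleftrightarrow> z = hd p \<or> z = last p)"
      if "z \<in> set p" for z
      using that assms Cons by (simp add: pres f_eq subset_iff)
    then show ?thesis using assms Cons \<open>p \<noteq> []\<close> f_mem[of x "set p"] ipath_map[of p]
      by (simp add: A.icycle_Cons B.icycle_Cons hd_map last_map)
  qed (simp add: Cons A.icycle_Cons B.icycle_Cons)
qed (simp add: A.icycle_def B.icycle_def)

lemma cyc_image: "A.cyc T \<Longrightarrow> T \<subseteq> S \<Longrightarrow> B.cyc (f ` T)"
  unfolding A.cyc_iff B.cyc_iff using icycle_map by (metis list.set_map)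

lemma joined_map:
  assumes "A.joined p q R" "set p \<subseteq> S" "set q \<subseteq> S"
    and R: "\<And>x y. x \<in> set p \<Longrightarrow> y \<in> set q \<Longrightarrow> R' (f x) (f y) \<longleftrightarrow> R x y"
  shows "B.joined (map f p) (map f q) R'"
proof (rule B.joinedI)
  show "set (map f p) \<inter> set (map f q) = {}"
    using inj_on_image_Int[OF inj assms(2,3)] A.joinedD(1)[OF assms(1)] by simp
  fix x y assume "x \<in> set (map f p)" "y \<in> set (map f q)"
  then obtain a b where "a \<in> set p" "b \<in> set q" "x = f a" "y = f b" by auto
  then show "F x y \<longleftrightarrow> R' x y"
    using A.joinedD(2)[OF assms(1)] R pres assms(2,3) by (simp add: subset_iff)
qed

lemma solid_image:
  assumes "A.solid T" "T \<subseteq> S"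
  shows "B.solid (f ` T)"
proof -
  let ?I = "{1, 2, 3} :: nat set"
  consider "pyramid (A.induced T)" | "trihedron (A.induced T)" | "stamp (A.induced T)" | "prism (A.induced T)"
    using assms(1) by (auto simp: A.solid_def solid_graph_def)
  then show ?thesis
  proof cases
    case 1
    then obtain c w where c: "A.icycle c" "w \<notin> set c" "3 \<le> card {x \<in> set c. E w x}" "T = insert w (set c)"
      unfolding A.pyramid_iff by blast
    then have wc: "w \<in> S" "set c \<subseteq> S" using assms(2) by auto
    then have "{x \<in> set (map f c). F (f w) x} = f ` {x \<in> set c. E w x}" using pres by auto
    moreover have "inj_on f {x \<in> set c. E w x}" using inj wc by (auto intro: inj_on_subset)
    ultimately have "card {x \<in> set (map f c). F (f w) x} = card {x \<in> set c. E w x}" by (simp add: card_image)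
    then have "B.solid (insert (f w) (set (map f c)))"
      using c wc icycle_map f_mem[of w "set c"] by (intro B.solid_pyramidI) auto
    then show ?thesis using c by simp
  next
    case 2
    then obtain a b p where th: "A.theta a b p T" unfolding A.trihedron_iff by blast
    note T = A.thetaD(3)[OF th]
    have sub: "set (p i) \<subseteq> S" "a \<in> S" "b \<in> S" if "i \<in> ?I" for i using that T assms(2) by blast+
    have "B.theta (f a) (f b) (\<lambda>i. map f (p i)) (f ` T)"
    proof (rule B.thetaI)
      fix i assume i: "i \<in> ?I"
      have "B.ipath (map f (a # p i @ [b]))" using A.thetaD(1)[OF th i] sub[OF i] by (subst ipath_map) auto
      then show "map f (p i) \<noteq> [] \<and> B.ipath (f a # map f (p i) @ [f b])" using A.thetaD(1)[OF th i] by simp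
      fix j assume j: "j \<in> ?I" "i \<noteq> j"
      show "B.apart (map f (p i)) (map f (p j))"
        using A.thetaD(2)[OF th i j] sub(1)[OF i] sub(1)[OF j(1)] by (rule joined_map) simp
    next
      show "f ` T = {f a, f b} \<union> (\<Union>i\<in>?I. set (map f (p i)))" unfolding T by (simp add: image_Un)
    qed
    then have "trihedron (B.induced (f ` T))" unfolding B.trihedron_iff by blast
    then show ?thesis by (simp add: B.solid_def solid_graph_def)
  next
    case 3
    then obtain b p where sp: "A.stamp_paths b p T" unfolding A.stamp_iff by blast
    note T = A.stamp_pathsD(3)[OF sp]
    have sub: "set (p i) \<subseteq> S" "b \<in> S" if "i \<in> ?I" for i using that T assms(2) by blast+
    have ne: "p i \<noteq> []" "hd (p i) \<in> S" if "i \<in> ?I" for i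
      using A.stamp_pathsD(1)[OF sp that] sub(1)[OF that] by auto
    have "B.stamp_paths (f b) (\<lambda>i. map f (p i)) (f ` T)"
    proof (rule B.stamp_pathsI)
      fix i assume i: "i \<in> ?I"
      have "B.ipath (map f (p i @ [b]))" using A.stamp_pathsD(1)[OF sp i] sub[OF i] by (subst ipath_map) auto
      then show "map f (p i) \<noteq> [] \<and> B.ipath (map f (p i) @ [f b])" using ne[OF i] by simp
      fix j assume j: "j \<in> ?I" "i \<noteq> j"
      show "B.heads_joined (map f (p i)) (map f (p j))"
        using A.stamp_pathsD(2)[OF sp i j] sub(1)[OF i] sub(1)[OF j(1)] ne[OF i] ne[OF j(1)]
        by (elim joined_map) (simp_all add: hd_map f_eq subset_iff)
    next
      show "f ` T = {f b} \<union> (\<Union>i\<in>?I. set (map f (p i)))" unfolding T by (simp add: image_Un)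
    qed
    then have "stamp (B.induced (f ` T))" unfolding B.stamp_iff by blast
    then show ?thesis by (simp add: B.solid_def solid_graph_def)
  next
    case 4
    then obtain p where pp: "A.prism_paths p T" unfolding A.prism_iff by blast
    note T = A.prism_pathsD(3)[OF pp]
    have sub: "set (p i) \<subseteq> S" if "i \<in> ?I" for i using that T assms(2) by blast
    have ne: "p i \<noteq> []" "hd (p i) \<in> S" "last (p i) \<in> S" if "i \<in> ?I" for i
    proof -
      show "p i \<noteq> []" using A.prism_pathsD(1)[OF pp that] by auto
      then show "hd (p i) \<in> S" "last (p i) \<in> S" using sub[OF that] by auto
    qed
    have "B.prism_paths (\<lambda>i. map f (p i)) (f ` T)"
    proof (rule B.prism_pathsI)
      fix i assume i: "i \<in> ?I"
      show "2 \<le> length (map f (p i)) \<and> B.ipath (map f (p i))"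
        using A.prism_pathsD(1)[OF pp i] ipath_map[OF sub[OF i]] by simp
      fix j assume j: "j \<in> ?I" "i \<noteq> j"
      show "B.ends_joined (map f (p i)) (map f (p j))"
        using A.prism_pathsD(2)[OF pp i j] sub[OF i] sub[OF j(1)] ne[OF i] ne[OF j(1)]
        by (elim joined_map) (simp_all add: hd_map last_map f_eq subset_iff)
    next
      show "f ` T = (\<Union>i\<in>?I. set (map f (p i)))" unfolding T by (simp add: image_Un)
    qed
    then have "prism (B.induced (f ` T))" unfolding B.prism_iff by blast
    then show ?thesis by (simp add: B.solid_def solid_graph_def)
  qed
qed

text \<open>Transfer along the inverse map turns the implications \<open>cyc_image\<close> and
  \<open>solid_image\<close> into equivalences.\<close>

lemma inverse: "adjacency_embedding F E (inv_into S f) (f ` S)"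
proof unfold_locales
  show "inj_on (inv_into S f) (f ` S)" by (simp add: inj_on_inv_into)
  fix x y assume "x \<in> f ` S" "y \<in> f ` S"
  then show "E (inv_into S f x) (inv_into S f y) \<longleftrightarrow> F x y" using inj pres by auto
qed

lemma
  assumes "T \<subseteq> S"
  shows cyc_image_iff: "B.cyc (f ` T) \<longleftrightarrow> A.cyc T" and solid_image_iff: "B.solid (f ` T) \<longleftrightarrow> A.solid T"
proof -
  interpret inv: adjacency_embedding F E "inv_into S f" "f ` S" by (rule inverse)
  have "inv_into S f ` f ` T = T" using inj assms by (simp add: inv_into_image_cancel)
  then show "B.cyc (f ` T) \<longleftrightarrow> A.cyc T" "B.solid (f ` T) \<longleftrightarrow> A.solid T"
    using cyc_image solid_image inv.cyc_image[of "f ` T"] inv.solid_image[of "f ` T"] assms by (metis image_mono)+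
qed

end

subsection \<open>Contracting an edge\<close>

context adjacency begin

section \<open>Exchanging and identifying vertices; what an induced path cannot contain\<close>

lemma solid_replace:
  assumes "solid (insert w A)" "w \<notin> A" "u \<notin> A" "\<And>x. x \<in> A \<Longrightarrow> E w x \<longleftrightarrow> E u x"
  shows "solid (insert u A)"
proof -
  let ?f = "\<lambda>x. if x = w then u else x"
  interpret adjacency_embedding E E ?f "insert w A"
  proof unfold_locales
    show "inj_on ?f (insert w A)" using assms(2,3) by (auto simp: inj_on_def)
    fix x y assume "x \<in> insert w A" "y \<in> insert w A"
    then show "E (?f x) (?f y) \<longleftrightarrow> E x y"
      using assms(4) E_commute[of _ u] E_commute[of _ w] by auto
  qed
  have "?f ` insert w A = insert u A" using assms(2) by auto
  then show ?thesis using solid_image[OF assms(1)] by simp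
qed

text \<open>A cut of the image pulls back to a cut of \<open>Q\<close>, and the edge crossing it
  cannot be collapsed by \<open>f\<close>.\<close>

lemma conn_image:
  assumes "conn Q" "\<And>x y. x \<in> Q \<Longrightarrow> y \<in> Q \<Longrightarrow> E x y \<Longrightarrow> f x = f y \<or> E (f x) (f y)"
  shows "conn (f ` Q)"
  unfolding conn_def
proof (intro conjI allI impI)
  show "f ` Q \<noteq> {}" using assms(1) by (auto simp: conn_def)
  fix X assume X: "X \<subseteq> f ` Q" "X \<noteq> {}" "X \<noteq> f ` Q"
  let ?Y = "{x \<in> Q. f x \<in> X}"
  have "?Y \<noteq> {}" "?Y \<noteq> Q" using X by auto
  then obtain x y where "x \<in> ?Y" "y \<in> Q - ?Y" "E x y" using connD[OF assms(1), of ?Y] by blast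
  then have "f x \<in> X" "f y \<in> f ` Q - X" "f x = f y \<or> E (f x) (f y)" using assms(2) by auto
  then show "\<exists>x\<in>X. \<exists>y\<in>f ` Q - X. E x y" by auto
qed

text \<open>The first vertex of \<open>p\<close> on the cycle would need two neighbours further
  along \<open>p\<close>, where it has at most one.\<close>

lemma icycle_not_subset_ipath:
  assumes "ipath p" "icycle c" "set c \<subseteq> set p"
  shows False
proof -
  have "\<exists>x\<in>set p. x \<in> set c" using assms by (cases c) (auto simp: icycle_def)
  then obtain p1 x p2 where p: "p = p1 @ x # p2" "x \<in> set c" "\<forall>y\<in>set p1. y \<notin> set c"
    by (rule split_list_first_propE)
  obtain y z where yz: "y \<in> set c" "z \<in> set c" "y \<noteq> z" "E x y" "E x z" using icycle_nbrs[OF assms(2) p(2)] by metis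
  have "y \<in> set p2" "z \<in> set p2" using yz assms(3) p by auto
  then show False using assms(1) p(1) yz by (auto simp: ipath_append)
qed

lemma ipath_nbrs:
  assumes "ipath (p1 @ x # p2)" "y \<in> set (p1 @ x # p2)" "E x y"
  shows "p1 \<noteq> [] \<and> y = last p1 \<or> p2 \<noteq> [] \<and> y = hd p2"
proof -
  consider "y \<in> set p1" | "y \<in> set p2" using assms by auto
  then show ?thesis
  proof cases
    case 1
    then have "y = last p1" using assms(1) sym[OF assms(3)] by (auto simp: ipath_append)
    then show ?thesis using 1 by auto
  next
    case 2
    then have "y = hd p2" using assms(1,3) by (auto simp: ipath_append)
    then show ?thesis using 2 by auto
  qed
qed

text \<open>In each case \<open>A\<close> contains what a path cannot: the cycle if \<open>w\<close>
  lies in the ear, the other end \<open>b\<close> of a trihedron with its three neighbours, or the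
  triangle of a stamp with apex \<open>w\<close>.\<close>

lemma solid_insert_not_ipath:
  assumes "solid (insert w A)" "w \<notin> A" "ipath p" "set p = A"
  shows False
  using assms(1) insertI1
proof (cases rule: solid_cases)
  case (ear c Q)
  then have "set c \<inter> Q = {}" by (auto simp: minbad_def bad_def)
  have "set c \<subseteq> A"
  proof
    fix x assume x: "x \<in> set c"
    then have "x \<in> insert w A" using ear(3) by simp
    moreover have "x \<noteq> w" using x ear(4) \<open>set c \<inter> Q = {}\<close> by auto
    ultimately show "x \<in> A" by simp
  qed
  then show False using icycle_not_subset_ipath[OF assms(3) ear(1)] assms(4) by simp
next
  case (theta b q)
  note theta = thetaD[OF theta]
  have bw: "b \<noteq> w" using theta(1)[of 1] by (auto simp: ipath_append)
  then have "b \<in> set p" using theta(3) assms(4) by blast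
  then obtain p1 p2 where p: "p = p1 @ b # p2" by (meson split_list)
  have q: "last (q i) \<in> set p \<and> E b (last (q i)) \<and> last (q i) \<in> set (q i)" if "i \<in> {1, 2, 3}" for i
  proof -
    have "q i \<noteq> []" "ipath (w # q i @ [b])" using theta(1)[OF that] by auto
    then have "last (q i) \<in> set (q i)" "E (last (q i)) b" "last (q i) \<noteq> w" by (auto simp: ipath_append)
    moreover from this have "last (q i) \<in> insert w A" using theta(3) that by blast
    ultimately show ?thesis using sym assms(4) by auto
  qed
  have "last (q i) \<noteq> last (q j)" if "i \<in> {1, 2, 3}" "j \<in> {1, 2, 3}" "i \<noteq> j" for i j
    using theta(2)[OF that] q[OF that(1)] q[OF that(2)] by (auto simp: joined_def)
  then have ne: "last (q 1) \<noteq> last (q 2)" "last (q 1) \<noteq> last (q 3)" "last (q 2) \<noteq> last (q 3)" by auto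
  have "last (q i) = last p1 \<or> last (q i) = hd p2" if "i \<in> {1, 2, 3}" for i
    using ipath_nbrs[of p1 b p2 "last (q i)"] q[OF that] assms(3) p by blast
  then have "last (q 1) = last p1 \<or> last (q 1) = hd p2" "last (q 2) = last p1 \<or> last (q 2) = hd p2"
    "last (q 3) = last p1 \<or> last (q 3) = hd p2" by auto
  then show False using ne by metis
next
  case (apex q)
  note apex = stamp_pathsD[OF apex]
  have q: "hd (q i) \<in> set (q i) \<and> hd (q i) \<in> A" if "i \<in> {1, 2, 3}" for i
  proof -
    have "q i \<noteq> []" "w \<notin> set (q i)" using apex(1)[OF that] by (auto simp: ipath_append)
    then have "hd (q i) \<in> set (q i)" "hd (q i) \<noteq> w" by (auto intro: hd_in_set)
    then show ?thesis using apex(3) that by blast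
  qed
  have "E (hd (q i)) (hd (q j)) \<and> hd (q i) \<noteq> hd (q j)" if "i \<in> {1, 2, 3}" "j \<in> {1, 2, 3}" "i \<noteq> j" for i j
    using apex(2)[OF that] q[OF that(1)] q[OF that(2)] by (auto simp: joined_def)
  then have "icycle [hd (q 1), hd (q 2), hd (q 3)]" by (auto simp: icycle_Cons)
  moreover have "set [hd (q 1), hd (q 2), hd (q 3)] \<subseteq> A" using q by auto
  ultimately show False using icycle_not_subset_ipath assms by blast
qed

text \<open>The ends of an induced path are determined by its vertex set alone. This lets
  \<open>cyc_one\<close> compare two cycles that close up the same set \<open>A\<close>.\<close>

lemma ipath_ends_iff:
  assumes "ipath p" "2 \<le> length p" "x \<in> set p"
  shows "(\<exists>y\<in>set p. \<exists>z\<in>set p. y \<noteq> z \<and> E x y \<and> E x z) \<longleftrightarrow> x \<noteq> hd p \<and> x \<noteq> last p"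
proof -
  obtain p1 p2 where p: "p = p1 @ x # p2" using assms(3) by (meson split_list)
  have d: "distinct p" using ipath_distinct[OF assms(1)] .
  have h: "x = hd p \<longleftrightarrow> p1 = []" using d p by (cases p1) auto
  have l: "x = last p \<longleftrightarrow> p2 = []" using d p by (cases p2 rule: rev_cases) auto
  show ?thesis
  proof
    assume "\<exists>y\<in>set p. \<exists>z\<in>set p. y \<noteq> z \<and> E x y \<and> E x z"
    then obtain y z where "y \<in> set p" "z \<in> set p" "y \<noteq> z" "E x y" "E x z" by blast
    then have "p1 \<noteq> []" "p2 \<noteq> []" using ipath_nbrs[of p1 x p2 y] ipath_nbrs[of p1 x p2 z] assms(1) p by auto
    then show "x \<noteq> hd p \<and> x \<noteq> last p" using h l by blast
  next
    assume "x \<noteq> hd p \<and> x \<noteq> last p"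
    then have ne: "p1 \<noteq> []" "p2 \<noteq> []" using h l by auto
    then have m: "last p1 \<in> set p1" "hd p2 \<in> set p2" by auto
    have "set p1 \<inter> set p2 = {}" using d p by auto
    then have "last p1 \<noteq> hd p2" using m by auto
    moreover have "E (last p1) x" "E x (hd p2)"
      using assms(1) p ne m by (auto simp: ipath_append)
    ultimately have "E (last p1) x" "E x (hd p2)" "last p1 \<noteq> hd p2" by blast+
    then show "\<exists>y\<in>set p. \<exists>z\<in>set p. y \<noteq> z \<and> E x y \<and> E x z"
      using m p sym by (intro bexI[of _ "last p1"] bexI[of _ "hd p2"]) auto
  qed
qed

lemma cyc_insertE:
  assumes "cyc (insert u A)" "u \<notin> A"
  obtains R where "icycle (u # R)" "set R = A"
proof -
  obtain c where c: "icycle c" "set c = insert u A" using assms(1) cyc_iff by blast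
  then obtain R where R: "icycle (u # R)" "set c = insert u (set R)" using icycle_at[of c u] by blast
  then have "u \<notin> set R" by (auto simp: icycle_Cons)
  then show thesis using that R c assms(2) by (metis insert_ident)
qed

lemma cyc_insert_two_nbrs:
  assumes "cyc (insert u A)" "u \<notin> A"
  obtains y z where "y \<in> A" "z \<in> A" "y \<noteq> z" "E u y" "E u z"
proof -
  obtain c where c: "icycle c" "set c = insert u A" using assms(1) cyc_iff by blast
  obtain y z where "y \<in> set c" "z \<in> set c" "y \<noteq> z" "E u y" "E u z" using icycle_nbrs[OF c(1), of u] c(2) by (metis insertI1)
  then show thesis using that c(2) by auto
qed

end

text \<open>\<open>u\<close>, \<open>v\<close> and \<open>w\<close> coexist in one relation; apart
  from the edge \<open>uv\<close> only the adjacencies of \<open>w\<close> to \<open>A\<close> are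
  prescribed. The assumptions pass to subsets of \<open>A\<close>, so the local inequality can be
  summed over them.\<close>

locale edge_contraction = adjacency E for E :: "'a \<Rightarrow> 'a \<Rightarrow> bool" +
  fixes u v w :: 'a and A :: "'a set"
  assumes fin: "finite A" and notin: "u \<notin> A" "v \<notin> A" "w \<notin> A" and uvw: "u \<noteq> w" "v \<noteq> w"
    and Euv: "E u v" and Ew: "x \<in> A \<Longrightarrow> E w x \<longleftrightarrow> E u x \<or> E v x"
begin

lemma uv: "u \<noteq> v" using Euv by auto

lemma swap: "edge_contraction E v u w A"
  by unfold_locales (use fin notin uvw Euv sym Ew in auto)

section \<open>Lifting solids through the contraction\<close>

definition merge :: "'a \<Rightarrow> 'a" where "merge x = (if x = u \<or> x = v then w else x)"

lemma merge_edge: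
  assumes "x \<in> {u, v} \<union> A" "y \<in> {u, v} \<union> A" "E x y"
  shows "merge x = merge y \<or> E (merge x) (merge y)"
proof -
  have m: "merge z = z" if "z \<in> A" for z using that notin by (auto simp: merge_def)
  have muv: "merge t = w" if "t \<in> {u, v}" for t using that by (auto simp: merge_def)
  have Ez: "E w z" if "z \<in> A" "t \<in> {u, v}" "E t z" for z t using Ew[OF that(1)] that by auto
  consider "x \<in> {u, v}" "y \<in> {u, v}" | "x \<in> {u, v}" "y \<in> A" | "x \<in> A" "y \<in> {u, v}" | "x \<in> A" "y \<in> A"
    using assms(1,2) by blast
  then show ?thesis
  proof cases
    case 2 then show ?thesis using Ez[OF 2(2,1) assms(3)] m muv by simp
  next
    case 3 then show ?thesis using Ez[OF 3 sym[OF assms(3)]] m muv sym by simp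
  qed (use assms(3) m muv in auto)
qed

text \<open>The cycle stays and \<open>w\<close> is split inside the ear. The split ear remains
  connected and keeps all attachments, so it contains a minimal ear \<open>P\<close>. Merging
  \<open>u\<close> and \<open>v\<close> again sends \<open>P\<close> to an ear inside
  \<open>Q\<close>, hence onto \<open>Q\<close>. So \<open>P\<close> is \<open>Q\<close> with
  \<open>w\<close> replaced by \<open>u\<close>, by \<open>v\<close> or by both.\<close>

lemma lift_ear:
  assumes c: "icycle c" and mb: "minbad (set c) Q" and S: "insert w A = set c \<union> Q" and wQ: "w \<in> Q"
  shows "solid (insert u A) \<or> solid (insert v A) \<or> solid (insert u (insert v A))"
proof -
  have bd: "conn Q" "Q \<inter> set c = {}" "\<not> small (set c) (att (set c) Q)" using mb by (auto simp: minbad_def bad_def)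
  have cA: "set c \<subseteq> A" and QA: "Q - {w} \<subseteq> A" and A: "A = set c \<union> (Q - {w})" using S bd wQ notin(3) by auto
  let ?Q = "(Q - {w}) \<union> {u, v}"
  have "conn ?Q" unfolding conn_def
  proof (intro conjI allI impI)
    fix X assume X: "X \<subseteq> ?Q" "X \<noteq> {}" "X \<noteq> ?Q"
    consider "u \<in> X" "v \<notin> X" | "v \<in> X" "u \<notin> X" | "u \<in> X" "v \<in> X" | "u \<notin> X" "v \<notin> X" by blast
    then show "\<exists>x\<in>X. \<exists>y\<in>?Q - X. E x y"
    proof cases
      case 1 then show ?thesis using Euv by blast
    next
      case 2 then show ?thesis using sym[OF Euv] by blast
    next
      case 3
      \<comment> \<open>If \<open>u\<close> and \<open>v\<close> are on different sides, the edge
        \<open>uv\<close> crosses the cut; if both are in \<open>X\<close>, the cut comes from one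
        of \<open>Q\<close> with \<open>w\<close> on that side.\<close>
      let ?X = "insert w (X - {u, v})"
      have "?X \<subseteq> Q" "?X \<noteq> Q" using X 3 wQ QA notin by auto
      then obtain x y where xy: "x \<in> ?X" "y \<in> Q - ?X" "E x y" using connD[OF bd(1), of ?X] by blast
      have y: "y \<in> A" "y \<in> ?Q - X" using xy QA notin 3 by auto
      show ?thesis
      proof (cases "x = w")
        case True
        then have "E u y \<or> E v y" using Ew[OF y(1)] xy by simp
        then show ?thesis using 3 y by blast
      next
        case False
        then show ?thesis using xy y by blast
      qed
    next
      case 4
      have "X \<subseteq> Q" "X \<noteq> Q" using X 4 wQ by auto
      then obtain x y where xy: "x \<in> X" "y \<in> Q - X" "E x y" using connD[OF bd(1), of X] X by blast
      have x: "x \<in> A" using xy X 4 QA by blast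
      show ?thesis
      proof (cases "y = w")
        case True
        then have "E u x \<or> E v x" using Ew[OF x] sym[OF xy(3)] by simp
        then show ?thesis using 4 xy sym by blast
      next
        case False
        then show ?thesis using xy by blast
      qed
    qed
  qed auto
  moreover have "att (set c) Q \<subseteq> att (set c) ?Q"
    unfolding att_def using Ew cA by blast
  then have "\<not> small (set c) (att (set c) ?Q)" using small_mono bd(3) by blast
  ultimately have "bad (set c) ?Q" unfolding bad_def using bd(2) cA notin by auto
  moreover have "finite ?Q" using finite_subset[OF QA fin] by simp
  ultimately obtain P where P: "P \<subseteq> ?Q" "minbad (set c) P" using bad_minbad[of ?Q "set c"] by metis
  have Pb: "conn P" "\<not> small (set c) (att (set c) P)" using P(2) by (auto simp: minbad_def bad_def)
  have gQ: "merge ` P \<subseteq> Q" using P(1) wQ by (auto simp: merge_def)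
  have "conn (merge ` P)"
  proof (rule conn_image[OF Pb(1)])
    fix x y assume xy: "x \<in> P" "y \<in> P" "E x y"
    then show "merge x = merge y \<or> E (merge x) (merge y)" using P(1) QA by (intro merge_edge) auto
  qed
  moreover have "att (set c) P \<subseteq> att (set c) (merge ` P)"
  proof
    fix x assume "x \<in> att (set c) P"
    then obtain q where q: "x \<in> set c" "q \<in> P" "E q x" by (auto simp: att_def)
    then have "E (merge q) x" using Ew[of x] cA by (auto simp: merge_def)
    then show "x \<in> att (set c) (merge ` P)" using q by (auto simp: att_def)
  qed
  then have "\<not> small (set c) (att (set c) (merge ` P))" using small_mono Pb(2) by blast
  ultimately have gP: "merge ` P = Q" using minbadD[OF mb] gQ by blast
  have "P - {u, v} = Q - {w}"
  proof
    show "P - {u, v} \<subseteq> Q - {w}" using P(1) by auto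
    show "Q - {w} \<subseteq> P - {u, v}"
    proof
      fix x assume x: "x \<in> Q - {w}"
      then obtain y where "y \<in> P" "x = merge y" using gP by blast
      then show "x \<in> P - {u, v}" using x QA notin by (auto simp: merge_def split: if_splits)
    qed
  qed
  moreover have "u \<in> P \<or> v \<in> P"
  proof -
    obtain y where y: "y \<in> P" "w = merge y" using gP wQ by blast
    have "w \<notin> P" using P(1) uvw by auto
    then show ?thesis using y by (auto simp: merge_def split: if_splits)
  qed
  ultimately have "P = insert u (Q - {w}) \<or> P = insert v (Q - {w}) \<or> P = insert u (insert v (Q - {w}))"
    by blast
  then have "set c \<union> P = insert u A \<or> set c \<union> P = insert v A \<or> set c \<union> P = insert u (insert v A)"
    by (subst (1 2 3) A) auto
  then show ?thesis using minbad_solid[OF c P(2)] by metis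
qed

text \<open>
  \<open>w\<close> lies on the cycle and \<open>u\<close>, \<open>v\<close> can each take over only part of the neighbours \<open>h i\<close> of \<open>w\<close>:
  then \<open>w\<close> is replaced by the edge \<open>uv\<close> in a cycle through a neighbour missed by \<open>u\<close> and one missed by \<open>v\<close>,
  while the path to the third neighbour is kept as ear.
\<close>

definition branching :: "'a list \<Rightarrow> 'a list \<Rightarrow> bool" where
  "branching R q \<longleftrightarrow> icycle (w # R) \<and> ipath q \<and> q \<noteq> [] \<and> E w (hd q) \<and>
    A = set R \<union> set q \<and> set R \<inter> set q = {} \<and> (\<forall>s\<in>set q. s \<noteq> last q \<longrightarrow> (\<forall>t\<in>set R. \<not> E s t)) \<and>
    small (set R) (att (set R) {last q}) \<and> \<not> small (set (w # R)) (att (set (w # R)) (set q))"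

text \<open>If \<open>u\<close> or \<open>v\<close> sees every neighbour of \<open>w\<close> in
  \<open>A\<close>, it takes the place of \<open>w\<close>. The premise \<open>cycles\<close> covers
  every ordered choice of two neighbours, because which ones are missed by \<open>v\<close> and by
  \<open>u\<close> is not known beforehand.\<close>

lemma lift_branch:
  fixes h :: "nat \<Rightarrow> 'a"
  assumes sol: "solid (insert w A)"
    and nbrs: "\<And>x. x \<in> A \<Longrightarrow> E w x \<Longrightarrow> \<exists>i\<in>{1, 2, 3}. x = h i"
    and cycles: "\<And>m i k. m \<in> {1, 2, 3} \<Longrightarrow> i \<in> {1, 2, 3} \<Longrightarrow> k \<in> {1, 2, 3} \<Longrightarrow> m \<noteq> i \<Longrightarrow> m \<noteq> k \<Longrightarrow> i \<noteq> k \<Longrightarrow> {1, 2, 3} = {m, i, k} \<Longrightarrow>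
      \<exists>R q. branching R q \<and> hd R = h m \<and> last R = h i \<and> hd q = h k"
  shows "solid (insert u A) \<or> solid (insert v A) \<or> solid (insert u (insert v A))"
proof -
  have rep: "solid (insert x A)" if "x = u \<or> x = v" "\<And>s. s \<in> A \<Longrightarrow> E w s \<Longrightarrow> E x s" for x
    using that Ew notin by (intro solid_replace[OF sol notin(3)]) blast+
  show ?thesis
  proof (cases "(\<forall>s\<in>A. E w s \<longrightarrow> E u s) \<or> (\<forall>s\<in>A. E w s \<longrightarrow> E v s)")
    case True
    then show ?thesis using rep by blast
  next
    case False
    then obtain x y where x: "x \<in> A" "E w x" "\<not> E v x" and y: "y \<in> A" "E w y" "\<not> E u y" by blast
    obtain m i where mi: "m \<in> {1, 2, 3}" "x = h m" "i \<in> {1, 2, 3}" "y = h i" using nbrs x(1,2) y(1,2) by metis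
    have "m \<noteq> i" using x y mi(2,4) Ew by auto
    then obtain k where k: "k \<in> {1, 2, 3}" "m \<noteq> k" "i \<noteq> k" "{1, 2, 3} = {m, i, k}"
      using third_index[OF mi(1,3)] by metis
    obtain R q where br: "branching R q" and hR: "hd R = x" "last R = y" and hq: "hd q = h k"
      using cycles[OF mi(1,3) k(1) \<open>m \<noteq> i\<close> k(2-4)] unfolding mi(2,4)[symmetric] by blast
    have R: "icycle (w # R)" "hd R = x" "last R = y" and q: "ipath q" "q \<noteq> []" "hd q = h k"
      and A: "A = set R \<union> set q" "set R \<inter> set q = {}" and inner: "\<forall>s\<in>set q. s \<noteq> last q \<longrightarrow> (\<forall>t\<in>set R. \<not> E s t)"
      and sm: "small (set R) (att (set R) {last q})" and bad: "\<not> small (set (w # R)) (att (set (w # R)) (set q))"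
      using br hR hq unfolding branching_def by blast+
    have Rw: "ipath R" "2 \<le> length R" "\<And>t. t \<in> set R \<Longrightarrow> E w t \<longleftrightarrow> t = x \<or> t = y" using R by (auto simp: icycle_Cons)
    have uv_ne: "E u x" "E v y" using x y Ew by auto
    have Eu: "E u t \<longleftrightarrow> t = x" and Ev: "E v t \<longleftrightarrow> t = y" if "t \<in> set R" for t
      using Ew[of t] Rw(3)[OF that] that A(1) x y uv_ne by auto
    have nin: "u \<notin> set R" "v \<notin> set R" "u \<notin> set q" "v \<notin> set q" using A(1) notin by auto
    have wq: "s = hd q" if s: "s \<in> set q" "E w s" for s
    proof -
      have "s = h m \<or> s = h i \<or> s = h k" using nbrs[of s] s A(1) unfolding k(4) by auto
      moreover have "hd R \<in> set R" "last R \<in> set R" using Rw(2) by (auto intro!: hd_in_set last_in_set)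
      then have "s \<noteq> x" "s \<noteq> y" using s(1) A(2) R(2,3) by auto
      ultimately show ?thesis using mi q(3) by auto
    qed
    \<comment> \<open>The vertex \<open>w\<close> is expanded into the edge \<open>uv\<close>. On
      \<open>R\<close>, \<open>u\<close> sees only \<open>hd R\<close> and \<open>v\<close> only
      \<open>last R\<close>, so the longer cycle is still induced.\<close>
    let ?C = "set (u # R @ [v])" and ?W = "set (w # R)"
    have "ipath (R @ [v])" using Rw(1) nin Ev R(3) E_commute[of _ v] by (auto simp: ipath_append)
    moreover have "R \<noteq> []" using Rw(2) by auto
    ultimately have cy: "icycle (u # R @ [v])"
      using Rw(2) nin uv Eu Euv R(2) by (auto simp: icycle_Cons)
    have "minbad ?C (set q)"
    proof (rule minbad_path[OF q(1,2)])
      show "set q \<inter> ?C = {}" using A(2) nin by auto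
      \<comment> \<open>Only \<open>hd q\<close> sees \<open>w\<close>, so no later vertex of
        \<open>q\<close> sees \<open>u\<close> or \<open>v\<close>.\<close>
      have "att ?C (set q - {hd q}) \<subseteq> att (set R) {last q}"
      proof
        fix t assume "t \<in> att ?C (set q - {hd q})"
        then obtain s where s: "t \<in> ?C" "s \<in> set q" "s \<noteq> hd q" "E s t" by (auto simp: att_def)
        then have "t \<noteq> u" "t \<noteq> v" using wq[of s] Ew[of s] A(1) sym by auto
        then show "t \<in> att (set R) {last q}" using s inner by (auto simp: att_def)
      qed
      moreover have "small ?C (att (set R) {last q})" using sm unfolding small_def by auto
      ultimately show "small ?C (att ?C (set q - {hd q}))" using small_mono by blast
      have "att ?C (set q - {last q}) \<subseteq> {u, v}" using inner by (auto simp: att_def)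
      then show "small ?C (att ?C (set q - {last q}))" unfolding small_def using Euv by auto
      \<comment> \<open>An edge of the new cycle covering the attachments would, after merging
        \<open>u\<close> and \<open>v\<close>, become a vertex or an edge of the old cycle covering
        the old attachments.\<close>
      show "\<not> small ?C (att ?C (set q))"
      proof
        assume "small ?C (att ?C (set q))"
        then obtain c d where cd: "c \<in> ?C" "d \<in> ?C" "E c d" "att ?C (set q) \<subseteq> {c, d}" unfolding small_def by blast
        have mR: "merge t = t" if "t \<in> set R" for t using that nin by (auto simp: merge_def)
        have N: "att ?W (set q) \<subseteq> {merge c, merge d}"
        proof
          fix t assume "t \<in> att ?W (set q)"
          then obtain s where s: "t = w \<or> t \<in> set R" "s \<in> set q" "E s t" by (auto simp: att_def)
          show "t \<in> {merge c, merge d}"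
          proof (cases "t \<in> set R")
            case True
            then have "t \<in> att ?C (set q)" using s by (auto simp: att_def)
            then show ?thesis using cd(4) mR[OF True] by auto
          next
            case False
            then have "E u s \<or> E v s" using s Ew[of s] A(1) sym by auto
            then have "u \<in> att ?C (set q) \<or> v \<in> att ?C (set q)" using s(2) sym by (auto simp: att_def)
            then show ?thesis using cd(4) s(1) False by (auto simp: merge_def)
          qed
        qed
        have "small ?W (att ?W (set q))"
        proof (cases "merge c = merge d")
          case True
          then show ?thesis using small_pair[OF R(1), of "att ?W (set q)" "merge c"] N by (auto simp: att_def)
        next
          case False
          have "E (merge c) (merge d)"
            using merge_edge[OF _ _ cd(3)] cd(1,2) False A(1) by auto
          moreover have "merge c \<in> ?W" "merge d \<in> ?W" using cd(1,2) by (auto simp: merge_def)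
          ultimately show ?thesis using N unfolding small_def by blast
        qed
        then show False using bad by blast
      qed
    qed
    from minbad_solid[OF cy this] have "solid (?C \<union> set q)" .
    moreover have "?C \<union> set q = insert u (insert v A)" using A(1) by auto
    ultimately show ?thesis by simp
  qed
qed

lemma lift_theta:
  assumes th: "theta w b p (insert w A)" and sol: "solid (insert w A)"
  shows "solid (insert u A) \<or> solid (insert v A) \<or> solid (insert u (insert v A))"
proof (rule lift_branch[OF sol, of "\<lambda>i. hd (p i)"])
  note p = thetaD(1)[OF th] and j = thetaD(2)[OF th] and S = thetaD(3)[OF th]
  let ?I = "{1, 2, 3} :: nat set"
  have w: "w \<noteq> b" "\<not> E w b" "w \<notin> set (p i)" "b \<notin> set (p i)" "ipath (p i)" "\<And>s. s \<in> set (p i) \<Longrightarrow> E w s \<longleftrightarrow> s = hd (p i)"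
    "\<And>s. s \<in> set (p i) \<Longrightarrow> E s b \<longleftrightarrow> s = last (p i)" "hd (p i) \<in> set (p i)" "last (p i) \<in> set (p i)"
    if "i \<in> ?I" for i
    using p[OF that] by (auto simp: ipath_append)
  have A: "A = {b} \<union> (\<Union>i\<in>?I. set (p i))"
  proof -
    have "w \<notin> {b} \<union> (\<Union>i\<in>?I. set (p i))" using w by auto
    moreover have "insert w A = insert w ({b} \<union> (\<Union>i\<in>?I. set (p i)))" using S by simp
    ultimately show ?thesis using notin(3) by (metis insert_ident)
  qed
  show "\<exists>i\<in>?I. x = hd (p i)" if x: "x \<in> A" "E w x" for x
  proof -
    have "x \<noteq> b" using x w(2)[of 1] by auto
    then obtain i where "i \<in> ?I" "x \<in> set (p i)" using x(1) unfolding A by blast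
    then show ?thesis using w(6) x(2) by metis
  qed
  fix m i k assume I: "m \<in> ?I" "i \<in> ?I" "k \<in> ?I" "m \<noteq> i" "m \<noteq> k" "i \<noteq> k" "?I = {m, i, k}"
  \<comment> \<open>The cycle through the paths \<open>m\<close> and \<open>i\<close> is read from
    \<open>w\<close> and passes the other end \<open>b\<close>; path \<open>k\<close> is the ear,
    with \<open>b\<close> as its attachment away from \<open>w\<close>.\<close>
  let ?R = "p m @ b # rev (p i)"
  have "icycle (b # rev (w # p i) @ p m)"
    using p[OF I(1)] p[OF I(2)] j[OF I(2,1)] I(4) by (intro icycle_of_theta) auto
  then have cy: "icycle (w # ?R)" using icycle_rotate[of "b # rev (p i)" "w # p m"] by simp
  have N: "\<not> E s t" if "s \<in> set (p k)" "t \<in> set (p m) \<union> set (p i)" for s t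
    using joinedD(2)[OF j[OF I(3,1)]] joinedD(2)[OF j[OF I(3,2)]] I(5,6) that by auto
  have dis: "set (p k) \<inter> (set (p m) \<union> set (p i)) = {}"
    using joinedD(1)[OF j[OF I(3,1)]] joinedD(1)[OF j[OF I(3,2)]] I(5,6) by auto
  have "att (set ?R) {last (p k)} \<subseteq> {b}" using N[OF w(9)[OF I(3)]] by (auto simp: att_def)
  moreover have "E b (last (p m))" "last (p m) \<in> set ?R" using w(7,9)[OF I(1)] sym by auto
  ultimately have "small (set ?R) (att (set ?R) {last (p k)})" unfolding small_def by auto
  moreover have "w \<in> att (set (w # ?R)) (set (p k))" "b \<in> att (set (w # ?R)) (set (p k))"
    using w(6)[OF I(3) w(8)[OF I(3)]] w(7)[OF I(3) w(9)[OF I(3)]] w(8,9)[OF I(3)] sym by (auto simp: att_def)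
  then have "\<not> small (set (w # ?R)) (att (set (w # ?R)) (set (p k)))"
    using smallD w(1,2)[OF I(1)] by blast
  moreover have "A = set ?R \<union> set (p k)" unfolding A I(7) by auto
  moreover have "E w (hd (p k))" using w(6,8)[OF I(3)] by blast
  moreover have "set ?R \<inter> set (p k) = {}" using dis w(4)[OF I(3)] by auto
  moreover have "\<forall>s\<in>set (p k). s \<noteq> last (p k) \<longrightarrow> (\<forall>t\<in>set ?R. \<not> E s t)"
    using N w(7)[OF I(3)] by auto
  moreover have "ipath (p k)" "p k \<noteq> []" using w(5)[OF I(3)] p[OF I(3)] by blast+
  moreover have "hd ?R = hd (p m)" "last ?R = hd (p i)" using p[OF I(1)] p[OF I(2)] by (simp_all add: last_rev)
  ultimately show "\<exists>R q. branching R q \<and> hd R = hd (p m) \<and> last R = hd (p i) \<and> hd q = hd (p k)"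
    using cy unfolding branching_def by (intro exI[of _ ?R] exI[of _ "p k"] conjI refl)
qed

lemma lift_apex:
  assumes sp: "stamp_paths w p (insert w A)" and sol: "solid (insert w A)"
  shows "solid (insert u A) \<or> solid (insert v A) \<or> solid (insert u (insert v A))"
proof (rule lift_branch[OF sol, of "\<lambda>i. last (p i)"])
  note p = stamp_pathsD(1)[OF sp] and j = stamp_pathsD(2)[OF sp] and S = stamp_pathsD(3)[OF sp]
  let ?I = "{1, 2, 3} :: nat set"
  have w: "w \<notin> set (p i)" "ipath (p i)" "\<And>s. s \<in> set (p i) \<Longrightarrow> E w s \<longleftrightarrow> s = last (p i)"
    "hd (p i) \<in> set (p i)" "last (p i) \<in> set (p i)"
    if "i \<in> ?I" for i
    using p[OF that] E_commute[of w] by (auto simp: ipath_append)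
  have A: "A = (\<Union>i\<in>?I. set (p i))"
  proof -
    have "w \<notin> (\<Union>i\<in>?I. set (p i))" using w by auto
    moreover have "insert w A = insert w (\<Union>i\<in>?I. set (p i))" using S by simp
    ultimately show ?thesis using notin(3) by (metis insert_ident)
  qed
  show "\<exists>i\<in>?I. x = last (p i)" if x: "x \<in> A" "E w x" for x
  proof -
    obtain i where "i \<in> ?I" "x \<in> set (p i)" using x(1) unfolding A by blast
    then show ?thesis using w(3) x(2) by metis
  qed
  fix m i k assume I: "m \<in> ?I" "i \<in> ?I" "k \<in> ?I" "m \<noteq> i" "m \<noteq> k" "i \<noteq> k" "?I = {m, i, k}"
  \<comment> \<open>The paths run towards the apex, so the ear is reversed to start next to
    \<open>w\<close>; its far end completes the edge from \<open>hd (p m)\<close> to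
    \<open>hd (p i)\<close> to the triangle.\<close>
  let ?R = "rev (p m) @ p i" and ?q = "rev (p k)"
  have cy: "icycle (w # ?R)" using p[OF I(1)] p[OF I(2)] j[OF I(1,2,4)] by (intro icycle_of_stamp) auto
  have N: "E s t \<Longrightarrow> s = hd (p k) \<and> (t = hd (p m) \<or> t = hd (p i))" if "s \<in> set (p k)" "t \<in> set ?R" for s t
    using joinedD(2)[OF j[OF I(3,1)]] joinedD(2)[OF j[OF I(3,2)]] I(5,6) that by auto
  have h: "E (hd (p k)) (hd (p m))" "E (hd (p k)) (hd (p i))" "E (hd (p m)) (hd (p i))"
    using joinedD(2)[OF j[OF I(3,1)]] joinedD(2)[OF j[OF I(3,2)]] joinedD(2)[OF j[OF I(1,2,4)]] I(5,6) w(4) I(1-3) by auto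
  have dis: "set (p k) \<inter> set ?R = {}"
    using joinedD(1)[OF j[OF I(3,1)]] joinedD(1)[OF j[OF I(3,2)]] I(5,6) by auto
  have hR: "hd (p m) \<in> set ?R" "hd (p i) \<in> set ?R" using w(4)[OF I(1)] w(4)[OF I(2)] by auto
  have lq: "last ?q = hd (p k)" "hd ?q = last (p k)" using p[OF I(3)] by (simp_all add: last_rev hd_rev)
  have "att (set ?R) {last ?q} \<subseteq> {hd (p m), hd (p i)}" using N[OF w(4)[OF I(3)]] unfolding lq by (auto simp: att_def)
  then have "small (set ?R) (att (set ?R) {last ?q})" unfolding small_def using h(3) hR by blast
  moreover have "w \<in> att (set (w # ?R)) (set ?q)" "hd (p m) \<in> att (set (w # ?R)) (set ?q)" "hd (p i) \<in> att (set (w # ?R)) (set ?q)"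
    using w(3-5)[OF I(3)] h hR sym by (auto simp: att_def)
  then have "\<not> small (set (w # ?R)) (att (set (w # ?R)) (set ?q))"
    by (rule not_small_3) (use h(3) w(1,4)[OF I(1)] w(1,4)[OF I(2)] in auto)
  moreover have "A = set ?R \<union> set ?q" unfolding A I(7) by auto
  moreover have "E w (hd ?q)" using w(3,5)[OF I(3)] unfolding lq by blast
  moreover have "set ?R \<inter> set ?q = {}" using dis by auto
  moreover have "\<forall>s\<in>set ?q. s \<noteq> last ?q \<longrightarrow> (\<forall>t\<in>set ?R. \<not> E s t)"
    using N unfolding lq by auto
  moreover have "hd ?R = last (p m)" "last ?R = last (p i)" using p[OF I(1)] p[OF I(2)] by (simp_all add: hd_rev)
  moreover have "ipath ?q" "?q \<noteq> []" using w(2)[OF I(3)] p[OF I(3)] by simp_all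
  ultimately show "\<exists>R q. branching R q \<and> hd R = last (p m) \<and> last R = last (p i) \<and> hd q = last (p k)"
    using cy lq(2) unfolding branching_def by (intro exI[of _ ?R] exI[of _ ?q] conjI) simp_all
qed

lemma lift_solid:
  assumes "solid (insert w A)"
  shows "solid (insert u A) \<or> solid (insert v A) \<or> solid (insert u (insert v A))"
  using assms insertI1
proof (cases rule: solid_cases)
  case (ear c Q)
  then show ?thesis using lift_ear by blast
next
  case (theta b p)
  show ?thesis by (rule lift_theta[OF theta assms])
next
  case (apex p)
  show ?thesis by (rule lift_apex[OF apex assms])
qed

section \<open>Induced cycles through the contracted edge\<close>

lemma cyc_both:
  assumes "cyc (insert u (insert v A))"
  obtains R where "icycle (u # v # R)" "set R = A"
proof -
  obtain R where R: "icycle (u # R)" "set R = insert v A" using cyc_insertE[OF assms] uv notin by blast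
  then have "v = hd R \<or> v = last R" "R \<noteq> []" using Euv by (auto simp: icycle_Cons)
  then have "\<exists>R'. icycle (u # R') \<and> set R' = set R \<and> v = hd R'"
    using R icycle_rev_Cons[OF R(1)] by (auto simp: hd_rev intro: exI[of _ R] exI[of _ "rev R"])
  then obtain R' where R': "icycle (u # R')" "set R' = insert v A" "v = hd R'" using R by blast
  then obtain R2 where "R' = v # R2" by (cases R') auto
  moreover from this have "v \<notin> set R2" using icycle_distinct[OF R'(1)] by auto
  ultimately show thesis using that[of R2] R' notin by (metis insert_ident list.simps(15))
qed

text \<open>The attachments of \<open>v\<close> on the cycle \<open>A + u\<close> decide. If they
  are small, they contain besides \<open>u\<close> at most one vertex, a neighbour of
  \<open>u\<close>; then \<open>w\<close> sees in \<open>A\<close> exactly what \<open>u\<close>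
  sees, and \<open>v\<close> closes no cycle. If they are not small, \<open>v\<close> is a
  one-vertex ear and \<open>A + u + v\<close> is solid. Should \<open>A + v\<close> be a cycle as
  well, then \<open>u\<close> and \<open>v\<close> are joined to the same two ends of the path
  \<open>A\<close>, and so is \<open>w\<close>.\<close>

lemma cyc_one:
  assumes "cyc (insert u A)"
  shows "cyc (insert w A) \<and> \<not> cyc (insert v A) \<or> solid (insert u (insert v A)) \<and> (cyc (insert v A) \<longrightarrow> cyc (insert w A))"
proof -
  obtain R where R: "icycle (u # R)" "set R = A" using cyc_insertE[OF assms notin(1)] .
  have cw: "cyc (insert w A)" if "\<And>t. t \<in> A \<Longrightarrow> E w t \<longleftrightarrow> E u t"
  proof -
    have "icycle (w # R)" using R notin(3) that by (simp add: icycle_Cons)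
    then show ?thesis using R cyc_iff by (metis list.simps(15))
  qed
  let ?C = "set (u # R)"
  have uatt: "u \<in> att ?C {v}" using Euv sym by (auto simp: att_def)
  show ?thesis
  proof (cases "small ?C (att ?C {v})")
    case True
    then obtain z where z: "z \<in> ?C" "E u z" "att ?C {v} \<subseteq> {u, z}" using uatt sym unfolding small_def by blast
    have vz: "t = z" if "t \<in> A" "E v t" for t using that z(3) R(2) notin(1) by (auto simp: att_def)
    have "E w t \<longleftrightarrow> E u t" if "t \<in> A" for t using Ew[OF that] vz[OF that] z(2) by auto
    moreover have "\<not> cyc (insert v A)"
      using vz by (auto elim!: cyc_insert_two_nbrs[OF _ notin(2)])
    ultimately show ?thesis using cw by blast
  next
    case False
    have vC: "v \<notin> ?C" using R notin uv by auto
    have "minbad ?C {v}" unfolding minbad_def bad_def using False vC by (auto simp: conn_def)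
    then have "solid (?C \<union> {v})" by (rule minbad_solid[OF R(1)])
    moreover have "?C \<union> {v} = insert u (insert v A)" using R by auto
    moreover have "cyc (insert w A)" if cv: "cyc (insert v A)"
    proof (rule cw)
      obtain R2 where R2: "icycle (v # R2)" "set R2 = A" using cyc_insertE[OF cv notin(2)] .
      fix t assume t: "t \<in> A"
      have "E u t \<longleftrightarrow> t = hd R \<or> t = last R" "E v t \<longleftrightarrow> t = hd R2 \<or> t = last R2"
        using R R2 t by (auto simp: icycle_Cons)
      moreover have "t = hd R \<or> t = last R \<longleftrightarrow> t = hd R2 \<or> t = last R2"
        using ipath_ends_iff[of R t] ipath_ends_iff[of R2 t] R R2 t unfolding icycle_Cons by metis
      ultimately show "E w t \<longleftrightarrow> E u t" using Ew[OF t] by blast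
    qed
    ultimately show ?thesis by metis
  qed
qed

text \<open>If \<open>A\<close> induces no path, none of the three sets is a cycle and
  \<open>lift_solid\<close> suffices. If it does, \<open>A + w\<close> is not solid. A cycle
  \<open>A + u + v\<close> leaves \<open>u\<close> and \<open>v\<close> one neighbour each in
  \<open>A\<close>; then \<open>A + u\<close> and \<open>A + v\<close> are no cycles, and
  \<open>A + w\<close> is one unless \<open>A\<close> is a single common neighbour. If
  \<open>A + u + v\<close> is no cycle, \<open>cyc_one\<close> is applied from both sides.\<close>

lemma local_inequality:
  "(of_bool (cyc (insert u A)) + of_bool (cyc (insert v A)) + of_bool (cyc (insert u (insert v A))) + of_bool (solid (insert w A)) :: nat)
    \<le> of_bool (cyc (insert w A)) + of_bool (solid (insert u A)) + of_bool (solid (insert v A)) + of_bool (solid (insert u (insert v A)))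
      + of_bool (\<exists>x. A = {x} \<and> E u x \<and> E v x)"
proof (cases "\<exists>p. ipath p \<and> set p = A")
  case False
  have "\<not> cyc (insert u A)" "\<not> cyc (insert v A)"
    using False by (auto elim!: cyc_insertE[OF _ notin(1)] cyc_insertE[OF _ notin(2)] simp: icycle_Cons)
  moreover have "\<not> cyc (insert u (insert v A))"
    using False by (auto elim!: cyc_both simp: icycle_Cons)
  ultimately show ?thesis using lift_solid by auto
next
  case True
  then have ns: "\<not> solid (insert w A)" using solid_insert_not_ipath notin(3) by blast
  show ?thesis
  proof (cases "cyc (insert u (insert v A))")
    case c: True
    obtain R where R: "icycle (u # v # R)" "set R = A" using cyc_both[OF c] .
    have Rne: "R \<noteq> []" using R by (auto simp: icycle_Cons)
    have u1: "E u t \<longleftrightarrow> t = last R" and v1: "E v t \<longleftrightarrow> t = hd R" if "t \<in> A" for t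
      using R Rne that notin by (auto simp: icycle_Cons)
    have "\<not> cyc (insert u A)"
    proof
      assume "cyc (insert u A)"
      then obtain y z where "y \<in> A" "z \<in> A" "y \<noteq> z" "E u y" "E u z"
        using notin(1) by (rule cyc_insert_two_nbrs)
      then show False using u1 by metis
    qed
    moreover have "\<not> cyc (insert v A)"
    proof
      assume "cyc (insert v A)"
      then obtain y z where "y \<in> A" "z \<in> A" "y \<noteq> z" "E v y" "E v z"
        using notin(2) by (rule cyc_insert_two_nbrs)
      then show False using v1 by metis
    qed
    moreover have "cyc (insert w A) \<or> (\<exists>x. A = {x} \<and> E u x \<and> E v x)"
    proof (cases "2 \<le> length R")
      case True
      have "E w t \<longleftrightarrow> t = hd R \<or> t = last R" if "t \<in> A" for t
        using Ew[OF that] u1[OF that] v1[OF that] by blast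
      then have "icycle (w # R)" using True R notin(3) by (simp add: icycle_Cons)
      then show ?thesis using R cyc_iff by (metis list.simps(15))
    next
      case False
      then obtain x where "R = [x]" using Rne by (cases R) (auto simp: not_le)
      then show ?thesis using R u1[of x] v1[of x] by auto
    qed
    ultimately show ?thesis using ns by auto
  next
    case nc: False
    interpret sw: edge_contraction E v u w A by (rule swap)
    have 1: "cyc (insert u A) \<Longrightarrow> cyc (insert w A) \<and> \<not> cyc (insert v A) \<or>
      solid (insert u (insert v A)) \<and> (cyc (insert v A) \<longrightarrow> cyc (insert w A))"
      by (rule cyc_one)
    have 2: "cyc (insert v A) \<Longrightarrow> cyc (insert w A) \<and> \<not> cyc (insert u A) \<or>
      solid (insert u (insert v A)) \<and> (cyc (insert u A) \<longrightarrow> cyc (insert w A))"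
      using sw.cyc_one by (simp add: insert_commute)
    show ?thesis
      by (cases "cyc (insert u A)"; cases "cyc (insert v A)"; cases "cyc (insert w A)"; cases "solid (insert u (insert v A))")
        (use ns nc 1 2 in simp_all)
  qed
qed

end

subsection \<open>Counting\<close>

lemma card_subsets_insert:
  assumes "finite B" "x \<notin> B"
  shows "card {S. S \<subseteq> insert x B \<and> P S} = card {S. S \<subseteq> B \<and> P S} + card {S. S \<subseteq> B \<and> P (insert x S)}"
proof -
  let ?X = "{S. S \<subseteq> B \<and> P S}" and ?Y = "{S. S \<subseteq> B \<and> P (insert x S)}"
  have "{S. S \<subseteq> insert x B \<and> P S} = ?X \<union> insert x ` ?Y"
  proof (intro equalityI subsetI)
    fix S assume S: "S \<in> {S. S \<subseteq> insert x B \<and> P S}"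
    show "S \<in> ?X \<union> insert x ` ?Y"
    proof (cases "x \<in> S")
      case True
      then have "S = insert x (S - {x})" by auto
      moreover from this have "S - {x} \<in> ?Y" using S by auto
      ultimately show ?thesis by blast
    qed (use S in auto)
  qed auto
  moreover have "finite ?X" "finite ?Y" using assms(1) by auto
  moreover have "?X \<inter> insert x ` ?Y = {}" using assms(2) by auto
  moreover have "inj_on (insert x) ?Y" using assms(2) by (intro inj_onI) (auto simp: insert_ident subset_iff)
  ultimately show ?thesis by (simp add: card_Un_disjoint card_image)
qed

lemma card_subsets_sum:
  "finite B \<Longrightarrow> card {S. S \<subseteq> B \<and> P S} = (\<Sum>S\<in>Pow B. of_bool (P S))"
  by (simp add: sum_of_bool_eq Int_def Pow_def)

context adjacency begin

definition beth :: "'a set \<Rightarrow> int" where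
  "beth V = int (card {T. T \<subseteq> V \<and> solid T}) - int (card {T. T \<subseteq> V \<and> cyc T})
     + int (card (edges (induced V))) - int (card V)"

lemma edges_induced_subset: "f \<in> edges (induced B) \<Longrightarrow> f \<subseteq> B"
  by (auto elim: edge_inducedE)

lemma finite_edges_induced: "finite B \<Longrightarrow> finite (edges (induced B))"
  using edges_induced_subset by (rule_tac finite_subset[of _ "Pow B"]) auto

lemma card_edges_insert:
  assumes "finite B" "x \<notin> B"
  shows "card (edges (induced (insert x B))) = card (edges (induced B)) + card {y \<in> B. E x y}"
proof -
  have "edges (induced (insert x B)) = edges (induced B) \<union> (\<lambda>y. {x, y}) ` {y \<in> B. E x y}"
  proof (intro equalityI subsetI)
    fix f assume "f \<in> edges (induced (insert x B))"
    then obtain a b where ab: "f = {a, b}" "a \<in> insert x B" "b \<in> insert x B" "E a b" by (rule edge_inducedE)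
    consider "a = x" "b \<in> B" | "b = x" "a \<in> B" | "a \<in> B" "b \<in> B" using ab by auto
    then show "f \<in> edges (induced B) \<union> (\<lambda>y. {x, y}) ` {y \<in> B. E x y}"
    proof cases
      case 1 then show ?thesis using ab by auto
    next
      case 2 then show ?thesis using ab sym by (auto simp: insert_commute)
    next
      case 3 then show ?thesis using ab by auto
    qed
  next
    fix f assume "f \<in> edges (induced B) \<union> (\<lambda>y. {x, y}) ` {y \<in> B. E x y}"
    then show "f \<in> edges (induced (insert x B))" by (auto elim!: edge_inducedE)
  qed
  moreover have "edges (induced B) \<inter> (\<lambda>y. {x, y}) ` {y \<in> B. E x y} = {}"
    using edges_induced_subset assms(2) by blast
  moreover have "inj_on (\<lambda>y. {x, y}) {y \<in> B. E x y}" by (auto simp: inj_on_def doubleton_eq_iff)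
  ultimately show ?thesis using finite_edges_induced assms(1) by (simp add: card_Un_disjoint card_image)
qed

lemma induced_subgraph_iff: "induced_subgraph H (induced V) \<longleftrightarrow> (\<exists>T\<subseteq>V. H = induced T)"
proof
  assume H: "induced_subgraph H (induced V)"
  have "induced (verts H) = H"
  proof (rule induced_eqI)
    show "\<exists>x y. f = {x, y}" if "f \<in> edges H" for f
      using that H by (auto simp: induced_subgraph_def elim!: edge_inducedE)
    show "{x, y} \<in> edges H \<longleftrightarrow> x \<in> verts H \<and> y \<in> verts H \<and> E x y" for x y
      using H by (auto simp: induced_subgraph_def)
  qed simp
  then show "\<exists>T\<subseteq>V. H = induced T" using H by (metis induced_subgraph_def verts_induced)
next
  assume "\<exists>T\<subseteq>V. H = induced T"
  then obtain T where T: "T \<subseteq> V" "H = induced T" by blast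
  have "edges (induced T) = {f \<in> edges (induced V). f \<subseteq> T}"
    using T(1) by (auto elim!: edge_inducedE)
  then show "induced_subgraph H (induced V)" using T by (simp add: induced_subgraph_def)
qed

text \<open>The copy \<open>K\<close> is itself an induced graph, of the relation \<open>F\<close>
  read off from its edges, so relabelling applies to it.\<close>

lemma solid_iso_iff: "(\<exists>K :: 'a graph. solid_graph K \<and> graph_iso (induced T) K) \<longleftrightarrow> solid T"
proof
  assume "solid T"
  moreover have "graph_iso (induced T) (induced T)"
    unfolding graph_iso_def by (intro exI[of _ id]) auto
  ultimately show "\<exists>K :: 'a graph. solid_graph K \<and> graph_iso (induced T) K"
    unfolding solid_def by blast
next
  assume "\<exists>K :: 'a graph. solid_graph K \<and> graph_iso (induced T) K"
  then obtain K :: "'a graph" and f where K: "solid_graph K" and f: "bij_betw f T (verts K)"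
    and ed: "edges K = image f ` edges (induced T)" unfolding graph_iso_def by auto
  have inj: "inj_on f T" and im: "f ` T = verts K" using f by (auto simp: bij_betw_def)
  \<comment> \<open>The condition \<open>x \<noteq> y\<close> makes \<open>F\<close> irreflexive
    outright; no edge of \<open>K\<close> is lost, since \<open>f\<close> is injective on the ends
    of an edge.\<close>
  define F where "F x y \<longleftrightarrow> {x, y} \<in> edges K \<and> x \<noteq> y" for x y
  have pres: "F (f x) (f y) \<longleftrightarrow> E x y" if xy: "x \<in> T" "y \<in> T" for x y
  proof
    assume "F (f x) (f y)"
    then obtain g where g: "g \<in> edges (induced T)" "{f x, f y} = f ` g" unfolding F_def ed by auto
    then obtain a b where ab: "g = {a, b}" "a \<in> T" "b \<in> T" "E a b" by (auto elim: edge_inducedE)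
    have "f ` {x, y} = f ` {a, b}" using g(2) ab by simp
    then have "{x, y} = {a, b}" using inj_on_image_eq_iff[OF inj, of "{x, y}" "{a, b}"] xy ab by simp
    then show "E x y" using ab sym by (auto simp: doubleton_eq_iff)
  next
    assume "E x y"
    then have "{x, y} \<in> edges (induced T)" "x \<noteq> y" using xy by auto
    then have "f ` {x, y} \<in> edges K" "f x \<noteq> f y" using ed inj_onD[OF inj, of x y] xy by blast+
    then show "F (f x) (f y)" by (simp add: F_def)
  qed
  interpret adjacency_embedding E F f T
  proof unfold_locales
    show "F x y \<Longrightarrow> F y x" "\<not> F x x" for x y by (auto simp: F_def insert_commute)
  qed (use inj pres in auto)
  have "B.induced (verts K) = K"
  proof (rule B.induced_eqI)
    fix g assume "g \<in> edges K"
    then show "\<exists>x y. g = {x, y}" unfolding ed by (auto elim!: edge_inducedE)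
  next
    fix x y
    show "{x, y} \<in> edges K \<longleftrightarrow> x \<in> verts K \<and> y \<in> verts K \<and> F x y"
    proof
      assume xy: "{x, y} \<in> edges K"
      then obtain a b where ab: "a \<in> T" "b \<in> T" "E a b" "{x, y} = {f a, f b}" unfolding ed by (auto elim!: edge_inducedE)
      then have "f a \<noteq> f b" using inj_onD[OF inj, of a b] by auto
      then have "x \<noteq> y" "x \<in> f ` T" "y \<in> f ` T" using ab by (auto simp: doubleton_eq_iff)
      then show "x \<in> verts K \<and> y \<in> verts K \<and> F x y" using xy im by (simp add: F_def)
    qed (simp add: F_def)
  qed simp
  then have "B.solid (f ` T)" using K im by (simp add: B.solid_def)
  then show "solid T" using solid_image_iff by simp
qed

lemma inj_induced: "inj induced"
  by (metis injI verts_induced)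

lemma beth3_induced: "beth3 (induced V) = beth V"
proof -
  have "solids (induced V) = induced ` {T. T \<subseteq> V \<and> solid T}"
    unfolding solids_def induced_subgraph_iff solid_iso_iff[symmetric] by auto
  moreover have "induced_cycles (induced V) = induced ` {T. T \<subseteq> V \<and> cyc T}"
    unfolding induced_cycles_def cyc_def using induced_subgraph_iff by auto
  ultimately show ?thesis
    using inj_induced by (simp add: beth3_def beth_def card_image inj_on_subset[OF inj_induced])
qed

end

context adjacency_embedding begin

lemma beth_image: "B.beth (f ` S) = A.beth S"
proof -
  have injP: "inj_on (image f) X" if "X \<subseteq> Pow S" for X
    using inj_on_image_Pow[OF inj] that by (rule inj_on_subset)
  have "{T. T \<subseteq> f ` S \<and> B.solid T} = image f ` {T. T \<subseteq> S \<and> A.solid T}"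
    using solid_image_iff by (auto simp: subset_image_iff)
  moreover have "{T. T \<subseteq> f ` S \<and> B.cyc T} = image f ` {T. T \<subseteq> S \<and> A.cyc T}"
    using cyc_image_iff by (auto simp: subset_image_iff)
  moreover have "edges (B.induced (f ` S)) = image f ` edges (A.induced S)"
  proof (intro equalityI subsetI)
    fix g assume "g \<in> edges (B.induced (f ` S))"
    then obtain x y where "g = {x, y}" "x \<in> f ` S" "y \<in> f ` S" "F x y" by (rule B.edge_inducedE)
    then obtain a b where "a \<in> S" "b \<in> S" "E a b" "g = f ` {a, b}" using pres by auto
    then have "{a, b} \<in> edges (A.induced S)" "g = f ` {a, b}" by auto
    then show "g \<in> image f ` edges (A.induced S)" by (rule rev_image_eqI)
  next
    fix g assume "g \<in> image f ` edges (A.induced S)"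
    then show "g \<in> edges (B.induced (f ` S))" by (auto elim!: A.edge_inducedE simp: pres)
  qed
  moreover have "card (image f ` {T. T \<subseteq> S \<and> A.solid T}) = card {T. T \<subseteq> S \<and> A.solid T}"
    "card (image f ` {T. T \<subseteq> S \<and> A.cyc T}) = card {T. T \<subseteq> S \<and> A.cyc T}"
    "card (image f ` edges (A.induced S)) = card (edges (A.induced S))"
    using A.edges_induced_subset by (intro card_image injP; auto)+
  moreover have "card (f ` S) = card S" by (rule card_image[OF inj])
  ultimately show ?thesis by (simp add: B.beth_def A.beth_def)
qed

end

context edge_contraction begin

lemma subset_contraction: "T \<subseteq> A \<Longrightarrow> edge_contraction E u v w T"
  by unfold_locales (use fin notin uvw Euv Ew in \<open>auto intro: finite_subset\<close>)

theorem beth_contraction: "beth (insert w A) \<le> beth (insert u (insert v A))"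
proof -
  let ?n = "\<lambda>P. \<Sum>T\<in>Pow A. (of_bool (P T) :: nat)"
  have uvA: "u \<notin> insert v A" using uv notin by simp
  have split: "card {T. T \<subseteq> insert u (insert v A) \<and> P T} = card {T. T \<subseteq> A \<and> P T} + ?n (\<lambda>T. P (insert v T)) +
      (?n (\<lambda>T. P (insert u T)) + ?n (\<lambda>T. P (insert u (insert v T))))" for P
    unfolding card_subsets_insert[OF finite.insertI[OF fin] uvA] card_subsets_insert[OF fin notin(2)]
    by (simp only: card_subsets_sum[OF fin])
  have splitw: "card {T. T \<subseteq> insert w A \<and> P T} = card {T. T \<subseteq> A \<and> P T} + ?n (\<lambda>T. P (insert w T))" for P
    unfolding card_subsets_insert[OF fin notin(3)] by (simp only: card_subsets_sum[OF fin])
  let ?common = "{x \<in> A. E u x \<and> E v x}"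
  \<comment> \<open>Summed over all subsets, the last term of the local inequality counts
    singletons, one for each common neighbour.\<close>
  have "{T. T \<subseteq> A \<and> (\<exists>x. T = {x} \<and> E u x \<and> E v x)} = (\<lambda>x. {x}) ` ?common" by auto
  then have common: "?n (\<lambda>T. \<exists>x. T = {x} \<and> E u x \<and> E v x) = card ?common"
    by (simp add: card_subsets_sum[OF fin, symmetric] card_image)
  have "(\<Sum>T\<in>Pow A. of_bool (cyc (insert u T)) + of_bool (cyc (insert v T)) + of_bool (cyc (insert u (insert v T)))
      + of_bool (solid (insert w T)) :: nat)
    \<le> (\<Sum>T\<in>Pow A. of_bool (cyc (insert w T)) + of_bool (solid (insert u T)) + of_bool (solid (insert v T))
      + of_bool (solid (insert u (insert v T))) + of_bool (\<exists>x. T = {x} \<and> E u x \<and> E v x))"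
    by (intro sum_mono edge_contraction.local_inequality subset_contraction) auto
  then have main: "?n (\<lambda>T. cyc (insert u T)) + ?n (\<lambda>T. cyc (insert v T)) + ?n (\<lambda>T. cyc (insert u (insert v T)))
      + ?n (\<lambda>T. solid (insert w T))
    \<le> ?n (\<lambda>T. cyc (insert w T)) + ?n (\<lambda>T. solid (insert u T)) + ?n (\<lambda>T. solid (insert v T))
      + ?n (\<lambda>T. solid (insert u (insert v T))) + card ?common"
    unfolding sum.distrib common .
  \<comment> \<open>The edge \<open>uv\<close> contributes the \<open>Suc\<close> below and offsets
    the one vertex by which the two sides differ.\<close>
  have "{y \<in> insert v A. E u y} = insert v {y \<in> A. E u y}" using Euv by auto
  then have "card {y \<in> insert v A. E u y} = Suc (card {y \<in> A. E u y})" using fin notin(2) by simp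
  then have edges_uv: "card (edges (induced (insert u (insert v A)))) =
      card (edges (induced A)) + card {y \<in> A. E v y} + Suc (card {y \<in> A. E u y})"
    using card_edges_insert[OF finite.insertI[OF fin] uvA] card_edges_insert[OF fin notin(2)] by simp
  \<comment> \<open>Inclusion-exclusion: a common neighbour has one edge to \<open>u\<close> and one
    to \<open>v\<close>, but a single edge to \<open>w\<close>.\<close>
  have "{y \<in> A. E w y} = {y \<in> A. E u y} \<union> {y \<in> A. E v y}" "?common = {y \<in> A. E u y} \<inter> {y \<in> A. E v y}"
    using Ew by auto
  then have "card {y \<in> A. E w y} + card ?common = card {y \<in> A. E u y} + card {y \<in> A. E v y}"
    using card_Un_Int[of "{y \<in> A. E u y}" "{y \<in> A. E v y}"] fin by simp
  moreover have "card (edges (induced (insert w A))) = card (edges (induced A)) + card {y \<in> A. E w y}"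
    by (rule card_edges_insert[OF fin notin(3)])
  moreover have "card (insert u (insert v A)) = card A + 2" "card (insert w A) = card A + 1"
    using fin notin uv by simp_all
  ultimately show ?thesis
    unfolding beth_def split splitw edges_uv using main by linarith
qed

end

theorem theorem4p2p1:
  fixes G :: "'a graph" and e :: "'a set"
  assumes "fin_simple_graph G" and "e \<in> edges G"
  shows "beth3 (contract G e) \<le> beth3 G"
proof -
  let ?V = "verts G"
  have fin: "finite ?V" and simple: "\<And>f. f \<in> edges G \<Longrightarrow> f \<subseteq> ?V \<and> card f = 2"
    using assms(1) by (auto simp: fin_simple_graph_def)
  obtain u v where e: "e = {u, v}" "u \<noteq> v" using simple[OF assms(2)] by (auto simp: card_2_iff)
  have uvV: "u \<in> ?V" "v \<in> ?V" using simple[OF assms(2)] e by auto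
  define E where "E x y \<longleftrightarrow> {x, y} \<in> edges G" for x y
  define N where "N a \<longleftrightarrow> a \<in> ?V - e \<and> (\<exists>b\<in>e. {a, b} \<in> edges G)" for a
  \<comment> \<open>\<open>G\<close> is induced on the \<open>Some\<close> vertices, and the
    contracted graph on \<open>None\<close> and the vertices outside \<open>e\<close>. There is no
    edge between \<open>None\<close> and the ends of \<open>e\<close>, since \<open>N\<close> is
    confined to vertices outside \<open>e\<close>.\<close>
  define F where "F x y = (case x of None \<Rightarrow> (case y of None \<Rightarrow> False | Some b \<Rightarrow> N b)
    | Some a \<Rightarrow> (case y of None \<Rightarrow> N a | Some b \<Rightarrow> E a b))" for x y
  have EV: "x \<in> ?V \<and> y \<in> ?V \<and> x \<noteq> y" if "E x y" for x y
    using simple[of "{x, y}"] that by (auto simp: E_def)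
  have Esym: "E x y \<Longrightarrow> E y x" for x y by (simp add: E_def insert_commute)
  interpret adjacency_embedding E F Some ?V
  proof unfold_locales
    show "F x y \<Longrightarrow> F y x" for x y by (auto simp: F_def Esym split: option.splits)
    show "\<not> F x x" for x using EV by (auto simp: F_def split: option.splits)
  qed (use EV Esym in \<open>auto simp: F_def\<close>)
  have "A.induced ?V = G"
  proof (rule A.induced_eqI)
    show "\<exists>x y. f = {x, y}" if "f \<in> edges G" for f
      using simple[OF that] by (auto simp: card_2_iff)
  qed (use EV in \<open>auto simp: E_def\<close>)
  then have G: "beth3 G = B.beth (Some ` ?V)"
    using A.beth3_induced[of ?V] beth_image by simp
  have V: "Some ` ?V = insert (Some u) (insert (Some v) (Some ` (?V - e)))"
    using uvV e by auto
  have "B.induced (insert None (Some ` (?V - e))) = contract G e"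
  proof (rule B.induced_eqI)
    show "verts (contract G e) = insert None (Some ` (?V - e))" by (simp add: contract_def)
    show "\<exists>x y. f = {x, y}" if "f \<in> edges (contract G e)" for f
      using that by (auto simp: contract_def)
    fix x y
    show "{x, y} \<in> edges (contract G e) \<longleftrightarrow>
      x \<in> insert None (Some ` (?V - e)) \<and> y \<in> insert None (Some ` (?V - e)) \<and> F x y"
    proof (cases x; cases y)
      fix a b assume "x = Some a" "y = Some b"
      then show ?thesis using EV[of a b] Esym[of b a]
        by (auto simp: contract_def F_def doubleton_eq_iff E_def insert_commute)
    qed (auto simp: contract_def F_def N_def doubleton_eq_iff)
  qed
  then have contr: "beth3 (contract G e) = B.beth (insert None (Some ` (?V - e)))"
    using B.beth3_induced by metis
  interpret edge_contraction F "Some u" "Some v" None "Some ` (?V - e)"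
  proof unfold_locales
    show "F (Some u) (Some v)" using assms(2) e by (simp add: F_def E_def)
    fix x assume "x \<in> Some ` (?V - e)"
    then show "F None x \<longleftrightarrow> F (Some u) x \<or> F (Some v) x"
      by (auto simp: F_def N_def E_def e insert_commute)
  qed (use fin e in auto)
  show ?thesis using beth_contraction unfolding G V contr .
qed

end
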